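(* There is an absolute constant $C>0$ such that the following holds. Let $\gamma\in(0,1)$, $\xi=\frac{1-\gamma}{2n}$, $\delta\in(0,1)$, and let $\widehat\pi$ be an optimal policy of the discounted MDP $(\widehat P,\widetilde r,\gamma)$. Then with probability at least $1-\delta$, $$\|V^{\widehat\pi}_\gamma-V^\star_\gamma\|_\infty\le\frac{1}{1-\gamma}\sqrt{\frac{C\log^3\!\big(\frac{SAn}{(1-\gamma)\delta}\big)}{n}\Big(\|V^\star_\gamma\|_{\mathrm{sp}}+\min\{\|\widehat V^{\widehat\pi}_\gamma\|_{\mathrm{sp}},\|V^{\widehat\pi}_\gamma\|_{\mathrm{sp}}\}+1\Big)} .$$
   Context: $\mathcal S$ finite with $S$ states, $\mathcal A$ finite with $A$ actions; transition kernel $P$; known reward $r:\mathcal S\times\mathcal A\to[0,1]$. Policies stationary Markov; $P_\pi,r_\pi$ induced matrix/reward. Empirical kernel $\widehat P$: $n$ i.i.d. samples from each $P(\cdot|s,a)$, independent across pairs, $\widehat P(s'|s,a)$ = fraction equal to $s'$. Perturbed reward $\widetilde r=r+\Delta$, $\Delta(s,a)$ i.i.d. Uniform$[0,\xi]$ independent of the samples. $V^\pi_\gamma=(I-\gamma P_\pi)^{-1}r_\pi$, $V^\star_\gamma=\max_\pi V^\pi_\gamma$ (true model, reward $r$); $\widehat V^{\pi}_\gamma=(I-\gamma\widehat P_\pi)^{-1}r_\pi$ (empirical kernel, unperturbed reward). An optimal policy of $(\widehat P,\widetilde r,\gamma)$ maximizes $(I-\gamma\widehat P_\pi)^{-1}\widetilde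 r_\pi$ elementwise. $\|x\|_{\mathrm{sp}}=\max x-\min x$. *)

theory Defs
  imports "HOL-Probability.Probability"
begin

(* States are {..<S}, actions are {..<A} (natural-number indices), so that the
   absolute constant C can be quantified before S and A. *)

definition is_policy :: "nat \<Rightarrow> nat \<Rightarrow> (nat \<Rightarrow> nat \<Rightarrow> real) \<Rightarrow> bool" where
  "is_policy S A pol \<longleftrightarrow> (\<forall>s<S. (\<forall>a<A. 0 \<le> pol s a) \<and> (\<Sum>a<A. pol s a) = 1)"

definition kpol :: "nat \<Rightarrow> (nat \<Rightarrow> nat \<Rightarrow> nat \<Rightarrow> real) \<Rightarrow> (nat \<Rightarrow> nat \<Rightarrow> real) \<Rightarrow> nat \<Rightarrow> nat \<Rightarrow> real" where
  "kpol A K pol s s' = (\<Sum>a<A. pol s a * K s a s')"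

definition rpol :: "nat \<Rightarrow> (nat \<Rightarrow> nat \<Rightarrow> real) \<Rightarrow> (nat \<Rightarrow> nat \<Rightarrow> real) \<Rightarrow> nat \<Rightarrow> real" where
  "rpol A r pol s = (\<Sum>a<A. pol s a * r s a)"

definition mat_inv :: "nat \<Rightarrow> (nat \<Rightarrow> nat \<Rightarrow> real) \<Rightarrow> (nat \<Rightarrow> nat \<Rightarrow> real)" where
  "mat_inv S M = (THE N. (\<forall>i<S. \<forall>j<S.
        (\<Sum>k<S. N i k * M k j) = (if i = j then 1 else 0) \<and>
        (\<Sum>k<S. M i k * N k j) = (if i = j then 1 else 0)) \<and>
      (\<forall>i j. (S \<le> i \<or> S \<le> j) \<longrightarrow> N i j = 0))"

definition disc_value :: "nat \<Rightarrow> nat \<Rightarrow> (nat \<Rightarrow> nat \<Rightarrow> nat \<Rightarrow> real) \<Rightarrow> (nat \<Rightarrow> nat \<Rightarrow> real)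
    \<Rightarrow> real \<Rightarrow> (nat \<Rightarrow> nat \<Rightarrow> real) \<Rightarrow> nat \<Rightarrow> real" where
  "disc_value S A K r \<gamma> pol s =
     (\<Sum>s'<S. mat_inv S (\<lambda>i j. (if i = j then 1 else 0) - \<gamma> * kpol A K pol i j) s s' * rpol A r pol s')"

definition opt_value :: "nat \<Rightarrow> nat \<Rightarrow> (nat \<Rightarrow> nat \<Rightarrow> nat \<Rightarrow> real) \<Rightarrow> (nat \<Rightarrow> nat \<Rightarrow> real)
    \<Rightarrow> real \<Rightarrow> nat \<Rightarrow> real" where
  "opt_value S A K r \<gamma> s = (SUP pol \<in> {pol. is_policy S A pol}. disc_value S A K r \<gamma> pol s)"

definition is_optimal_policy :: "nat \<Rightarrow> nat \<Rightarrow> (nat \<Rightarrow> nat \<Rightarrow> nat \<Rightarrow> real) \<Rightarrow> (nat \<Rightarrow> nat \<Rightarrow> real)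
    \<Rightarrow> real \<Rightarrow> (nat \<Rightarrow> nat \<Rightarrow> real) \<Rightarrow> bool" where
  "is_optimal_policy S A K r \<gamma> pol \<longleftrightarrow> is_policy S A pol \<and>
     (\<forall>pol'. is_policy S A pol' \<longrightarrow> (\<forall>s<S. disc_value S A K r \<gamma> pol' s \<le> disc_value S A K r \<gamma> pol s))"

definition span_norm :: "nat \<Rightarrow> (nat \<Rightarrow> real) \<Rightarrow> real" where
  "span_norm S V = Max (V ` {..<S}) - Min (V ` {..<S})"

definition sup_norm :: "nat \<Rightarrow> (nat \<Rightarrow> real) \<Rightarrow> real" where
  "sup_norm S V = Max ((\<lambda>s. \<bar>V s\<bar>) ` {..<S})"

definition emp_kernel :: "nat \<Rightarrow> (nat \<times> nat \<Rightarrow> nat \<Rightarrow> nat) \<Rightarrow> nat \<Rightarrow> nat \<Rightarrow> nat \<Rightarrow> real" where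
  "emp_kernel n X s a s' = real (card {i. i < n \<and> X (s, a) i = s'}) / real n"

definition kernel_of :: "(nat \<Rightarrow> nat \<Rightarrow> nat pmf) \<Rightarrow> nat \<Rightarrow> nat \<Rightarrow> nat \<Rightarrow> real" where
  "kernel_of P s a s' = pmf (P s a) s'"

definition sample_measure :: "nat \<Rightarrow> nat \<Rightarrow> nat \<Rightarrow> (nat \<Rightarrow> nat \<Rightarrow> nat pmf) \<Rightarrow> (nat \<times> nat \<Rightarrow> nat \<Rightarrow> nat) measure" where
  "sample_measure S A n P =
     PiM ({..<S} \<times> {..<A}) (\<lambda>sa. PiM {..<n} (\<lambda>i. measure_pmf (P (fst sa) (snd sa))))"

definition noise_measure :: "nat \<Rightarrow> nat \<Rightarrow> real \<Rightarrow> (nat \<times> nat \<Rightarrow> real) measure" where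
  "noise_measure S A \<xi> = PiM ({..<S} \<times> {..<A}) (\<lambda>sa. uniform_measure lborel {0..\<xi>})"

definition data_measure :: "nat \<Rightarrow> nat \<Rightarrow> nat \<Rightarrow> (nat \<Rightarrow> nat \<Rightarrow> nat pmf) \<Rightarrow> real
    \<Rightarrow> ((nat \<times> nat \<Rightarrow> nat \<Rightarrow> nat) \<times> (nat \<times> nat \<Rightarrow> real)) measure" where
  "data_measure S A n P \<xi> = sample_measure S A n P \<Otimes>\<^sub>M noise_measure S A \<xi>"

end

theory Submission
  imports Defs
begin

text \<open>
  The error splits as \<open>V\<^sup>\<star> - V\<^sup>d = (V\<^sup>\<star> - U) + (U - V\<^sup>d)\<close>, where \<open>U\<close> is the optimal value of the
  empirical perturbed model and \<open>d\<close> its greedy policy.  Each part satisfies a recursion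
  \<open>D \<le> \<gamma> |(q - p) f| + \<gamma> k D\<close> along one of the two kernels \<open>p\<close>, \<open>q\<close>, with \<open>f\<close> one of the value
  functions.  Bernstein's inequality in the linear form
  \<open>|(q - p) f| \<le> t Var f + log / (n t)\<close> turns the variance into \<open>\<gamma> k f\<^sup>2 - f\<^sup>2\<close> up to terms of the
  size of the span, and the maximum principle for \<open>D + \<theta> f\<^sup>2 / 6\<close> then gives an error of order
  \<open>sqrt (span log / n) / (1 - \<gamma>)\<close> without a second factor \<open>1 / (1 - \<gamma>)\<close>.

  Bernstein's inequality needs \<open>f\<close> to be independent of the row of samples at the pair \<open>e\<close>.
  For this the value of the action \<open>e\<close> is overridden by a constant \<open>u\<close> from a fine net: the resulting
  optimal value does not depend on the row \<open>e\<close>, and for the right \<open>u\<close> it is close to \<open>U\<close>.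
  The uniform perturbation of the rewards creates, with high probability, a gap between the best two
  actions in each state, so that the greedy policy of the overridden model is exactly \<open>d\<close>.
\<close>

text \<open>The minimum of two spans reflects two ways to unroll \<open>U - V^d\<close>: along
  \<open>p\<close> with \<open>f = U\<close>, at the price of the empirical span, or along
  \<open>q\<close> with \<open>f = V^d\<close>, at the price of the true one. The second way is what
  calls for the reward gap: \<open>V^d\<close> depends on the row at \<open>e\<close> only through
  \<open>d\<close>, and once \<open>d\<close> can be recovered from the overridden model, a union
  over the net of values \<open>u\<close> replaces a union over all \<open>A^S\<close> policies. The
  spans are random, whereas \<open>t\<close> in Bernstein's inequality has to be fixed beforehand.
  Hence the deviation events are built for every integer \<open>N \<le> n\<close> with
  \<open>L * N \<le> n\<close> as a candidate bound on the spans, and the sample selects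
  \<open>N\<close> afterwards. If the selected \<open>N\<close> violates
  \<open>L * N \<le> n\<close>, the claimed bound already exceeds the trivial error
  \<open>1 / (1 - \<gamma>)\<close>. Functions are centred at state 0, which turns their size from
  \<open>1 / (1 - \<gamma>)\<close> into their span while the rewards stay bounded. The argument
  yields the first power of the logarithm; the cube in the theorem is a weakening.\<close>

section \<open>Averages and the maximum principle\<close>

definition stochastic :: "nat \<Rightarrow> (nat \<Rightarrow> nat \<Rightarrow> real) \<Rightarrow> bool" where
  "stochastic S k \<longleftrightarrow> (\<forall>s<S. (\<forall>s'<S. 0 \<le> k s s') \<and> (\<Sum>s'<S. k s s') = 1)"

lemma stochasticD:
  assumes "stochastic S k" "s < S"
  shows "s' < S \<Longrightarrow> 0 \<le> k s s'" and "(\<Sum>s'<S. k s s') = 1"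
  using assms by (auto simp: stochastic_def)

lemma convex_sum_le:
  fixes p x :: "nat \<Rightarrow> real"
  assumes "\<And>i. i < m \<Longrightarrow> 0 \<le> p i" "(\<Sum>i<m. p i) = 1" "\<And>i. i < m \<Longrightarrow> x i \<le> c"
  shows "(\<Sum>i<m. p i * x i) \<le> c"
proof -
  have "(\<Sum>i<m. p i * x i) \<le> (\<Sum>i<m. p i * c)"
    using assms by (intro sum_mono mult_left_mono) auto
  also have "\<dots> = c"
    using assms by (simp add: sum_distrib_right[symmetric])
  finally show ?thesis .
qed

lemma convex_sum_ge:
  fixes p x :: "nat \<Rightarrow> real"
  assumes "\<And>i. i < m \<Longrightarrow> 0 \<le> p i" "(\<Sum>i<m. p i) = 1" "\<And>i. i < m \<Longrightarrow> c \<le> x i"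
  shows "c \<le> (\<Sum>i<m. p i * x i)"
  using convex_sum_le[of m p "\<lambda>i. - x i" "- c"] assms by (simp add: sum_negf)

lemma convex_sum_abs_le:
  fixes p x :: "nat \<Rightarrow> real"
  assumes "\<And>i. i < m \<Longrightarrow> 0 \<le> p i" "(\<Sum>i<m. p i) = 1" "\<And>i. i < m \<Longrightarrow> \<bar>x i\<bar> \<le> c"
  shows "\<bar>\<Sum>i<m. p i * x i\<bar> \<le> c"
proof -
  have "x i \<le> c" "- c \<le> x i" if "i < m" for i
    using assms(3)[OF that] by auto
  then show ?thesis
    using convex_sum_le[OF assms(1,2), of x c] convex_sum_ge[OF assms(1,2), of "-c" x] by (simp add: abs_le_iff)
qed

text \<open>At a state where \<open>X\<close> attains its maximum \<open>m\<close>, the average of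
  \<open>X\<close> is at most \<open>m\<close>, so \<open>m \<le> c + \<gamma> * m\<close>.\<close>

lemma max_principle:
  fixes X :: "nat \<Rightarrow> real"
  assumes g: "0 \<le> \<gamma>" "\<gamma> < 1" and k: "stochastic S k"
    and X: "\<And>s. s < S \<Longrightarrow> X s \<le> c + \<gamma> * (\<Sum>s'<S. k s s' * X s')"
    and s: "s < S"
  shows "X s \<le> c / (1 - \<gamma>)"
proof -
  define m where "m = Max (X ` {..<S})"
  have fin: "finite (X ` {..<S})" "X ` {..<S} \<noteq> {}" using s by auto
  have le: "X i \<le> m" if "i < S" for i
    unfolding m_def using fin that by (intro Max_ge) auto
  have "m \<in> X ` {..<S}" unfolding m_def using fin by (rule Max_in)
  then obtain s0 where s0: "s0 < S" "X s0 = m" by auto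
  have "(\<Sum>s'<S. k s0 s' * X s') \<le> m"
    using stochasticD[OF k s0(1)] le by (intro convex_sum_le) auto
  then have "m \<le> c + \<gamma> * m"
    using X[OF s0(1)] s0(2) g(1) by (smt (verit) mult_left_mono)
  then have "m \<le> c / (1 - \<gamma>)"
    using g(2) by (simp add: pos_le_divide_eq algebra_simps)
  then show ?thesis using le[OF s] by simp
qed

section \<open>Fixed points of contractions and the resolvent\<close>

text \<open>Value iteration started at 0 instead of an abstract fixed point: every iterate is an
  explicit function of the data, so measurability and independence from single data entries are
  proved by induction on \<open>k\<close> and pass to the limit.\<close>

definition fix_lim :: "((nat \<Rightarrow> real) \<Rightarrow> nat \<Rightarrow> real) \<Rightarrow> nat \<Rightarrow> real" where
  "fix_lim T s = lim (\<lambda>k. (T ^^ k) (\<lambda>_. 0) s)"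

definition contraction :: "nat \<Rightarrow> real \<Rightarrow> ((nat \<Rightarrow> real) \<Rightarrow> nat \<Rightarrow> real) \<Rightarrow> bool" where
  "contraction S \<gamma> T \<longleftrightarrow>
    (\<forall>v w c. (\<forall>s<S. \<bar>v s - w s\<bar> \<le> c) \<longrightarrow> (\<forall>s<S. \<bar>T v s - T w s\<bar> \<le> \<gamma> * c))"

lemma contractionD:
  assumes "contraction S \<gamma> T" "\<And>s. s < S \<Longrightarrow> \<bar>v s - w s\<bar> \<le> c" "s < S"
  shows "\<bar>T v s - T w s\<bar> \<le> \<gamma> * c"
  using assms unfolding contraction_def by blast

lemma fix_lim_fixed:
  assumes T: "contraction S \<gamma> T" and g: "0 \<le> \<gamma>" "\<gamma> < 1" and s: "s < S"
  shows "T (fix_lim T) s = fix_lim T s"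
proof -
  define x where "x = (\<lambda>k. (T ^^ k) (\<lambda>_. 0::real))"
  have xS: "x (Suc k) = T (x k)" for k by (simp add: x_def)
  define c where "c = (\<Sum>s<S. \<bar>x (Suc 0) s - x 0 s\<bar>)"
  have step: "\<forall>s<S. \<bar>x (Suc k) s - x k s\<bar> \<le> \<gamma> ^ k * c" for k
  proof (induction k)
    case 0
    show ?case unfolding c_def by (auto intro!: member_le_sum[where f = "\<lambda>s. \<bar>x (Suc 0) s - x 0 s\<bar>"])
  next
    case (Suc k)
    show ?case
    proof (intro allI impI)
      fix s assume "s < S"
      then have "\<bar>T (x (Suc k)) s - T (x k) s\<bar> \<le> \<gamma> * (\<gamma> ^ k * c)"
        using Suc by (intro contractionD[OF T]) auto
      then show "\<bar>x (Suc (Suc k)) s - x (Suc k) s\<bar> \<le> \<gamma> ^ Suc k * c"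
        by (simp add: xS mult.assoc)
    qed
  qed
  have conv: "(\<lambda>k. x k s) \<longlonglongrightarrow> fix_lim T s" if "s < S" for s
  proof -
    have "summable (\<lambda>k. \<gamma> ^ k * c)" using g by (intro summable_mult2 summable_geometric) auto
    then have "summable (\<lambda>k. x (Suc k) s - x k s)"
      by (rule summable_comparison_test') (use step that in auto)
    then have "convergent (\<lambda>m. \<Sum>k<m. x (Suc k) s - x k s)"
      by (simp add: summable_iff_convergent)
    then have "convergent (\<lambda>m. x m s - x 0 s)"
      by (simp add: sum_lessThan_telescope[of "\<lambda>k. x k s"])
    then have "convergent (\<lambda>m. x m s)"
      by (subst convergent_diff_const_right_iff[symmetric]) 
    then show ?thesis unfolding fix_lim_def x_def by (simp add: convergent_LIMSEQ_iff)
  qed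
  have "(\<lambda>k. T (x k) s) \<longlonglongrightarrow> T (fix_lim T) s"
  proof (rule LIMSEQ_I)
    fix e :: real assume e: "e > 0"
    have "\<forall>i\<in>{..<S}. \<forall>\<^sub>F k in sequentially. \<bar>x k i - fix_lim T i\<bar> < e"
      using conv e by (auto simp: tendsto_iff dist_real_def)
    then have "\<forall>\<^sub>F k in sequentially. \<forall>i\<in>{..<S}. \<bar>x k i - fix_lim T i\<bar> < e"
      by (intro eventually_ball_finite) auto
    then obtain k0 where k0: "\<And>k i. k \<ge> k0 \<Longrightarrow> i < S \<Longrightarrow> \<bar>x k i - fix_lim T i\<bar> < e"
      by (auto simp: eventually_sequentially)
    have "norm (T (x k) s - T (fix_lim T) s) < e" if "k \<ge> k0" for k
    proof -
      have "\<bar>T (x k) s - T (fix_lim T) s\<bar> \<le> \<gamma> * e"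
        using k0[OF that] s by (intro contractionD[OF T]) (auto intro: less_imp_le)
      also have "\<dots> < e" using e g by simp
      finally show ?thesis by simp
    qed
    then show "\<exists>no. \<forall>n\<ge>no. norm (T (x n) s - T (fix_lim T) s) < e" by auto
  qed
  moreover have "(\<lambda>k. T (x k) s) \<longlonglongrightarrow> fix_lim T s"
    using LIMSEQ_Suc[OF conv[OF s]] by (simp add: xS)
  ultimately show ?thesis by (rule LIMSEQ_unique)
qed

lemma policy_eval_contraction:
  assumes "stochastic S k" "0 \<le> \<gamma>"
  shows "contraction S \<gamma> (\<lambda>v s. b s + \<gamma> * (\<Sum>s'<S. k s s' * v s'))"
proof -
  have "\<bar>b s + \<gamma> * (\<Sum>s'<S. k s s' * v s') - (b s + \<gamma> * (\<Sum>s'<S. k s s' * w s'))\<bar> \<le> \<gamma> * c"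
    if "\<forall>s<S. \<bar>v s - w s\<bar> \<le> c" "s < S" for v w c s
  proof -
    have "\<bar>\<Sum>s'<S. k s s' * (v s' - w s')\<bar> \<le> c"
      using stochasticD[OF assms(1) that(2)] that(1) by (intro convex_sum_abs_le) auto
    then have "\<gamma> * \<bar>\<Sum>s'<S. k s s' * (v s' - w s')\<bar> \<le> \<gamma> * c"
      using assms(2) by (rule mult_left_mono)
    moreover have "b s + \<gamma> * (\<Sum>s'<S. k s s' * v s') - (b s + \<gamma> * (\<Sum>s'<S. k s s' * w s'))
       = \<gamma> * (\<Sum>s'<S. k s s' * (v s' - w s'))"
      by (simp add: algebra_simps sum_subtractf)
    ultimately show ?thesis using assms(2) by (simp add: abs_mult)
  qed
  then show ?thesis unfolding contraction_def by blast
qed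

lemma policy_eval_unique:
  assumes k: "stochastic S k" and g: "0 \<le> \<gamma>" "\<gamma> < 1"
    and v: "\<And>s. s < S \<Longrightarrow> v s = b s + \<gamma> * (\<Sum>s'<S. k s s' * v s')"
    and w: "\<And>s. s < S \<Longrightarrow> w s = b s + \<gamma> * (\<Sum>s'<S. k s s' * w s')"
    and s: "s < S"
  shows "v s = w s"
proof -
  have "v s - w s \<le> 0 + \<gamma> * (\<Sum>s'<S. k s s' * (v s' - w s'))"
       "w s - v s \<le> 0 + \<gamma> * (\<Sum>s'<S. k s s' * (w s' - v s'))" if "s < S" for s
    using v[OF that] w[OF that] by (simp_all add: right_diff_distrib sum_subtractf)
  from max_principle[OF g k this(1) s] max_principle[OF g k this(2) s]
  show ?thesis by simp
qed

text \<open>\<open>mat_inv\<close> is a definite description, so existence and uniqueness of the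
  two-sided inverse are both required. Column \<open>j\<close> of the inverse is the fixed point of
  policy evaluation whose reward is the unit vector at \<open>j\<close>.\<close>

lemma mat_inv_resolvent:
  assumes k: "stochastic S k" and g: "0 \<le> \<gamma>" "\<gamma> < 1"
    and ij: "i < S" "j < S"
  defines "M \<equiv> \<lambda>i j. (if i = j then 1 else 0) - \<gamma> * k i j"
  shows "(\<Sum>l<S. M i l * mat_inv S M l j) = (if i = j then 1 else 0)"
proof -
  define Q where "Q = (\<lambda>N. (\<forall>i<S. \<forall>j<S.
        (\<Sum>l<S. N i l * M l j) = (if i = j then 1 else 0) \<and>
        (\<Sum>l<S. M i l * N l j) = (if i = j then 1 else 0)) \<and>
      (\<forall>i j. (S \<le> i \<or> S \<le> j) \<longrightarrow> N i j = (0::real)))"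
  define R where "R = (\<lambda>j. fix_lim (\<lambda>v s. (if s = j then 1 else 0) + \<gamma> * (\<Sum>s'<S. k s s' * v s')))"
  define N where "N = (\<lambda>i j. if i < S \<and> j < S then R j i else 0)"
  have M: "(\<Sum>l<S. M i l * v l) = v i - \<gamma> * (\<Sum>l<S. k i l * v l)" if "i < S" for i and v :: "nat \<Rightarrow> real"
  proof -
    have "(\<Sum>l<S. M i l * v l) = (\<Sum>l<S. (if i = l then v l else 0) - \<gamma> * (k i l * v l))"
      unfolding M_def by (intro sum.cong) (auto simp: algebra_simps)
    also have "\<dots> = v i - \<gamma> * (\<Sum>l<S. k i l * v l)"
      using that by (simp add: sum_subtractf sum.delta sum_distrib_left)
    finally show ?thesis .
  qed
  have R: "R j i = (if i = j then 1 else 0) + \<gamma> * (\<Sum>s'<S. k i s' * R j s')" if "i < S" for i j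
    using fix_lim_fixed[OF policy_eval_contraction[OF k g(1)] g that, symmetric,
        of "\<lambda>s. if s = j then 1 else 0"] unfolding R_def .
  have MN: "(\<Sum>l<S. M i l * N l j) = (if i = j then 1 else 0)" if "i < S" "j < S" for i j
  proof -
    have "(\<Sum>l<S. M i l * N l j) = (\<Sum>l<S. M i l * R j l)"
      using that by (intro sum.cong) (auto simp: N_def)
    also have "\<dots> = (if i = j then 1 else 0)" using R[OF that(1), of j] M[OF that(1)] by simp
    finally show ?thesis .
  qed
  \<comment> \<open>Column \<open>j\<close> of the product \<open>N M\<close> and the unit vector at
    \<open>j\<close> solve the same evaluation equation, with column \<open>j\<close> of
    \<open>M\<close> as reward; uniqueness identifies them.\<close>
  have NM: "(\<Sum>l<S. N i l * M l j) = (if i = j then 1 else 0)" if ij: "i < S" "j < S" for i j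
  proof -
    define y where "y = (\<lambda>i. \<Sum>l<S. N i l * M l j)"
    have "(\<Sum>l<S. M i l * y l) = M i j" if "i < S" for i
    proof -
      have "(\<Sum>l<S. M i l * y l) = (\<Sum>l<S. \<Sum>m<S. M i l * N l m * M m j)"
        by (simp add: y_def sum_distrib_left mult.assoc)
      also have "\<dots> = (\<Sum>m<S. (\<Sum>l<S. M i l * N l m) * M m j)"
        by (subst sum.swap) (simp add: sum_distrib_right)
      also have "\<dots> = (\<Sum>m<S. (if i = m then 1 else 0) * M m j)"
        using that MN by (intro sum.cong) auto
      also have "\<dots> = M i j" using that by (simp add: if_distrib[of "\<lambda>x. x * _"] sum.delta cong: if_cong)
      finally show ?thesis .
    qed
    then have y: "y i = M i j + \<gamma> * (\<Sum>l<S. k i l * y l)" if "i < S" for i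
      using M[OF that, of y] that by fastforce
    have "(if i = j then 1 else 0) = M i j + \<gamma> * (\<Sum>l<S. k i l * (if l = j then 1 else 0))" for i
      using ij by (simp add: M_def if_distrib[of "\<lambda>x. _ * x"] sum.delta cong: if_cong)
    from policy_eval_unique[OF k g y this ij(1)] show ?thesis by (simp add: y_def)
  qed
  have QN: "Q N" using MN NM by (auto simp: Q_def N_def)
  have "N' = N" if Q': "Q N'" for N'
  proof (intro ext)
    fix i j
    show "N' i j = N i j"
    proof (cases "i < S \<and> j < S")
      case False then show ?thesis using Q' QN by (auto simp: Q_def)
    next
      case True
      have "N' i j = (\<Sum>m<S. N' i m * (\<Sum>l<S. M m l * N l j))"
        using True MN by (simp add: if_distrib[of "\<lambda>x. _ * x"] sum.delta cong: if_cong)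
      also have "\<dots> = (\<Sum>l<S. (\<Sum>m<S. N' i m * M m l) * N l j)"
        by (simp add: sum_distrib_left sum_distrib_right mult.assoc) (rule sum.swap)
      also have "\<dots> = (\<Sum>l<S. (if i = l then 1 else 0) * N l j)"
        using True Q' by (intro sum.cong) (auto simp: Q_def)
      also have "\<dots> = N i j"
        using True by (simp add: if_distrib[of "\<lambda>x. x * _"] sum.delta cong: if_cong)
      finally show ?thesis .
    qed
  qed
  then have "mat_inv S M = N"
    unfolding mat_inv_def Q_def[symmetric] by (rule the_equality[of Q, OF QN])
  then show ?thesis using MN ij by simp
qed

lemma disc_value_eq:
  assumes k: "stochastic S (kpol A K pol)" and g: "0 \<le> \<gamma>" "\<gamma> < 1" and s: "s < S"
  shows "disc_value S A K r \<gamma> pol s =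
    rpol A r pol s + \<gamma> * (\<Sum>s'<S. kpol A K pol s s' * disc_value S A K r \<gamma> pol s')"
proof -
  define M where "M = (\<lambda>i j. (if i = j then 1 else 0) - \<gamma> * kpol A K pol i j)"
  define v where "v = disc_value S A K r \<gamma> pol"
  have v: "v s = (\<Sum>j<S. mat_inv S M s j * rpol A r pol j)" for s
    by (simp add: v_def disc_value_def M_def)
  have "(\<Sum>l<S. M s l * v l) = (\<Sum>l<S. \<Sum>j<S. M s l * mat_inv S M l j * rpol A r pol j)"
    by (simp add: v sum_distrib_left mult.assoc)
  also have "\<dots> = (\<Sum>j<S. (\<Sum>l<S. M s l * mat_inv S M l j) * rpol A r pol j)"
    by (subst sum.swap) (simp add: sum_distrib_right)
  also have "\<dots> = (\<Sum>j<S. (if s = j then 1 else 0) * rpol A r pol j)"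
    unfolding M_def using mat_inv_resolvent[OF k g s] by (intro sum.cong) auto
  also have "\<dots> = rpol A r pol s"
    using s by (simp add: if_distrib[of "\<lambda>x. x * _"] sum.delta cong: if_cong)
  finally have "(\<Sum>l<S. M s l * v l) = rpol A r pol s" .
  moreover have "(\<Sum>l<S. M s l * v l) = (\<Sum>l<S. (if s = l then v l else 0) - \<gamma> * (kpol A K pol s l * v l))"
    unfolding M_def by (intro sum.cong) (auto simp: algebra_simps)
  moreover have "\<dots> = v s - \<gamma> * (\<Sum>l<S. kpol A K pol s l * v l)"
    using s by (simp add: sum_subtractf sum.delta sum_distrib_left)
  ultimately show ?thesis unfolding v_def by simp
qed

definition kernel :: "nat \<Rightarrow> nat \<Rightarrow> (nat \<Rightarrow> nat \<Rightarrow> nat \<Rightarrow> real) \<Rightarrow> bool" where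
  "kernel S A K \<longleftrightarrow> (\<forall>s<S. \<forall>a<A. (\<forall>s'<S. 0 \<le> K s a s') \<and> (\<Sum>s'<S. K s a s') = 1)"

lemma kernelD:
  assumes "kernel S A K" "s < S" "a < A"
  shows "s' < S \<Longrightarrow> 0 \<le> K s a s'" "(\<Sum>s'<S. K s a s') = 1"
  using assms by (auto simp: kernel_def)

lemma kpol_sum: "(\<Sum>s'<S. kpol A K pol s s' * v s') = (\<Sum>a<A. pol s a * (\<Sum>s'<S. K s a s' * v s'))"
  unfolding kpol_def by (simp add: sum_distrib_left sum_distrib_right mult.assoc) (rule sum.swap)

lemma stochastic_kpol:
  assumes K: "kernel S A K" and pol: "is_policy S A pol"
  shows "stochastic S (kpol A K pol)"
  unfolding stochastic_def
proof (intro allI impI conjI)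
  fix s assume s: "s < S"
  show "0 \<le> kpol A K pol s s'" if "s' < S" for s'
    using K pol s that by (auto simp: kpol_def kernel_def is_policy_def intro!: sum_nonneg)
  have "(\<Sum>s'<S. kpol A K pol s s') = (\<Sum>a<A. pol s a * (\<Sum>s'<S. K s a s'))"
    using kpol_sum[of A K pol s "\<lambda>_. 1" S] by simp
  also have "\<dots> = (\<Sum>a<A. pol s a)" using K s by (intro sum.cong) (auto simp: kernel_def)
  also have "\<dots> = 1" using pol s by (auto simp: is_policy_def)
  finally show "(\<Sum>s'<S. kpol A K pol s s') = 1" .
qed

definition det_policy :: "(nat \<Rightarrow> nat) \<Rightarrow> nat \<Rightarrow> nat \<Rightarrow> real" where
  "det_policy d s a = (if a = d s then 1 else 0)"

lemma is_policy_det_policy: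
  assumes "\<And>s. s < S \<Longrightarrow> d s < A"
  shows "is_policy S A (det_policy d)"
  using assms by (auto simp: is_policy_def det_policy_def sum.delta)

lemma kpol_det_policy: "d s < A \<Longrightarrow> kpol A K (det_policy d) s s' = K s (d s) s'"
  and rpol_det_policy: "d s < A \<Longrightarrow> rpol A r (det_policy d) s = r s (d s)"
  by (simp_all add: kpol_def rpol_def det_policy_def if_distrib[of "\<lambda>x. x * _"] sum.delta cong: if_cong)

lemma disc_value_policy_eq:
  assumes K: "kernel S A K" and pol: "is_policy S A pol" and g: "0 \<le> \<gamma>" "\<gamma> < 1" and s: "s < S"
  shows "disc_value S A K r \<gamma> pol s =
    (\<Sum>a<A. pol s a * (r s a + \<gamma> * (\<Sum>s'<S. K s a s' * disc_value S A K r \<gamma> pol s')))"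
  by (subst disc_value_eq[OF stochastic_kpol[OF K pol] g s])
     (simp add: rpol_def kpol_sum sum.distrib sum_distrib_left algebra_simps)

lemma disc_value_det_eq:
  assumes K: "kernel S A K" and d: "\<And>s. s < S \<Longrightarrow> d s < A" and g: "0 \<le> \<gamma>" "\<gamma> < 1" and s: "s < S"
  shows "disc_value S A K r \<gamma> (det_policy d) s =
    r s (d s) + \<gamma> * (\<Sum>s'<S. K s (d s) s' * disc_value S A K r \<gamma> (det_policy d) s')"
  using disc_value_eq[OF stochastic_kpol[OF K is_policy_det_policy[OF d]] g s, where r = r]
  by (simp add: rpol_det_policy[where d = d and s = s, OF d[OF s]] kpol_det_policy[where d = d and s = s, OF d[OF s]])

section \<open>The optimality equation with one overridden action value\<close>

text \<open>The maximum principle for the nonlinear optimality operator. The step may assume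
  \<open>0 \<le> b\<close> because at an overridden pair two action values differ by 0, which is at
  most \<open>\<gamma> * b\<close> only for such \<open>b\<close>.\<close>

lemma bootstrap_bound:
  fixes X :: "nat \<Rightarrow> real"
  assumes g: "0 \<le> \<gamma>" "\<gamma> < 1" and c: "0 \<le> c"
    and X: "\<And>s b. s < S \<Longrightarrow> 0 \<le> b \<Longrightarrow> (\<And>s'. s' < S \<Longrightarrow> X s' \<le> b) \<Longrightarrow> X s \<le> c + \<gamma> * b"
    and s: "s < S"
  shows "X s \<le> c / (1 - \<gamma>)"
proof -
  define m where "m = Max (X ` {..<S})"
  have fin: "finite (X ` {..<S})" "X ` {..<S} \<noteq> {}" using s by auto
  have le: "X i \<le> m" if "i < S" for i
    unfolding m_def using fin that by (intro Max_ge) auto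
  show ?thesis
  proof (cases "m \<le> 0")
    case True
    moreover have "0 \<le> c / (1 - \<gamma>)" using g c by simp
    ultimately show ?thesis using le[OF s] by linarith
  next
    case False
    have "m \<in> X ` {..<S}" unfolding m_def using fin by (rule Max_in)
    then obtain s0 where s0: "s0 < S" "X s0 = m" by auto
    have "m \<le> c + \<gamma> * m" using X[OF s0(1), of m] le False s0 by simp
    then have "m \<le> c / (1 - \<gamma>)"
      using g(2) by (simp add: pos_le_divide_eq algebra_simps)
    then show ?thesis using le[OF s] by simp
  qed
qed

text \<open>Freezing the value at \<open>e\<close> removes the kernel row and also the reward at
  \<open>e\<close> from the equation; the first serves the sample bounds, the second the bound on
  near ties.\<close>

definition action_value ::
  "nat \<Rightarrow> real \<Rightarrow> (nat \<Rightarrow> nat \<Rightarrow> nat \<Rightarrow> real) \<Rightarrow> (nat \<Rightarrow> nat \<Rightarrow> real) \<Rightarrow> nat \<times> nat \<Rightarrow> real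
    \<Rightarrow> (nat \<Rightarrow> real) \<Rightarrow> nat \<Rightarrow> nat \<Rightarrow> real" where
  "action_value S \<gamma> K r e u v s a =
     (if (s, a) = e then u else r s a + \<gamma> * (\<Sum>s'<S. K s a s' * v s'))"

definition bellman_value ::
  "nat \<Rightarrow> nat \<Rightarrow> real \<Rightarrow> (nat \<Rightarrow> nat \<Rightarrow> nat \<Rightarrow> real) \<Rightarrow> (nat \<Rightarrow> nat \<Rightarrow> real) \<Rightarrow> nat \<times> nat \<Rightarrow> real
    \<Rightarrow> nat \<Rightarrow> real" where
  "bellman_value S A \<gamma> K r e u = fix_lim (\<lambda>v s. Max (action_value S \<gamma> K r e u v s ` {..<A}))"

lemma Max_le_Max_plus:
  fixes f g :: "nat \<Rightarrow> real"
  assumes "0 < A" "\<And>a. a < A \<Longrightarrow> f a \<le> g a + c"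
  shows "Max (f ` {..<A}) \<le> Max (g ` {..<A}) + c"
proof -
  have "Max (f ` {..<A}) \<in> f ` {..<A}" using assms(1) by (intro Max_in) auto
  then obtain a where a: "a < A" "Max (f ` {..<A}) = f a" by auto
  have "g a \<le> Max (g ` {..<A})" using a by (intro Max_ge) auto
  then show ?thesis using assms(2)[OF a(1)] a(2) by simp
qed

lemma kernel_sum_diff_le:
  assumes K: "kernel S A K" and g: "0 \<le> \<gamma>" and sa: "s < S" "a < A"
    and b: "\<And>s'. s' < S \<Longrightarrow> v s' - w s' \<le> b"
  shows "\<gamma> * (\<Sum>s'<S. K s a s' * v s') - \<gamma> * (\<Sum>s'<S. K s a s' * w s') \<le> \<gamma> * b"
proof -
  have "(\<Sum>s'<S. K s a s' * (v s' - w s')) \<le> b"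
    using kernelD[OF K sa] b by (intro convex_sum_le) auto
  then have "\<gamma> * (\<Sum>s'<S. K s a s' * (v s' - w s')) \<le> \<gamma> * b"
    using g by (rule mult_left_mono)
  then show ?thesis by (simp add: algebra_simps sum_subtractf)
qed

lemma action_value_diff_le:
  assumes K: "kernel S A K" and g: "0 \<le> \<gamma>" and sa: "s < S" "a < A"
    and b: "0 \<le> b" "\<And>s'. s' < S \<Longrightarrow> v s' - w s' \<le> b"
  shows "action_value S \<gamma> K r e u v s a - action_value S \<gamma> K r e u w s a \<le> \<gamma> * b"
  using kernel_sum_diff_le[OF K g sa, of v w b] b g by (auto simp: action_value_def)

lemma bellman_contraction:
  assumes K: "kernel S A K" and g: "0 \<le> \<gamma>" and A: "0 < A"
  shows "contraction S \<gamma> (\<lambda>v s. Max (action_value S \<gamma> K r e u v s ` {..<A}))"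
  unfolding contraction_def
proof (intro allI impI)
  fix v w :: "nat \<Rightarrow> real" and c :: real and s assume vw: "\<forall>s<S. \<bar>v s - w s\<bar> \<le> c" and s: "s < S"
  have c: "0 \<le> c" using vw s by (meson abs_ge_zero order_trans)
  have le: "v s' - w s' \<le> c" "w s' - v s' \<le> c" if "s' < S" for s' using vw that by (auto simp: abs_le_iff)
  have "Max (action_value S \<gamma> K r e u v s ` {..<A}) \<le> Max (action_value S \<gamma> K r e u w s ` {..<A}) + \<gamma> * c"
    using action_value_diff_le[OF K g s _ c, where v = v and w = w and r = r and e = e and u = u] le
    by (intro Max_le_Max_plus[OF A]) (auto simp: algebra_simps)
  moreover have "Max (action_value S \<gamma> K r e u w s ` {..<A}) \<le> Max (action_value S \<gamma> K r e u v s ` {..<A}) + \<gamma> * c"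
    using action_value_diff_le[OF K g s _ c, where v = w and w = v and r = r and e = e and u = u] le
    by (intro Max_le_Max_plus[OF A]) (auto simp: algebra_simps)
  ultimately show "\<bar>Max (action_value S \<gamma> K r e u v s ` {..<A}) - Max (action_value S \<gamma> K r e u w s ` {..<A})\<bar> \<le> \<gamma> * c"
    by simp
qed

locale discounted =
  fixes S A :: nat and \<gamma> :: real
  assumes S_pos: "0 < S" and A_pos: "0 < A" and discount: "0 < \<gamma>" "\<gamma> < 1"
begin

lemma discount': "0 \<le> \<gamma>" using discount by simp

lemma bellman_value_Max:
  assumes K: "kernel S A K" and s: "s < S"
  shows "bellman_value S A \<gamma> K r e u s =
    Max (action_value S \<gamma> K r e u (bellman_value S A \<gamma> K r e u) s ` {..<A})"
  unfolding bellman_value_def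
  by (rule fix_lim_fixed[OF bellman_contraction[OF K discount' A_pos] discount' discount(2) s, symmetric])

lemma action_value_le_bellman:
  assumes K: "kernel S A K" and s: "s < S" and a: "a < A"
  shows "action_value S \<gamma> K r e u (bellman_value S A \<gamma> K r e u) s a \<le> bellman_value S A \<gamma> K r e u s"
proof -
  have "action_value S \<gamma> K r e u (bellman_value S A \<gamma> K r e u) s a
      \<le> Max (action_value S \<gamma> K r e u (bellman_value S A \<gamma> K r e u) s ` {..<A})"
    using a by (intro Max_ge) auto
  then show ?thesis using bellman_value_Max[OF K s, of r e u] by simp
qed

lemma bellman_value_attained:
  assumes K: "kernel S A K" and s: "s < S"
  obtains a where "a < A"
    "bellman_value S A \<gamma> K r e u s = action_value S \<gamma> K r e u (bellman_value S A \<gamma> K r e u) s a"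
proof -
  have "Max (action_value S \<gamma> K r e u (bellman_value S A \<gamma> K r e u) s ` {..<A}) \<in>
    action_value S \<gamma> K r e u (bellman_value S A \<gamma> K r e u) s ` {..<A}"
    using A_pos by (intro Max_in) auto
  then show ?thesis using that bellman_value_Max[OF K s, of r e u] by auto
qed

text \<open>Comparison with an approximate supersolution: the maximizing action of the fixed point
  is tested on \<open>v\<close>. The companion \<open>bellman_value_ge\<close> needs only one good
  action per state, since a subsolution is compared with a maximum.\<close>

lemma bellman_value_le:
  assumes K: "kernel S A K" and c: "0 \<le> c"
    and v: "\<And>s a. s < S \<Longrightarrow> a < A \<Longrightarrow> action_value S \<gamma> K r e u v s a \<le> v s + c"
    and s: "s < S"
  shows "bellman_value S A \<gamma> K r e u s \<le> v s + c / (1 - \<gamma>)"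
proof -
  let ?U = "bellman_value S A \<gamma> K r e u"
  have "?U s - v s \<le> c / (1 - \<gamma>)"
  proof (rule bootstrap_bound[OF discount' discount(2) c _ s])
    fix s b assume s: "s < S" and b: "0 \<le> b" "\<And>s'. s' < S \<Longrightarrow> ?U s' - v s' \<le> b"
    obtain a where a: "a < A" "?U s = action_value S \<gamma> K r e u ?U s a"
      using bellman_value_attained[OF K s] .
    show "?U s - v s \<le> c + \<gamma> * b"
      using action_value_diff_le[OF K discount' s a(1) b(1), where v = ?U and w = v and r = r and e = e and u = u, OF b(2)] v[OF s a(1)] a(2) by simp
  qed
  then show ?thesis by simp
qed

lemma bellman_value_ge:
  assumes K: "kernel S A K" and c: "0 \<le> c"
    and v: "\<And>s. s < S \<Longrightarrow> \<exists>a<A. v s \<le> action_value S \<gamma> K r e u v s a + c"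
    and s: "s < S"
  shows "v s \<le> bellman_value S A \<gamma> K r e u s + c / (1 - \<gamma>)"
proof -
  let ?U = "bellman_value S A \<gamma> K r e u"
  have "v s - ?U s \<le> c / (1 - \<gamma>)"
  proof (rule bootstrap_bound[OF discount' discount(2) c _ s])
    fix s b assume s: "s < S" and b: "0 \<le> b" "\<And>s'. s' < S \<Longrightarrow> v s' - ?U s' \<le> b"
    obtain a where a: "a < A" "v s \<le> action_value S \<gamma> K r e u v s a + c"
      using v[OF s] by auto
    show "v s - ?U s \<le> c + \<gamma> * b"
      using action_value_diff_le[OF K discount' s a(1) b(1), where v = v and w = ?U and r = r and e = e and u = u, OF b(2)]
        action_value_le_bellman[OF K s a(1), of r e u] a(2) by simp
  qed
  then show ?thesis by simp
qed

lemma kernel_sum_shift: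
  assumes "kernel S A K" "s < S" "a < A"
  shows "(\<Sum>s'<S. K s a s' * (v s' + c)) = (\<Sum>s'<S. K s a s' * v s') + c"
  using kernelD(2)[OF assms] by (simp add: distrib_left sum.distrib sum_distrib_right[symmetric])

text \<open>The value for \<open>u'\<close>, raised everywhere by \<open>\<bar>u - u'\<bar>\<close>,
  is a supersolution for \<open>u\<close>: discounting shrinks the shift at all other pairs.\<close>

lemma bellman_value_lipschitz:
  assumes K: "kernel S A K" and s: "s < S"
  shows "\<bar>bellman_value S A \<gamma> K r e u s - bellman_value S A \<gamma> K r e u' s\<bar> \<le> \<bar>u - u'\<bar>"
proof -
  have *: "bellman_value S A \<gamma> K r e u s \<le> bellman_value S A \<gamma> K r e u' s + \<bar>u - u'\<bar>" for u u'
  proof -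
    let ?V = "bellman_value S A \<gamma> K r e u'"
    have "bellman_value S A \<gamma> K r e u s \<le> (?V s + \<bar>u - u'\<bar>) + 0 / (1 - \<gamma>)"
    proof (rule bellman_value_le[OF K order_refl _ s])
      fix s a assume sa: "s < S" "a < A"
      have "\<gamma> * \<bar>u - u'\<bar> \<le> \<bar>u - u'\<bar>" using discount by (simp add: mult_left_le_one_le)
      then show "action_value S \<gamma> K r e u (\<lambda>s. ?V s + \<bar>u - u'\<bar>) s a \<le> ?V s + \<bar>u - u'\<bar> + 0"
        using action_value_le_bellman[OF K sa, of r e u']
        by (auto simp: action_value_def kernel_sum_shift[OF K sa] distrib_left[of \<gamma>])
    qed
    then show ?thesis by simp
  qed
  show ?thesis using *[of u u'] *[of u' u] by (simp add: abs_le_iff abs_minus_commute)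
qed

lemma bellman_value_nonneg:
  assumes K: "kernel S A K" and r: "\<And>s a. s < S \<Longrightarrow> a < A \<Longrightarrow> 0 \<le> r s a" and u: "0 \<le> u" and s: "s < S"
  shows "0 \<le> bellman_value S A \<gamma> K r e u s"
  using bellman_value_ge[OF K order_refl _ s, of "\<lambda>_. 0" r e u] r u A_pos
  by (force simp: action_value_def)

lemma bellman_value_upper:
  assumes K: "kernel S A K" and r: "\<And>s a. s < S \<Longrightarrow> a < A \<Longrightarrow> r s a \<le> c" and c: "0 \<le> c" "u \<le> c"
    and s: "s < S"
  shows "bellman_value S A \<gamma> K r e u s \<le> c / (1 - \<gamma>)"
  using bellman_value_le[OF K c(1) _ s, of r e u "\<lambda>_. 0"] r c
  by (force simp: action_value_def)

text \<open>All iterates of the two operators agree below \<open>S\<close>. The hypotheses leave out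
  the pair \<open>e\<close>, and this is the source of every later independence claim.\<close>

lemma bellman_value_cong:
  assumes "\<And>s a s'. s < S \<Longrightarrow> a < A \<Longrightarrow> (s, a) \<noteq> e \<Longrightarrow> s' < S \<Longrightarrow> K s a s' = K' s a s'"
    and "\<And>s a. s < S \<Longrightarrow> a < A \<Longrightarrow> (s, a) \<noteq> e \<Longrightarrow> r s a = r' s a" and s: "s < S"
  shows "bellman_value S A \<gamma> K r e u s = bellman_value S A \<gamma> K' r' e u s"
proof -
  define T where "T = (\<lambda>v s. Max (action_value S \<gamma> K r e u v s ` {..<A}))"
  define T' where "T' = (\<lambda>v s. Max (action_value S \<gamma> K' r' e u v s ` {..<A}))"
  have T: "T v s = T' w s" if "s < S" "\<And>i. i < S \<Longrightarrow> v i = w i" for v w s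
  proof -
    have "action_value S \<gamma> K r e u v s a = action_value S \<gamma> K' r' e u w s a" if "a < A" for a
      using assms \<open>s < S\<close> that \<open>\<And>i. i < S \<Longrightarrow> v i = w i\<close>
      by (auto simp: action_value_def intro!: arg_cong[where f = "(*) \<gamma>"] sum.cong)
    then show ?thesis unfolding T_def T'_def by (intro arg_cong[where f = Max] image_cong) auto
  qed
  have "\<forall>s<S. (T ^^ k) (\<lambda>_. 0) s = (T' ^^ k) (\<lambda>_. 0) s" for k
    by (induction k) (auto intro!: T)
  then show ?thesis using s unfolding bellman_value_def fix_lim_def T_def T'_def by simp
qed

section \<open>Optimal values, greedy policies and action gaps\<close>

definition strictly_greedy ::
  "real \<Rightarrow> (nat \<Rightarrow> nat \<Rightarrow> nat \<Rightarrow> real) \<Rightarrow> (nat \<Rightarrow> nat \<Rightarrow> real) \<Rightarrow> nat \<times> nat \<Rightarrow> real \<Rightarrow> (nat \<Rightarrow> nat) \<Rightarrow> bool" where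
  "strictly_greedy h K r e u d \<longleftrightarrow> (\<forall>s<S. d s < A \<and> (\<forall>a<A. a \<noteq> d s \<longrightarrow>
     action_value S \<gamma> K r e u (bellman_value S A \<gamma> K r e u) s a + h
       < action_value S \<gamma> K r e u (bellman_value S A \<gamma> K r e u) s (d s)))"

text \<open>States lie below \<open>S\<close>, so the pair \<open>(S, 0)\<close> never occurs and
  the override is inert: the ordinary optimal value is an instance of the overridden one.\<close>

abbreviation opt :: "(nat \<Rightarrow> nat \<Rightarrow> nat \<Rightarrow> real) \<Rightarrow> (nat \<Rightarrow> nat \<Rightarrow> real) \<Rightarrow> nat \<Rightarrow> real" where
  "opt K r \<equiv> bellman_value S A \<gamma> K r (S, 0) 0"

abbreviation optq :: "(nat \<Rightarrow> nat \<Rightarrow> nat \<Rightarrow> real) \<Rightarrow> (nat \<Rightarrow> nat \<Rightarrow> real) \<Rightarrow> nat \<Rightarrow> nat \<Rightarrow> real" where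
  "optq K r s a \<equiv> r s a + \<gamma> * (\<Sum>s'<S. K s a s' * opt K r s')"

lemma action_value_opt: "s < S \<Longrightarrow> action_value S \<gamma> K r (S, 0) 0 v s a = r s a + \<gamma> * (\<Sum>s'<S. K s a s' * v s')"
  by (auto simp: action_value_def)

lemma optq_le_opt: "kernel S A K \<Longrightarrow> s < S \<Longrightarrow> a < A \<Longrightarrow> optq K r s a \<le> opt K r s"
  using action_value_le_bellman[of K s a r "(S, 0)" 0] by (simp add: action_value_opt)

lemma disc_value_le_opt:
  assumes K: "kernel S A K" and pol: "is_policy S A pol" and s: "s < S"
  shows "disc_value S A K r \<gamma> pol s \<le> opt K r s"
proof -
  let ?V = "disc_value S A K r \<gamma> pol"
  have "?V s \<le> opt K r s + 0 / (1 - \<gamma>)"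
  proof (rule bellman_value_ge[OF K order_refl _ s])
    fix s assume s: "s < S"
    define Q where "Q = (\<lambda>a. r s a + \<gamma> * (\<Sum>s'<S. K s a s' * ?V s'))"
    have "Max (Q ` {..<A}) \<in> Q ` {..<A}" using A_pos by (intro Max_in) auto
    then obtain a where a: "a < A" "Max (Q ` {..<A}) = Q a" by auto
    have "?V s = (\<Sum>a<A. pol s a * Q a)"
      using disc_value_policy_eq[OF K pol discount' discount(2) s] by (simp add: Q_def)
    also have "\<dots> \<le> Q a"
      using pol s by (intro convex_sum_le) (auto simp: is_policy_def a(2)[symmetric] intro!: Max_ge)
    finally show "\<exists>a<A. ?V s \<le> action_value S \<gamma> K r (S, 0) 0 ?V s a + 0"
      using a s by (auto simp: action_value_opt Q_def)
  qed
  then show ?thesis by simp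
qed

lemma disc_value_greedy:
  assumes K: "kernel S A K" and d: "\<And>s. s < S \<Longrightarrow> d s < A \<and> opt K r s = optq K r s (d s)" and s: "s < S"
  shows "disc_value S A K r \<gamma> (det_policy d) s = opt K r s"
proof (rule policy_eval_unique[OF _ discount' discount(2) _ _ s])
  show "stochastic S (\<lambda>s s'. K s (d s) s')"
    using kernelD[OF K] d by (auto simp: stochastic_def)
  show "disc_value S A K r \<gamma> (det_policy d) s =
    r s (d s) + \<gamma> * (\<Sum>s'<S. K s (d s) s' * disc_value S A K r \<gamma> (det_policy d) s')" if "s < S" for s
    using disc_value_det_eq[OF K _ discount' discount(2) that] d by blast
  show "opt K r s = r s (d s) + \<gamma> * (\<Sum>s'<S. K s (d s) s' * opt K r s')" if "s < S" for s
    using d[OF that] by blast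
qed

lemma opt_greedy_exists:
  assumes K: "kernel S A K"
  obtains d where "\<And>s. s < S \<Longrightarrow> d s < A \<and> opt K r s = optq K r s (d s)"
proof -
  have "\<forall>s. \<exists>a. s < S \<longrightarrow> a < A \<and> opt K r s = optq K r s a"
  proof
    fix s
    show "\<exists>a. s < S \<longrightarrow> a < A \<and> opt K r s = optq K r s a"
    proof (cases "s < S")
      case True
      obtain a where "a < A" "opt K r s = action_value S \<gamma> K r (S, 0) 0 (opt K r) s a"
        using bellman_value_attained[OF K True] .
      then show ?thesis using True by (auto simp: action_value_opt)
    qed simp
  qed
  then show ?thesis using that by metis
qed

lemma opt_attained:
  assumes K: "kernel S A K"
  obtains pol where "is_policy S A pol" "\<And>s. s < S \<Longrightarrow> disc_value S A K r \<gamma> pol s = opt K r s"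
proof -
  obtain d where d: "\<And>s. s < S \<Longrightarrow> d s < A \<and> opt K r s = optq K r s (d s)"
    using opt_greedy_exists[OF K] by metis
  show ?thesis
    using that[OF is_policy_det_policy disc_value_greedy[OF K d]] d by blast
qed

lemma opt_value_eq:
  assumes K: "kernel S A K" and s: "s < S"
  shows "opt_value S A K r \<gamma> s = opt K r s"
proof -
  obtain pol where pol: "is_policy S A pol" "\<And>s. s < S \<Longrightarrow> disc_value S A K r \<gamma> pol s = opt K r s"
    using opt_attained[OF K] by metis
  show ?thesis unfolding opt_value_def
  proof (rule cSup_eq_maximum)
    show "opt K r s \<in> (\<lambda>pol. disc_value S A K r \<gamma> pol s) ` {pol. is_policy S A pol}"
      using pol s by force
    show "x \<le> opt K r s" if "x \<in> (\<lambda>pol. disc_value S A K r \<gamma> pol s) ` {pol. is_policy S A pol}" for x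
      using that disc_value_le_opt[OF K _ s] by auto
  qed
qed

lemma optimal_policy_value:
  assumes K: "kernel S A K" and pol: "is_optimal_policy S A K r \<gamma> pol" and s: "s < S"
  shows "disc_value S A K r \<gamma> pol s = opt K r s"
proof -
  obtain pol' where pol': "is_policy S A pol'" "\<And>s. s < S \<Longrightarrow> disc_value S A K r \<gamma> pol' s = opt K r s"
    using opt_attained[OF K] by metis
  have "opt K r s \<le> disc_value S A K r \<gamma> pol s"
    using pol pol' s unfolding is_optimal_policy_def by metis
  then show ?thesis using disc_value_le_opt[OF K _ s] pol unfolding is_optimal_policy_def by (metis order_antisym)
qed

lemma strictly_greedy_opt:
  assumes K: "kernel S A K" and d: "strictly_greedy h K r (S, 0) 0 d" and h: "0 \<le> h" and s: "s < S"
  shows "d s < A" "opt K r s = optq K r s (d s)"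
    "a < A \<Longrightarrow> a \<noteq> d s \<Longrightarrow> optq K r s a < opt K r s"
proof -
  show dA: "d s < A" using d s by (auto simp: strictly_greedy_def)
  have lt: "optq K r s a < optq K r s (d s)" if "a < A" "a \<noteq> d s" for a
    using d s that h unfolding strictly_greedy_def by (fastforce simp: action_value_opt)
  obtain d' where "d' s < A \<and> opt K r s = optq K r s (d' s)"
    using opt_greedy_exists[OF K] s by metis
  then show eq: "opt K r s = optq K r s (d s)"
    using lt[of "d' s"] optq_le_opt[OF K s dA, of r] by (cases "d' s = d s") auto
  show "a < A \<Longrightarrow> a \<noteq> d s \<Longrightarrow> optq K r s a < opt K r s" using lt eq by simp
qed

text \<open>An optimal policy could randomize. Its value is \<open>opt\<close>, so its average loss
  against \<open>opt\<close> is 0 in each state; the losses are nonnegative and strictly positive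
  away from \<open>d s\<close>, which leaves no weight there.\<close>

lemma optimal_policy_strictly_greedy:
  assumes K: "kernel S A K" and d: "strictly_greedy h K r (S, 0) 0 d" and h: "0 \<le> h"
    and pol: "is_optimal_policy S A K r \<gamma> pol" and s: "s < S" and a: "a < A"
  shows "pol s a = det_policy d s a"
proof -
  have ip: "is_policy S A pol" using pol by (simp add: is_optimal_policy_def)
  have pos: "0 \<le> pol s a" if "a < A" for a using ip s that by (auto simp: is_policy_def)
  have sum1: "(\<Sum>a<A. pol s a) = 1" using ip s by (auto simp: is_policy_def)
  let ?V = "disc_value S A K r \<gamma> pol"
  have "?V s = (\<Sum>a<A. pol s a * (r s a + \<gamma> * (\<Sum>s'<S. K s a s' * ?V s')))"
    by (rule disc_value_policy_eq[OF K ip discount' discount(2) s])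
  also have "\<dots> = (\<Sum>a<A. pol s a * optq K r s a)"
    using optimal_policy_value[OF K pol] by simp
  finally have "(\<Sum>a<A. pol s a * (opt K r s - optq K r s a)) = 0"
    using optimal_policy_value[OF K pol s] sum1
    by (simp add: right_diff_distrib sum_subtractf sum_distrib_right[symmetric])
  then have "\<forall>a\<in>{..<A}. pol s a * (opt K r s - optq K r s a) = 0"
    by (subst (asm) sum_nonneg_eq_0_iff) (use pos optq_le_opt[OF K s] in auto)
  then have zero: "pol s a = 0" if "a < A" "a \<noteq> d s" for a
    using strictly_greedy_opt(3)[OF K d h s that] that by fastforce
  have "(\<Sum>a<A. pol s a) = (\<Sum>a<A. if a = d s then pol s (d s) else 0)"
    using zero by (intro sum.cong) auto
  then have "pol s (d s) = 1" using sum1 strictly_greedy_opt(1)[OF K d h s] by (simp add: sum.delta)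
  then show ?thesis using zero[OF a] by (auto simp: det_policy_def)
qed

lemma disc_value_cong:
  assumes K: "kernel S A K" and pol: "is_policy S A pol" and pol': "is_policy S A pol'"
    and eq: "\<And>s a. s < S \<Longrightarrow> a < A \<Longrightarrow> pol s a = pol' s a" and s: "s < S"
  shows "disc_value S A K r \<gamma> pol s = disc_value S A K r \<gamma> pol' s"
proof (rule policy_eval_unique[OF stochastic_kpol[OF K pol] discount' discount(2) _ _ s])
  fix s assume s: "s < S"
  have "kpol A K pol s s' = kpol A K pol' s s'" "rpol A r pol s = rpol A r pol' s" for s'
    using eq s by (auto simp: kpol_def rpol_def)
  then show "disc_value S A K r \<gamma> pol' s =
      rpol A r pol s + \<gamma> * (\<Sum>s'<S. kpol A K pol s s' * disc_value S A K r \<gamma> pol' s')"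
    using disc_value_eq[OF stochastic_kpol[OF K pol'] discount' discount(2) s] by simp
qed (rule disc_value_eq[OF stochastic_kpol[OF K pol] discount' discount(2)])

text \<open>The inserted constant is exactly the action value that it replaces, so
  \<open>opt\<close> itself solves the overridden equation.\<close>

lemma bellman_value_override_opt:
  assumes K: "kernel S A K" and e: "fst e < S" "snd e < A" and s: "s < S"
  shows "bellman_value S A \<gamma> K r e (optq K r (fst e) (snd e)) s = opt K r s"
proof -
  let ?u = "optq K r (fst e) (snd e)"
  have av: "action_value S \<gamma> K r e ?u (opt K r) s a = optq K r s a" for s a
    by (auto simp: action_value_def)
  have "bellman_value S A \<gamma> K r e ?u s \<le> opt K r s + 0 / (1 - \<gamma>)"
    using optq_le_opt[OF K] by (intro bellman_value_le[OF K order_refl _ s]) (simp only: av add_0_right)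
  moreover have "opt K r s \<le> bellman_value S A \<gamma> K r e ?u s + 0 / (1 - \<gamma>)"
  proof (rule bellman_value_ge[OF K order_refl _ s])
    fix s assume "s < S"
    obtain d where "\<And>s. s < S \<Longrightarrow> d s < A \<and> opt K r s = optq K r s (d s)"
      using opt_greedy_exists[OF K] by metis
    then show "\<exists>a<A. opt K r s \<le> action_value S \<gamma> K r e ?u (opt K r) s a + 0"
      using \<open>s < S\<close> by (intro exI[of _ "d s"]) (simp only: av add_0_right order_refl)
  qed
  ultimately show ?thesis by simp
qed

text \<open>The override \<open>u\<close> is within \<open>\<eta>\<close> of one that changes
  nothing, so by the Lipschitz bound every action value moves by at most \<open>\<eta>\<close>, and
  a gap above \<open>2 * \<eta>\<close> cannot close.\<close>

lemma strictly_greedy_override: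
  assumes K: "kernel S A K" and e: "fst e < S" "snd e < A"
    and u: "\<bar>u - optq K r (fst e) (snd e)\<bar> \<le> \<eta>"
    and d: "strictly_greedy h K r (S, 0) 0 d" and h: "2 * \<eta> \<le> h"
  shows "strictly_greedy 0 K r e u d"
    and "\<And>s. s < S \<Longrightarrow> \<bar>bellman_value S A \<gamma> K r e u s - opt K r s\<bar> \<le> \<eta>"
proof -
  let ?U = "bellman_value S A \<gamma> K r e u"
  show close: "\<bar>?U s - opt K r s\<bar> \<le> \<eta>" if "s < S" for s
    using bellman_value_lipschitz[OF K that, of r e u "optq K r (fst e) (snd e)"]
      bellman_value_override_opt[OF K e that, of r] u by simp
  have eta: "0 \<le> \<eta>" using u by (meson abs_ge_zero order_trans)
  then have ge: "\<gamma> * \<eta> \<le> \<eta>" using discount by (simp add: mult_left_le_one_le)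
  have av: "\<bar>action_value S \<gamma> K r e u ?U s a - optq K r s a\<bar> \<le> \<eta>" if sa: "s < S" "a < A" for s a
  proof (cases "(s, a) = e")
    case True then show ?thesis using u by (auto simp: action_value_def)
  next
    case False
    have "?U s' - opt K r s' \<le> \<eta>" "opt K r s' - ?U s' \<le> \<eta>" if "s' < S" for s'
      using close[OF that] by auto
    then have "\<gamma> * (\<Sum>s'<S. K s a s' * ?U s') - \<gamma> * (\<Sum>s'<S. K s a s' * opt K r s') \<le> \<gamma> * \<eta>"
      "\<gamma> * (\<Sum>s'<S. K s a s' * opt K r s') - \<gamma> * (\<Sum>s'<S. K s a s' * ?U s') \<le> \<gamma> * \<eta>"
      by (auto intro!: kernel_sum_diff_le[OF K discount' sa])
    then show ?thesis using False ge unfolding action_value_def by simp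
  qed
  show "strictly_greedy 0 K r e u d"
    unfolding strictly_greedy_def
  proof (intro allI impI conjI)
    fix s assume s: "s < S"
    show dA: "d s < A" using d s by (auto simp: strictly_greedy_def)
    fix a assume a: "a < A" "a \<noteq> d s"
    have "optq K r s a + h < optq K r s (d s)"
      using d s a unfolding strictly_greedy_def by (fastforce simp: action_value_opt)
    then show "action_value S \<gamma> K r e u ?U s a + 0 < action_value S \<gamma> K r e u ?U s (d s)"
      using av[OF s a(1)] av[OF s dA] h by (auto simp: abs_le_iff)
  qed
qed

lemma strictly_greedy_unique:
  assumes "strictly_greedy 0 K r e u d" "strictly_greedy 0 K r e u d'" "s < S"
  shows "d s = d' s"
  using assms unfolding strictly_greedy_def by (metis add_0_right less_asym)

text \<open>If the best two actions in a state are within \<open>h\<close>, then removing the better one (by the value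
  \<open>-1\<close>) changes the optimal value by at most \<open>h / (1 - \<gamma>)\<close>, which confines its reward to a short
  interval whose centre does not depend on that reward.\<close>

lemma gap_or_reward_near_threshold:
  assumes K: "kernel S A K" and r: "\<And>s a. s < S \<Longrightarrow> a < A \<Longrightarrow> 0 \<le> r s a" and h: "0 \<le> h"
    and far: "\<And>s a. s < S \<Longrightarrow> a < A \<Longrightarrow>
      h / (1 - \<gamma>) < \<bar>r s a - (bellman_value S A \<gamma> K r (s, a) (-1) s
        - \<gamma> * (\<Sum>s'<S. K s a s' * bellman_value S A \<gamma> K r (s, a) (-1) s'))\<bar>"
  obtains d where "strictly_greedy h K r (S, 0) 0 d"
proof -
  obtain d where d: "\<And>s. s < S \<Longrightarrow> d s < A \<and> opt K r s = optq K r s (d s)"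
    using opt_greedy_exists[OF K] by metis
  have "optq K r s a + h < optq K r s (d s)" if s: "s < S" and a: "a < A" "a \<noteq> d s" for s a
  proof (rule ccontr)
    assume "\<not> ?thesis"
    then have near: "opt K r s \<le> optq K r s a + h" using d[OF s] by simp
    define e where "e = (s, d s)"
    define U where "U = bellman_value S A \<gamma> K r e (-1)"
    \<comment> \<open>\<open>opt\<close> is an approximate subsolution of the model without the
      action \<open>d s\<close>: at \<open>s\<close> the runner-up \<open>a\<close> loses at most
      \<open>h\<close>, and elsewhere \<open>d\<close> loses nothing.\<close>
    have up: "opt K r i \<le> U i + h / (1 - \<gamma>)" if "i < S" for i
      unfolding U_def
    proof (rule bellman_value_ge[OF K h _ that])
      fix i assume i: "i < S"
      show "\<exists>a<A. opt K r i \<le> action_value S \<gamma> K r e (- 1) (opt K r) i a + h"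
      proof (cases "i = s")
        case True
        then show ?thesis using near a by (intro exI[of _ a]) (auto simp: action_value_def e_def)
      next
        case False
        then show ?thesis using d[OF i] h by (intro exI[of _ "d i"]) (auto simp: action_value_def e_def)
      qed
    qed
    have lo: "U i \<le> opt K r i" if "i < S" for i
    proof -
      have "U i \<le> opt K r i + 0 / (1 - \<gamma>)" unfolding U_def
      proof (rule bellman_value_le[OF K order_refl _ that])
        fix i b assume "i < S" "b < A"
        then show "action_value S \<gamma> K r e (- 1) (opt K r) i b \<le> opt K r i + 0"
          using bellman_value_nonneg[of K r 0 i "(S, 0)", OF K r order_refl \<open>i < S\<close>]
            optq_le_opt[OF K \<open>i < S\<close> \<open>b < A\<close>, of r] by (auto simp: action_value_def)
      qed
      then show ?thesis by simp
    qed
    have dA: "d s < A" using d[OF s] by simp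
    have "\<gamma> * (\<Sum>s'<S. K s (d s) s' * opt K r s') - \<gamma> * (\<Sum>s'<S. K s (d s) s' * U s') \<le> \<gamma> * (h / (1 - \<gamma>))"
      using up by (intro kernel_sum_diff_le[OF K discount' s dA]) (simp add: algebra_simps)
    moreover have "\<gamma> * (h / (1 - \<gamma>)) \<le> h / (1 - \<gamma>)"
      using discount h by (intro mult_left_le_one_le) auto
    moreover have "\<gamma> * (\<Sum>s'<S. K s (d s) s' * U s') - \<gamma> * (\<Sum>s'<S. K s (d s) s' * opt K r s') \<le> \<gamma> * 0"
      using lo by (intro kernel_sum_diff_le[OF K discount' s dA]) simp
    \<comment> \<open>The reward is \<open>opt\<close> at \<open>s\<close> minus its discounted
      average. Replacing \<open>opt\<close> by \<open>U\<close> lowers both terms, each by at most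
      \<open>h / (1 - \<gamma>)\<close>; as the two changes have the same sign, they do not add
      up.\<close>
    ultimately have "\<bar>r s (d s) - (U s - \<gamma> * (\<Sum>s'<S. K s (d s) s' * U s'))\<bar> \<le> h / (1 - \<gamma>)"
      using up[OF s] lo[OF s] d[OF s] by (auto simp: abs_le_iff)
    then show False using far[OF s dA] by (simp add: U_def e_def)
  qed
  then have "strictly_greedy h K r (S, 0) 0 d"
    using d unfolding strictly_greedy_def by (auto simp: action_value_opt)
  then show ?thesis by (rule that)
qed

end

section \<open>From deviation bounds to variance terms\<close>

text \<open>Bernstein's inequality for \<open>f\<close> and for \<open>f^2\<close>, where
  \<open>N\<close> bounds \<open>\<bar>f\<bar>\<close>. The tuning parameter is
  \<open>\<gamma> * \<theta> / 8\<close>; its factor \<open>\<gamma>\<close> ensures that no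
  \<open>1 / \<gamma>\<close> survives once the recursion multiplies the deviation by
  \<open>\<gamma>\<close>. The second clause lets the second moment be moved from \<open>p\<close>
  to \<open>q\<close>.\<close>

definition row_good ::
  "nat \<Rightarrow> real \<Rightarrow> real \<Rightarrow> real \<Rightarrow> (nat \<Rightarrow> real) \<Rightarrow> (nat \<Rightarrow> real) \<Rightarrow> (nat \<Rightarrow> real) \<Rightarrow> bool" where
  "row_good S \<gamma> N \<theta> p q f \<longleftrightarrow>
    (let v = (\<Sum>i<S. p i * (f i)\<^sup>2) - (\<Sum>i<S. p i * f i)\<^sup>2 in
      \<bar>(\<Sum>i<S. q i * f i) - (\<Sum>i<S. p i * f i)\<bar> \<le> \<theta> * (\<gamma> * v / 8 + 8 * N / \<gamma>) \<and>
      \<bar>(\<Sum>i<S. q i * (f i)\<^sup>2) - (\<Sum>i<S. p i * (f i)\<^sup>2)\<bar> \<le> v / 4 + 16 * N)"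

text \<open>Here \<open>x\<close> stands for \<open>\<gamma>^2\<close> times the variance. Absorbing
  \<open>x / 4\<close> gives \<open>3/4 * x \<le> b - w + 20 * N\<close>; a sixth of this plus
  \<open>8 * N\<close> stays below the claim, which explains both 6 and 12.\<close>

lemma variance_arithmetic:
  fixes x b p' w N :: real
  assumes "x \<le> b - p' + x / 4 + 16 * N" "w - 4 * N \<le> p'" "1 \<le> N"
  shows "x / 8 + 8 * N \<le> (b - w) / 6 + 12 * N"
  using assms by (simp add: field_simps)

text \<open>For \<open>w\<close> solving the equation of the true kernel, while the recursion runs
  along the empirical one. The equation identifies \<open>\<gamma> * P1\<close> with
  \<open>w\<close> up to a bounded reward, so their squares differ by order \<open>N\<close>, and
  the deviation of \<open>f^2\<close> trades \<open>P2\<close> for \<open>Q2\<close>.\<close>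

lemma true_model_variance:
  fixes \<gamma> N \<theta> P1 P2 Q1 Q2 \<rho> w :: real
  assumes g: "0 < \<gamma>" "\<gamma> < 1" and N: "1 \<le> N" and l: "0 \<le> \<theta>"
    and dev: "\<bar>Q1 - P1\<bar> \<le> \<theta> * (\<gamma> * (P2 - P1\<^sup>2) / 8 + 8 * N / \<gamma>)"
    and dev2: "\<bar>Q2 - P2\<bar> \<le> (P2 - P1\<^sup>2) / 4 + 16 * N"
    and w: "w = \<rho> + \<gamma> * P1" and \<rho>: "\<bar>\<rho>\<bar> \<le> 2" and wN: "\<bar>w\<bar> \<le> N" and Q2: "0 \<le> Q2"
  shows "\<gamma> * \<bar>Q1 - P1\<bar> \<le> \<theta> * ((\<gamma> * Q2 - w\<^sup>2) / 6 + 12 * N)"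
proof -
  define v where "v = P2 - P1\<^sup>2"
  have gg: "\<gamma>\<^sup>2 \<le> \<gamma>" "\<gamma>\<^sup>2 \<le> 1" using g by (simp_all add: power2_eq_square mult_left_le_one_le mult_le_one)
  have "\<bar>w * \<rho>\<bar> \<le> N * 2" unfolding abs_mult using \<rho> wN N by (intro mult_mono) auto
  then have "w * \<rho> \<le> 2 * N" by linarith
  moreover have "\<gamma>\<^sup>2 * P1\<^sup>2 = w\<^sup>2 - 2 * (w * \<rho>) + \<rho>\<^sup>2" using w by (simp add: power2_eq_square algebra_simps)
  ultimately have P1: "w\<^sup>2 - 4 * N \<le> \<gamma>\<^sup>2 * P1\<^sup>2" using zero_le_power2[of \<rho>] by linarith
  have "\<gamma>\<^sup>2 * P2 \<le> \<gamma>\<^sup>2 * (Q2 + v / 4 + 16 * N)"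
    using dev2 unfolding v_def[symmetric] by (intro mult_left_mono) (auto simp: abs_le_iff)
  then have "\<gamma>\<^sup>2 * P2 \<le> \<gamma>\<^sup>2 * Q2 + \<gamma>\<^sup>2 * v / 4 + 16 * (\<gamma>\<^sup>2 * N)"
    by (simp add: algebra_simps)
  moreover have "\<gamma>\<^sup>2 * Q2 \<le> \<gamma> * Q2" using gg Q2 by (intro mult_right_mono)
  moreover have "16 * (\<gamma>\<^sup>2 * N) \<le> 16 * N"
    using mult_right_mono[OF gg(2), of N] N by linarith
  moreover have "\<gamma>\<^sup>2 * v = \<gamma>\<^sup>2 * P2 - \<gamma>\<^sup>2 * P1\<^sup>2" by (simp add: v_def algebra_simps)
  ultimately have "\<gamma>\<^sup>2 * v / 8 + 8 * N \<le> (\<gamma> * Q2 - w\<^sup>2) / 6 + 12 * N"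
    using P1 N by (intro variance_arithmetic[where p' = "\<gamma>\<^sup>2 * P1\<^sup>2"]) linarith+
  moreover have "\<gamma> * \<bar>Q1 - P1\<bar> \<le> \<gamma> * (\<theta> * (\<gamma> * v / 8 + 8 * N / \<gamma>))"
    using dev g unfolding v_def by (intro mult_left_mono) auto
  moreover have "\<gamma> * (\<theta> * (\<gamma> * v / 8 + 8 * N / \<gamma>)) = \<theta> * (\<gamma>\<^sup>2 * v / 8 + 8 * N)"
    using g by (simp add: power2_eq_square field_simps)
  ultimately show ?thesis using l by (smt (verit) mult_left_mono)
qed

text \<open>The opposite case: \<open>w\<close> solves the empirical equation and the recursion runs
  along the true kernel. Now \<open>P2\<close> is the right moment, but the variance contains
  \<open>P1\<close> where the equation gives \<open>Q1\<close>. Their squares differ by at most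
  \<open>2 * N * \<bar>Q1 - P1\<bar>\<close>, to which the first-order bound is applied once more;
  \<open>\<theta> * N \<le> 1\<close> makes the result a quarter of the variance plus
  \<open>16 * N\<close>.\<close>

lemma empirical_model_variance:
  fixes \<gamma> N \<theta> P1 P2 Q1 \<rho> w :: real
  assumes g: "0 < \<gamma>" "\<gamma> < 1" and N: "1 \<le> N" and l: "0 \<le> \<theta>" "\<theta> * N \<le> 1"
    and dev: "\<bar>Q1 - P1\<bar> \<le> \<theta> * (\<gamma> * (P2 - P1\<^sup>2) / 8 + 8 * N / \<gamma>)" and v0: "0 \<le> P2 - P1\<^sup>2"
    and w: "w = \<rho> + \<gamma> * Q1" and \<rho>: "\<bar>\<rho>\<bar> \<le> 2" and wN: "\<bar>w\<bar> \<le> N"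
    and PQ: "\<bar>P1\<bar> \<le> N" "\<bar>Q1\<bar> \<le> N" and P2: "0 \<le> P2"
  shows "\<gamma> * \<bar>Q1 - P1\<bar> \<le> \<theta> * ((\<gamma> * P2 - w\<^sup>2) / 6 + 12 * N)"
proof -
  define v where "v = P2 - P1\<^sup>2"
  have gg: "\<gamma>\<^sup>2 \<le> \<gamma>" "\<gamma>\<^sup>2 \<le> 1" using g by (simp_all add: power2_eq_square mult_left_le_one_le mult_le_one)
  have "\<bar>w * \<rho>\<bar> \<le> N * 2" unfolding abs_mult using \<rho> wN N by (intro mult_mono) auto
  then have "w * \<rho> \<le> 2 * N" by linarith
  moreover have "\<gamma>\<^sup>2 * Q1\<^sup>2 = w\<^sup>2 - 2 * (w * \<rho>) + \<rho>\<^sup>2" using w by (simp add: power2_eq_square algebra_simps)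
  ultimately have Q1: "w\<^sup>2 - 4 * N \<le> \<gamma>\<^sup>2 * Q1\<^sup>2" using zero_le_power2[of \<rho>] by linarith
  have gdev: "\<gamma> * \<bar>Q1 - P1\<bar> \<le> \<theta> * (\<gamma>\<^sup>2 * v / 8 + 8 * N)"
  proof -
    have "\<gamma> * \<bar>Q1 - P1\<bar> \<le> \<gamma> * (\<theta> * (\<gamma> * v / 8 + 8 * N / \<gamma>))"
      using dev g unfolding v_def by (intro mult_left_mono) auto
    moreover have "\<gamma> * (\<theta> * (\<gamma> * v / 8 + 8 * N / \<gamma>)) = \<theta> * (\<gamma>\<^sup>2 * v / 8 + 8 * N)"
      using g by (simp add: power2_eq_square field_simps)
    ultimately show ?thesis by simp
  qed
  have "\<gamma>\<^sup>2 * (Q1\<^sup>2 - P1\<^sup>2) \<le> \<gamma>\<^sup>2 * (\<bar>Q1 - P1\<bar> * (2 * N))"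
  proof (intro mult_left_mono)
    have "Q1\<^sup>2 - P1\<^sup>2 \<le> \<bar>(Q1 - P1) * (Q1 + P1)\<bar>" by (simp add: power2_eq_square algebra_simps)
    also have "\<dots> \<le> \<bar>Q1 - P1\<bar> * (2 * N)" unfolding abs_mult using PQ by (intro mult_left_mono) auto
    finally show "Q1\<^sup>2 - P1\<^sup>2 \<le> \<bar>Q1 - P1\<bar> * (2 * N)" .
  qed auto
  also have "\<dots> = (\<gamma> * \<bar>Q1 - P1\<bar>) * (\<gamma> * (2 * N))" by (simp add: power2_eq_square)
  also have "\<dots> \<le> (\<theta> * (\<gamma>\<^sup>2 * v / 8 + 8 * N)) * (2 * N)"
  proof (rule mult_mono[OF gdev])
    show "\<gamma> * (2 * N) \<le> 2 * N" using g N by (intro mult_left_le_one_le) auto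
    show "0 \<le> \<theta> * (\<gamma>\<^sup>2 * v / 8 + 8 * N)" using v0 N l by (simp add: v_def)
  qed (use g N in auto)
  also have "\<dots> = (\<theta> * N) * (2 * (\<gamma>\<^sup>2 * v / 8 + 8 * N))" by (simp add: algebra_simps)
  also have "\<dots> \<le> 1 * (2 * (\<gamma>\<^sup>2 * v / 8 + 8 * N))"
    using l(2) v0 N by (intro mult_right_mono) (auto simp: v_def)
  finally have "\<gamma>\<^sup>2 * Q1\<^sup>2 - \<gamma>\<^sup>2 * P1\<^sup>2 \<le> \<gamma>\<^sup>2 * v / 4 + 16 * N" by (simp add: algebra_simps)
  moreover have "\<gamma>\<^sup>2 * P2 \<le> \<gamma> * P2" using gg P2 by (intro mult_right_mono)
  moreover have "\<gamma>\<^sup>2 * v = \<gamma>\<^sup>2 * P2 - \<gamma>\<^sup>2 * P1\<^sup>2" by (simp add: v_def algebra_simps)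
  ultimately have "\<gamma>\<^sup>2 * v / 8 + 8 * N \<le> (\<gamma> * P2 - w\<^sup>2) / 6 + 12 * N"
    using Q1 N by (intro variance_arithmetic[where p' = "\<gamma>\<^sup>2 * Q1\<^sup>2"]) linarith+
  then show ?thesis using gdev l by (smt (verit) mult_left_mono)
qed

lemma variance_nonneg:
  fixes p f :: "nat \<Rightarrow> real"
  assumes "\<And>i. i < m \<Longrightarrow> 0 \<le> p i" "(\<Sum>i<m. p i) = 1"
  shows "0 \<le> (\<Sum>i<m. p i * (f i)\<^sup>2) - (\<Sum>i<m. p i * f i)\<^sup>2"
proof -
  define \<mu> where "\<mu> = (\<Sum>i<m. p i * f i)"
  have "0 \<le> (\<Sum>i<m. p i * (f i - \<mu>)\<^sup>2)" using assms by (intro sum_nonneg) auto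
  also have "\<dots> = (\<Sum>i<m. p i * (f i)\<^sup>2 - 2 * \<mu> * (p i * f i) + \<mu>\<^sup>2 * p i)"
    by (intro sum.cong) (auto simp: power2_eq_square algebra_simps)
  also have "\<dots> = (\<Sum>i<m. p i * (f i)\<^sup>2) - 2 * \<mu> * (\<Sum>i<m. p i * f i) + \<mu>\<^sup>2 * (\<Sum>i<m. p i)"
    by (simp add: sum.distrib sum_subtractf sum_distrib_left)
  also have "\<dots> = (\<Sum>i<m. p i * (f i)\<^sup>2) - \<mu>\<^sup>2"
    using assms(2) by (simp add: \<mu>_def power2_eq_square)
  finally show ?thesis by (simp add: \<mu>_def)
qed

lemma convex_sum_shift:
  fixes p f :: "nat \<Rightarrow> real"
  assumes "(\<Sum>i<m. p i) = 1"
  shows "(\<Sum>i<m. p i * (f i - c)) = (\<Sum>i<m. p i * f i) - c"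
  using assms by (simp add: right_diff_distrib sum_subtractf sum_distrib_right[symmetric])

context discounted
begin

text \<open>The term \<open>\<theta> f\<^sup>2 / 6\<close> is a potential that absorbs the variances along the trajectory:
  this replaces the law of total variance.\<close>

lemma variance_max_principle:
  assumes k: "stochastic S k" and l: "0 \<le> \<theta>"
    and D: "\<And>s. s < S \<Longrightarrow> D s \<le> \<theta> * ((\<gamma> * (\<Sum>i<S. k s i * (f i)\<^sup>2) - (f s)\<^sup>2) / 6 + B) + c
      + \<gamma> * (\<Sum>i<S. k s i * D i)"
    and s: "s < S"
  shows "D s \<le> (\<theta> * B + c) / (1 - \<gamma>)"
proof -
  have "D s + \<theta> / 6 * (f s)\<^sup>2 \<le> (\<theta> * B + c) / (1 - \<gamma>)"
  proof (rule max_principle[OF discount' discount(2) k _ s])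
    fix s assume "s < S"
    have "(\<Sum>i<S. k s i * (D i + \<theta> / 6 * (f i)\<^sup>2)) = (\<Sum>i<S. k s i * D i) + \<theta> / 6 * (\<Sum>i<S. k s i * (f i)\<^sup>2)"
      by (simp add: distrib_left sum.distrib sum_distrib_left mult.left_commute)
    with D[OF \<open>s < S\<close>] show "D s + \<theta> / 6 * (f s)\<^sup>2 \<le> \<theta> * B + c + \<gamma> * (\<Sum>i<S. k s i * (D i + \<theta> / 6 * (f i)\<^sup>2))"
      by (simp add: algebra_simps add_divide_distrib diff_divide_distrib)
  qed
  moreover have "0 \<le> \<theta> / 6 * (f s)\<^sup>2" using l by simp
  ultimately show ?thesis by linarith
qed

text \<open>Subtracting \<open>V 0\<close> turns the reward into
  \<open>\<rho> - (1 - \<gamma>) * V 0\<close>, still bounded by 2 because \<open>V 0\<close> is at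
  most \<open>1 / (1 - \<gamma>)\<close>. The centred function is bounded by the span, and
  differences of averages are unaffected.\<close>

lemma row_good_true_model:
  assumes p: "\<And>i. i < S \<Longrightarrow> 0 \<le> p i" "(\<Sum>i<S. p i) = 1" and q: "\<And>i. i < S \<Longrightarrow> 0 \<le> q i" "(\<Sum>i<S. q i) = 1"
    and N: "1 \<le> N" "\<bar>V s - V 0\<bar> \<le> N" and l: "0 \<le> \<theta>"
    and good: "row_good S \<gamma> N \<theta> p q (\<lambda>i. V i - V 0)"
    and V: "V s = \<rho> + \<gamma> * (\<Sum>i<S. p i * V i)" and \<rho>: "0 \<le> \<rho>" "\<rho> \<le> 1"
    and V0: "0 \<le> V 0" "V 0 \<le> 1 / (1 - \<gamma>)"
  shows "\<gamma> * \<bar>(\<Sum>i<S. q i * V i) - (\<Sum>i<S. p i * V i)\<bar>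
    \<le> \<theta> * ((\<gamma> * (\<Sum>i<S. q i * (V i - V 0)\<^sup>2) - (V s - V 0)\<^sup>2) / 6 + 12 * N)"
proof -
  have "0 \<le> (1 - \<gamma>) * V 0" "(1 - \<gamma>) * V 0 \<le> 1"
    using V0 discount by (auto simp: pos_le_divide_eq mult.commute)
  then have \<rho>': "\<bar>\<rho> - (1 - \<gamma>) * V 0\<bar> \<le> 2" using \<rho> by auto
  have "V s - V 0 = (\<rho> - (1 - \<gamma>) * V 0) + \<gamma> * (\<Sum>i<S. p i * (V i - V 0))"
    using V unfolding convex_sum_shift[OF p(2)] by (simp add: algebra_simps)
  moreover have "0 \<le> (\<Sum>i<S. q i * (V i - V 0)\<^sup>2)" using q(1) by (auto intro!: sum_nonneg)
  ultimately have "\<gamma> * \<bar>(\<Sum>i<S. q i * (V i - V 0)) - (\<Sum>i<S. p i * (V i - V 0))\<bar>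
    \<le> \<theta> * ((\<gamma> * (\<Sum>i<S. q i * (V i - V 0)\<^sup>2) - (V s - V 0)\<^sup>2) / 6 + 12 * N)"
    using good unfolding row_good_def Let_def
    by (intro true_model_variance[OF discount N(1) l _ _ _ \<rho>' N(2)]) auto
  then show ?thesis by (simp add: convex_sum_shift[OF p(2)] convex_sum_shift[OF q(2)])
qed

text \<open>\<open>U\<close> depends on the very row that is tested, so the deviation bound is
  available only for a proxy \<open>G\<close> nearby. Passing from \<open>G\<close> back to
  \<open>U\<close> raises 12 to 13 in the variance bound and adds \<open>4 * \<eta>\<close> to the
  averages.\<close>

lemma row_good_empirical_model:
  assumes p: "\<And>i. i < S \<Longrightarrow> 0 \<le> p i" "(\<Sum>i<S. p i) = 1" and q: "\<And>i. i < S \<Longrightarrow> 0 \<le> q i" "(\<Sum>i<S. q i) = 1"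
    and N: "1 \<le> N" "\<And>i. i < S \<Longrightarrow> \<bar>U i - U 0\<bar> \<le> N" "\<And>i. i < S \<Longrightarrow> \<bar>G i - G 0\<bar> \<le> N"
    and l: "0 \<le> \<theta>" "\<theta> * N \<le> 1" and s: "s < S"
    and close: "\<And>i. i < S \<Longrightarrow> \<bar>G i - U i\<bar> \<le> \<eta>" and \<eta>: "\<eta> \<le> 1 / 8"
    and good: "row_good S \<gamma> N \<theta> p q (\<lambda>i. G i - G 0)"
    and U: "U s = \<rho> + \<gamma> * (\<Sum>i<S. q i * U i)" and \<rho>: "0 \<le> \<rho>" "\<rho> \<le> 3 / 2"
    and U0: "0 \<le> U 0" "U 0 \<le> 3 / 2 / (1 - \<gamma>)"
  shows "\<gamma> * \<bar>(\<Sum>i<S. q i * U i) - (\<Sum>i<S. p i * U i)\<bar>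
    \<le> \<theta> * ((\<gamma> * (\<Sum>i<S. p i * (U i - U 0)\<^sup>2) - (U s - U 0)\<^sup>2) / 6 + 13 * N) + 4 * \<eta>"
proof -
  define F where "F = (\<lambda>i. G i - G 0)"
  define W where "W = (\<lambda>i. U i - U 0)"
  have eta0: "0 \<le> \<eta>" using close[OF s] by (meson abs_ge_zero order_trans)
  have FW: "\<bar>F i - W i\<bar> \<le> 2 * \<eta>" if "i < S" for i
    using close[OF that] close[OF S_pos] by (simp add: F_def W_def)
  have FW2: "\<bar>(F i)\<^sup>2 - (W i)\<^sup>2\<bar> \<le> 4 * (\<eta> * N)" if "i < S" for i
  proof -
    have "\<bar>F i - W i\<bar> * \<bar>F i + W i\<bar> \<le> (2 * \<eta>) * (2 * N)"
      using FW[OF that] N(2,3)[OF that] eta0 by (intro mult_mono) (auto simp: F_def W_def)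
    then show ?thesis by (simp add: abs_mult[symmetric] power2_eq_square algebra_simps)
  qed
  have diff: "\<bar>(\<Sum>i<S. h i * F i) - (\<Sum>i<S. h i * W i)\<bar> \<le> 2 * \<eta>"
    if "\<And>i. i < S \<Longrightarrow> 0 \<le> h i" "(\<Sum>i<S. h i) = 1" for h
    using convex_sum_abs_le[OF that, of "\<lambda>i. F i - W i" "2 * \<eta>"] FW by (simp add: right_diff_distrib sum_subtractf)
  \<comment> \<open>\<open>F\<close> satisfies the equation only approximately;
    \<open>\<rho>'\<close> is the reward that makes it exact. It is at most
    \<open>3 / 2 + 4 * \<eta>\<close> in absolute value, and \<open>\<eta> \<le> 1 / 8\<close> keeps
    this below 2.\<close>
  define \<rho>' where "\<rho>' = F s - \<gamma> * (\<Sum>i<S. q i * F i)"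
  have "0 \<le> (1 - \<gamma>) * U 0" "(1 - \<gamma>) * U 0 \<le> (1 - \<gamma>) * (3 / 2 / (1 - \<gamma>))"
    by (rule mult_nonneg_nonneg mult_left_mono; use U0 discount in simp)+
  moreover have "(1 - \<gamma>) * (3 / 2 / (1 - \<gamma>)) = 3 / 2" using discount by (auto simp: divide_eq_eq)
  ultimately have "0 \<le> (1 - \<gamma>) * U 0" "(1 - \<gamma>) * U 0 \<le> 3 / 2" by linarith+
  then have \<rho>1: "\<bar>\<rho> - (1 - \<gamma>) * U 0\<bar> \<le> 3 / 2" using \<rho> unfolding abs_le_iff by linarith
  have W: "W s = (\<rho> - (1 - \<gamma>) * U 0) + \<gamma> * (\<Sum>i<S. q i * W i)"
    unfolding W_def convex_sum_shift[OF q(2)] using U by (simp add: algebra_simps)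
  have "\<bar>\<gamma> * ((\<Sum>i<S. q i * F i) - (\<Sum>i<S. q i * W i))\<bar> \<le> 1 * (2 * \<eta>)"
    unfolding abs_mult using diff[OF q] discount by (intro mult_mono) auto
  then have "\<bar>\<gamma> * (\<Sum>i<S. q i * F i) - \<gamma> * (\<Sum>i<S. q i * W i)\<bar> \<le> 2 * \<eta>" by (simp add: right_diff_distrib)
  then have \<rho>': "\<bar>\<rho>'\<bar> \<le> 2" using \<rho>1 W FW[OF s] \<eta> unfolding \<rho>'_def abs_le_iff by linarith
  have F: "F s = \<rho>' + \<gamma> * (\<Sum>i<S. q i * F i)" by (simp add: \<rho>'_def)
  have FN: "\<bar>F i\<bar> \<le> N" if "i < S" for i using N(3)[OF that] by (simp add: F_def)
  have "\<gamma> * \<bar>(\<Sum>i<S. q i * F i) - (\<Sum>i<S. p i * F i)\<bar>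
      \<le> \<theta> * ((\<gamma> * (\<Sum>i<S. p i * (F i)\<^sup>2) - (F s)\<^sup>2) / 6 + 12 * N)"
  proof (rule empirical_model_variance[OF discount N(1) l _ _ F \<rho>' FN[OF s]])
    show "\<bar>\<Sum>i<S. p i * F i\<bar> \<le> N" "\<bar>\<Sum>i<S. q i * F i\<bar> \<le> N"
      using FN by (auto intro!: convex_sum_abs_le p q)
    show "0 \<le> (\<Sum>i<S. p i * (F i)\<^sup>2)" using p(1) by (auto intro!: sum_nonneg)
  qed (use good variance_nonneg[OF p, of F] in \<open>auto simp: row_good_def Let_def F_def\<close>)
  also have "\<dots> \<le> \<theta> * ((\<gamma> * (\<Sum>i<S. p i * (W i)\<^sup>2) - (W s)\<^sup>2) / 6 + 13 * N)"
  proof (intro mult_left_mono l(1))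
    have arith: "(x - w) / 6 + 12 * n \<le> (x' - w') / 6 + 13 * n"
      if "x \<le> x' + 4 * e" "w' \<le> w + 4 * e" "e \<le> 1 / 8 * n" "1 \<le> n" for x x' w w' e n :: real
      using that by (simp add: field_simps)
    have "(\<Sum>i<S. p i * ((F i)\<^sup>2 - (W i)\<^sup>2)) \<le> 4 * (\<eta> * N)"
      using FW2 by (intro convex_sum_le p) (auto simp: abs_le_iff)
    then have "\<gamma> * (\<Sum>i<S. p i * ((F i)\<^sup>2 - (W i)\<^sup>2)) \<le> \<gamma> * (4 * (\<eta> * N))"
      using discount by (intro mult_left_mono) auto
    moreover have "\<gamma> * (4 * (\<eta> * N)) \<le> 4 * (\<eta> * N)"
      using discount eta0 N(1) by (intro mult_left_le_one_le) auto
    ultimately have "\<gamma> * (\<Sum>i<S. p i * (F i)\<^sup>2) \<le> \<gamma> * (\<Sum>i<S. p i * (W i)\<^sup>2) + 4 * (\<eta> * N)"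
      by (simp add: right_diff_distrib sum_subtractf)
    moreover have "(W s)\<^sup>2 \<le> (F s)\<^sup>2 + 4 * (\<eta> * N)" using FW2[OF s] by (auto simp: abs_le_iff)
    moreover have "\<eta> * N \<le> 1 / 8 * N" using \<eta> N(1) by (intro mult_right_mono) auto
    ultimately show "(\<gamma> * (\<Sum>i<S. p i * (F i)\<^sup>2) - (F s)\<^sup>2) / 6 + 12 * N
      \<le> (\<gamma> * (\<Sum>i<S. p i * (W i)\<^sup>2) - (W s)\<^sup>2) / 6 + 13 * N" using N(1) by (intro arith[where e = "\<eta> * N" and n = N]) simp_all
  qed
  finally have F_le: "\<gamma> * \<bar>(\<Sum>i<S. q i * F i) - (\<Sum>i<S. p i * F i)\<bar>
    \<le> \<theta> * ((\<gamma> * (\<Sum>i<S. p i * (W i)\<^sup>2) - (W s)\<^sup>2) / 6 + 13 * N)" .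
  have "\<gamma> * \<bar>(\<Sum>i<S. q i * W i) - (\<Sum>i<S. p i * W i)\<bar>
      \<le> \<gamma> * (\<bar>(\<Sum>i<S. q i * F i) - (\<Sum>i<S. p i * F i)\<bar> + 4 * \<eta>)"
    using diff[OF p] diff[OF q] discount by (intro mult_left_mono) auto
  also have "\<dots> \<le> \<gamma> * \<bar>(\<Sum>i<S. q i * F i) - (\<Sum>i<S. p i * F i)\<bar> + 4 * \<eta>"
    using discount eta0 by (simp add: distrib_left mult_left_le_one_le)
  finally have "\<gamma> * \<bar>(\<Sum>i<S. q i * W i) - (\<Sum>i<S. p i * W i)\<bar>
    \<le> \<theta> * ((\<gamma> * (\<Sum>i<S. p i * (W i)\<^sup>2) - (W s)\<^sup>2) / 6 + 13 * N) + 4 * \<eta>" using F_le by linarith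
  then show ?thesis
    unfolding W_def by (simp add: convex_sum_shift[OF p(2)] convex_sum_shift[OF q(2)])
qed

section \<open>The three error recursions\<close>

text \<open>\<open>d\<close> is optimal in the true model and merely admissible in the empirical
  one, so \<open>opt K r - opt Q r'\<close> unrolls along \<open>Q\<close>, with deviations tested
  on the nonrandom function \<open>opt K r\<close>. Since \<open>r \<le> r'\<close>, the
  perturbation contributes no error on this side.\<close>

lemma opt_error:
  assumes K: "kernel S A K" and Q: "kernel S A Q"
    and r: "\<And>s a. s < S \<Longrightarrow> a < A \<Longrightarrow> 0 \<le> r s a \<and> r s a \<le> 1"
    and r': "\<And>s a. s < S \<Longrightarrow> a < A \<Longrightarrow> r s a \<le> r' s a"
    and N: "1 \<le> N" "\<And>i. i < S \<Longrightarrow> \<bar>opt K r i - opt K r 0\<bar> \<le> N" and l: "0 \<le> \<theta>"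
    and good: "\<And>s a. s < S \<Longrightarrow> a < A \<Longrightarrow> row_good S \<gamma> N \<theta> (K s a) (Q s a) (\<lambda>i. opt K r i - opt K r 0)"
    and s: "s < S"
  shows "opt K r s - opt Q r' s \<le> 12 * \<theta> * N / (1 - \<gamma>)"
proof -
  let ?V = "opt K r" and ?U = "opt Q r'"
  obtain d where d: "\<And>s. s < S \<Longrightarrow> d s < A \<and> ?V s = optq K r s (d s)"
    using opt_greedy_exists[OF K] by metis
  have "?V s - ?U s \<le> (\<theta> * (12 * N) + 0) / (1 - \<gamma>)"
  proof (rule variance_max_principle[OF _ l _ s])
    show "stochastic S (\<lambda>s. Q s (d s))" using kernelD[OF Q] d by (auto simp: stochastic_def)
    fix s assume s: "s < S"
    have dA: "d s < A" using d[OF s] by simp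
    have V0: "?V 0 \<le> 1 / (1 - \<gamma>)" "0 \<le> ?V 0"
      using bellman_value_upper[OF K _ _ _ S_pos, of r 1 0 "(S, 0)"]
        bellman_value_nonneg[OF K _ _ S_pos, of r 0 "(S, 0)"] r by auto
    have V: "?V s = r s (d s) + \<gamma> * (\<Sum>i<S. K s (d s) i * ?V i)" using d[OF s] by simp
    have "\<gamma> * \<bar>(\<Sum>i<S. Q s (d s) i * ?V i) - (\<Sum>i<S. K s (d s) i * ?V i)\<bar>
      \<le> \<theta> * ((\<gamma> * (\<Sum>i<S. Q s (d s) i * (?V i - ?V 0)\<^sup>2) - (?V s - ?V 0)\<^sup>2) / 6 + 12 * N)"
      using r[OF s dA]
      by (intro row_good_true_model[OF kernelD[OF K s dA] kernelD[OF Q s dA] N(1) N(2)[OF s] l good[OF s dA] V _ _ V0(2,1)]) auto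
    moreover have "\<gamma> * (\<Sum>i<S. K s (d s) i * ?V i) - \<gamma> * (\<Sum>i<S. Q s (d s) i * ?V i)
        \<le> \<gamma> * \<bar>(\<Sum>i<S. Q s (d s) i * ?V i) - (\<Sum>i<S. K s (d s) i * ?V i)\<bar>"
      using discount unfolding right_diff_distrib[symmetric] by (intro mult_left_mono) auto
    moreover note V
    moreover have "r s (d s) + \<gamma> * (\<Sum>i<S. Q s (d s) i * ?U i) \<le> ?U s"
      using optq_le_opt[OF Q s dA, of r'] r'[OF s dA] by simp
    moreover have "\<gamma> * (\<Sum>i<S. Q s (d s) i * (?V i - ?U i))
        = \<gamma> * (\<Sum>i<S. Q s (d s) i * ?V i) - \<gamma> * (\<Sum>i<S. Q s (d s) i * ?U i)"
      by (simp add: right_diff_distrib sum_subtractf)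
    ultimately show "?V s - ?U s \<le> \<theta> * ((\<gamma> * (\<Sum>i<S. Q s (d s) i * (?V i - ?V 0)\<^sup>2) - (?V s - ?V 0)\<^sup>2) / 6 + 12 * N) + 0
      + \<gamma> * (\<Sum>i<S. Q s (d s) i * (?V i - ?U i))" by linarith
  qed
  then show ?thesis by (simp add: mult.assoc mult.left_commute)
qed

lemma disc_value_det_bounds:
  assumes K: "kernel S A K" and d: "\<And>s. s < S \<Longrightarrow> d s < A"
    and r: "\<And>s a. s < S \<Longrightarrow> a < A \<Longrightarrow> 0 \<le> r s a \<and> r s a \<le> c" and s: "s < S"
  shows "0 \<le> disc_value S A K r \<gamma> (det_policy d) s" "disc_value S A K r \<gamma> (det_policy d) s \<le> c / (1 - \<gamma>)"
proof -
  let ?V = "disc_value S A K r \<gamma> (det_policy d)"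
  have st: "stochastic S (\<lambda>s. K s (d s))" using kernelD[OF K] d by (auto simp: stochastic_def)
  have *: "?V s \<le> c + \<gamma> * (\<Sum>s'<S. K s (d s) s' * ?V s')"
    "- ?V s \<le> 0 + \<gamma> * (\<Sum>s'<S. K s (d s) s' * (- ?V s'))" if "s < S" for s
  proof -
    have "?V s = r s (d s) + \<gamma> * (\<Sum>s'<S. K s (d s) s' * ?V s')"
      by (rule disc_value_det_eq[OF K _ discount' discount(2) that]) (rule d)
    moreover have "0 \<le> r s (d s)" "r s (d s) \<le> c" using r[OF that d[OF that]] by auto
    moreover have "\<gamma> * (\<Sum>s'<S. K s (d s) s' * (- ?V s')) = - (\<gamma> * (\<Sum>s'<S. K s (d s) s' * ?V s'))"
      by (simp add: sum_negf)
    ultimately show "?V s \<le> c + \<gamma> * (\<Sum>s'<S. K s (d s) s' * ?V s')"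
      "- ?V s \<le> 0 + \<gamma> * (\<Sum>s'<S. K s (d s) s' * (- ?V s'))" by linarith+
  qed
  show "0 \<le> ?V s" using max_principle[OF discount' discount(2) st *(2) s] by simp
  show "?V s \<le> c / (1 - \<gamma>)" using max_principle[OF discount' discount(2) st *(1) s] by simp
qed

text \<open>Both values follow \<open>d\<close>, so their difference can be unrolled along either
  kernel. Unrolling along \<open>Q\<close> leaves the deviation at \<open>V\<close>, and hence the
  span of the true value of \<open>d\<close>.\<close>

lemma greedy_error_true_variance:
  assumes K: "kernel S A K" and Q: "kernel S A Q"
    and r: "\<And>s a. s < S \<Longrightarrow> a < A \<Longrightarrow> 0 \<le> r s a \<and> r s a \<le> 1"
    and r': "\<And>s a. s < S \<Longrightarrow> a < A \<Longrightarrow> r' s a \<le> r s a + \<xi>"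
    and d: "\<And>s. s < S \<Longrightarrow> d s < A \<and> opt Q r' s = optq Q r' s (d s)"
  defines "V \<equiv> disc_value S A K r \<gamma> (det_policy d)"
  assumes N: "1 \<le> N" "\<And>i. i < S \<Longrightarrow> \<bar>V i - V 0\<bar> \<le> N" and l: "0 \<le> \<theta>"
    and good: "\<And>s a. s < S \<Longrightarrow> a < A \<Longrightarrow> row_good S \<gamma> N \<theta> (K s a) (Q s a) (\<lambda>i. V i - V 0)"
    and s: "s < S"
  shows "opt Q r' s - V s \<le> (12 * \<theta> * N + \<xi>) / (1 - \<gamma>)"
proof -
  let ?U = "opt Q r'"
  have dA: "d s < A" if "s < S" for s using d[OF that] by simp
  have V: "V s = r s (d s) + \<gamma> * (\<Sum>i<S. K s (d s) i * V i)" if "s < S" for s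
    unfolding V_def by (rule disc_value_det_eq[OF K _ discount' discount(2) that]) (rule dA)
  have "?U s - V s \<le> (\<theta> * (12 * N) + \<xi>) / (1 - \<gamma>)"
  proof (rule variance_max_principle[OF _ l _ s])
    show "stochastic S (\<lambda>s. Q s (d s))" using kernelD[OF Q] d by (auto simp: stochastic_def)
    fix s assume s: "s < S"
    have V0: "0 \<le> V 0" "V 0 \<le> 1 / (1 - \<gamma>)"
      unfolding V_def using disc_value_det_bounds[OF K dA r S_pos] by auto
    have "\<gamma> * \<bar>(\<Sum>i<S. Q s (d s) i * V i) - (\<Sum>i<S. K s (d s) i * V i)\<bar>
      \<le> \<theta> * ((\<gamma> * (\<Sum>i<S. Q s (d s) i * (V i - V 0)\<^sup>2) - (V s - V 0)\<^sup>2) / 6 + 12 * N)"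
      using r[OF s dA[OF s]]
      by (intro row_good_true_model[OF kernelD[OF K s dA[OF s]] kernelD[OF Q s dA[OF s]] N(1) N(2)[OF s] l
            good[OF s dA[OF s]] V[OF s] _ _ V0]) auto
    moreover have "\<gamma> * (\<Sum>i<S. Q s (d s) i * V i) - \<gamma> * (\<Sum>i<S. K s (d s) i * V i)
        \<le> \<gamma> * \<bar>(\<Sum>i<S. Q s (d s) i * V i) - (\<Sum>i<S. K s (d s) i * V i)\<bar>"
      using discount unfolding right_diff_distrib[symmetric] by (intro mult_left_mono) auto
    moreover have "?U s \<le> r s (d s) + \<xi> + \<gamma> * (\<Sum>i<S. Q s (d s) i * ?U i)"
      using d[OF s] r'[OF s dA[OF s]] by simp
    moreover have "\<gamma> * (\<Sum>i<S. Q s (d s) i * (?U i - V i))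
        = \<gamma> * (\<Sum>i<S. Q s (d s) i * ?U i) - \<gamma> * (\<Sum>i<S. Q s (d s) i * V i)"
      by (simp add: right_diff_distrib sum_subtractf)
    ultimately show "?U s - V s \<le> \<theta> * ((\<gamma> * (\<Sum>i<S. Q s (d s) i * (V i - V 0)\<^sup>2) - (V s - V 0)\<^sup>2) / 6 + 12 * N) + \<xi>
      + \<gamma> * (\<Sum>i<S. Q s (d s) i * (?U i - V i))" using V[OF s] by linarith
  qed
  then show ?thesis by (simp add: mult.assoc mult.left_commute)
qed

text \<open>The same difference unrolled along \<open>K\<close>, which leaves the deviation at
  \<open>opt Q r'\<close> and hence the empirical span. The proxy \<open>G\<close> may change with
  the pair, because each pair needs a function independent of its own row.\<close>

lemma greedy_error_empirical_variance:
  assumes K: "kernel S A K" and Q: "kernel S A Q"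
    and r: "\<And>s a. s < S \<Longrightarrow> a < A \<Longrightarrow> 0 \<le> r s a \<and> r s a \<le> 1"
    and r': "\<And>s a. s < S \<Longrightarrow> a < A \<Longrightarrow> 0 \<le> r' s a \<and> r' s a \<le> r s a + \<xi>" and \<xi>: "\<xi> \<le> 1 / 2"
    and d: "\<And>s. s < S \<Longrightarrow> d s < A \<and> opt Q r' s = optq Q r' s (d s)"
    and N: "1 \<le> N" "\<And>i. i < S \<Longrightarrow> \<bar>opt Q r' i - opt Q r' 0\<bar> \<le> N"
    and l: "0 \<le> \<theta>" "\<theta> * N \<le> 1" and \<eta>: "\<eta> \<le> 1 / 8"
    and good: "\<And>s a. s < S \<Longrightarrow> a < A \<Longrightarrow> \<exists>G. (\<forall>i<S. \<bar>G i - opt Q r' i\<bar> \<le> \<eta> \<and> \<bar>G i - G 0\<bar> \<le> N)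
      \<and> row_good S \<gamma> N \<theta> (K s a) (Q s a) (\<lambda>i. G i - G 0)"
    and s: "s < S"
  shows "opt Q r' s - disc_value S A K r \<gamma> (det_policy d) s \<le> (13 * \<theta> * N + \<xi> + 4 * \<eta>) / (1 - \<gamma>)"
proof -
  define U where "U = opt Q r'"
  define V where "V = disc_value S A K r \<gamma> (det_policy d)"
  have dA: "d s < A" if "s < S" for s using d[OF that] by simp
  have V: "V s = r s (d s) + \<gamma> * (\<Sum>i<S. K s (d s) i * V i)" if "s < S" for s
    unfolding V_def by (rule disc_value_det_eq[OF K _ discount' discount(2) that]) (rule dA)
  have r'32: "r' s a \<le> 3 / 2" if "s < S" "a < A" for s a using r[OF that] r'[OF that] \<xi> by auto
  have "U s - V s \<le> (\<theta> * (13 * N) + (\<xi> + 4 * \<eta>)) / (1 - \<gamma>)"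
  proof (rule variance_max_principle[OF _ l(1) _ s])
    show "stochastic S (\<lambda>s. K s (d s))" using kernelD[OF K] d by (auto simp: stochastic_def)
    fix s assume s: "s < S"
    have U0: "U 0 \<le> 3 / 2 / (1 - \<gamma>)" "0 \<le> U 0" unfolding U_def
      using bellman_value_upper[OF Q _ _ _ S_pos, of r' "3 / 2" 0 "(S, 0)"]
        bellman_value_nonneg[OF Q _ _ S_pos, of r' 0 "(S, 0)"] r' r'32 by auto
    obtain G where G: "\<And>i. i < S \<Longrightarrow> \<bar>G i - U i\<bar> \<le> \<eta>" "\<And>i. i < S \<Longrightarrow> \<bar>G i - G 0\<bar> \<le> N"
      "row_good S \<gamma> N \<theta> (K s (d s)) (Q s (d s)) (\<lambda>i. G i - G 0)"
      using good[OF s dA[OF s]] unfolding U_def by blast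
    have Us: "U s = r' s (d s) + \<gamma> * (\<Sum>i<S. Q s (d s) i * U i)" using d[OF s] by (simp add: U_def)
    have "\<gamma> * \<bar>(\<Sum>i<S. Q s (d s) i * U i) - (\<Sum>i<S. K s (d s) i * U i)\<bar>
      \<le> \<theta> * ((\<gamma> * (\<Sum>i<S. K s (d s) i * (U i - U 0)\<^sup>2) - (U s - U 0)\<^sup>2) / 6 + 13 * N) + 4 * \<eta>"
      using r'[OF s dA[OF s]] r'32[OF s dA[OF s]] U0 N(2)
      by (intro row_good_empirical_model[OF kernelD[OF K s dA[OF s]] kernelD[OF Q s dA[OF s]] N(1) _ G(2) l s
            G(1) \<eta> G(3) Us]) (auto simp: U_def)
    moreover have "\<gamma> * (\<Sum>i<S. Q s (d s) i * U i) - \<gamma> * (\<Sum>i<S. K s (d s) i * U i)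
        \<le> \<gamma> * \<bar>(\<Sum>i<S. Q s (d s) i * U i) - (\<Sum>i<S. K s (d s) i * U i)\<bar>"
      using discount unfolding right_diff_distrib[symmetric] by (intro mult_left_mono) auto
    moreover have "r' s (d s) \<le> r s (d s) + \<xi>" using r'[OF s dA[OF s]] by simp
    moreover have "\<gamma> * (\<Sum>i<S. K s (d s) i * (U i - V i))
        = \<gamma> * (\<Sum>i<S. K s (d s) i * U i) - \<gamma> * (\<Sum>i<S. K s (d s) i * V i)"
      by (simp add: right_diff_distrib sum_subtractf)
    ultimately show "U s - V s \<le> \<theta> * ((\<gamma> * (\<Sum>i<S. K s (d s) i * (U i - U 0)\<^sup>2) - (U s - U 0)\<^sup>2) / 6 + 13 * N) + (\<xi> + 4 * \<eta>)
      + \<gamma> * (\<Sum>i<S. K s (d s) i * (U i - V i))" using V[OF s] Us by linarith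
  qed
  then show ?thesis by (simp add: U_def V_def mult.assoc mult.left_commute add.assoc)
qed

end

section \<open>Bernstein's inequality for one row of samples\<close>

lemma nn_integral_pmf_finite:
  fixes p :: "nat pmf" and g :: "nat \<Rightarrow> real"
  assumes "set_pmf p \<subseteq> {..<S}" "\<And>i. 0 \<le> g i"
  shows "(\<integral>\<^sup>+x. ennreal (g x) \<partial>measure_pmf p) = ennreal (\<Sum>i<S. pmf p i * g i)"
proof -
  have "(\<integral>\<^sup>+x. ennreal (g x) \<partial>measure_pmf p) = ennreal (\<integral>x. g x \<partial>measure_pmf p)"
    using assms finite_subset[OF assms(1)]
    by (intro nn_integral_eq_integral integrable_measure_pmf_finite) auto
  also have "(\<integral>x. g x \<partial>measure_pmf p) = (\<Sum>i<S. g i * pmf p i)"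
    using assms(1) by (intro integral_measure_pmf_real) auto
  finally show ?thesis by (simp add: mult.commute)
qed

lemma pmf_sum_1:
  fixes p :: "nat pmf"
  assumes "set_pmf p \<subseteq> {..<S}"
  shows "(\<Sum>i<S. pmf p i) = 1"
  using assms by (intro sum_pmf_eq_1) auto

lemma variance_eq:
  fixes p f :: "nat \<Rightarrow> real"
  assumes "(\<Sum>i<m. p i) = 1"
  shows "(\<Sum>i<m. p i * (f i - c)\<^sup>2) =
    (\<Sum>i<m. p i * (f i)\<^sup>2) - (\<Sum>i<m. p i * f i)\<^sup>2 + ((\<Sum>i<m. p i * f i) - c)\<^sup>2"
proof -
  have "(\<Sum>i<m. p i * (f i - c)\<^sup>2) = (\<Sum>i<m. p i * (f i)\<^sup>2 - 2 * c * (p i * f i) + c\<^sup>2 * p i)"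
    by (intro sum.cong) (auto simp: power2_eq_square algebra_simps)
  also have "\<dots> = (\<Sum>i<m. p i * (f i)\<^sup>2) - 2 * c * (\<Sum>i<m. p i * f i) + c\<^sup>2 * (\<Sum>i<m. p i)"
    by (simp add: sum.distrib sum_subtractf sum_distrib_left)
  also have "\<dots> = (\<Sum>i<m. p i * (f i)\<^sup>2) - (\<Sum>i<m. p i * f i)\<^sup>2 + ((\<Sum>i<m. p i * f i) - c)\<^sup>2"
    using assms by (simp add: power2_eq_square algebra_simps)
  finally show ?thesis .
qed

lemma exp_le_quadratic:
  fixes y :: real
  assumes "\<bar>y\<bar> \<le> 1"
  shows "exp y \<le> 1 + y + y\<^sup>2"
proof -
  have "exp y \<le> 1 + y + \<bar>y\<bar>\<^sup>2" if "0 \<le> y" using exp_bound[of y] that assms by simp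
  moreover have "exp y \<le> 1 + y + y\<^sup>2" if "y < 0"
  proof -
    have "(1 - y) * (1 + y + y\<^sup>2) = 1 - y ^ 3" by (simp add: algebra_simps power2_eq_square power3_eq_cube)
    moreover have "y ^ 3 \<le> 0" using that by (simp add: power_le_zero_eq)
    ultimately have "1 \<le> (1 - y) * (1 + y + y\<^sup>2)" by simp
    also have "\<dots> \<le> exp (- y) * (1 + y + y\<^sup>2)"
      using exp_ge_add_one_self[of "- y"] assms that by (intro mult_right_mono) auto
    finally show ?thesis by (simp add: exp_minus field_simps)
  qed
  ultimately show ?thesis by (cases "0 \<le> y") auto
qed

text \<open>After the quadratic bound on \<open>exp\<close> the linear term vanishes by centring,
  and the quadratic term is \<open>t^2 * v\<close>.\<close>

lemma pmf_mgf_bound: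
  fixes p :: "nat pmf" and f :: "nat \<Rightarrow> real"
  assumes p: "set_pmf p \<subseteq> {..<S}"
  defines "\<mu> \<equiv> \<Sum>i<S. pmf p i * f i"
  defines "v \<equiv> (\<Sum>i<S. pmf p i * (f i)\<^sup>2) - \<mu>\<^sup>2"
  assumes t: "0 \<le> t" and b: "\<And>i. i < S \<Longrightarrow> t * \<bar>f i - \<mu>\<bar> \<le> 1"
  shows "(\<integral>\<^sup>+x. ennreal (exp (t * (f x - \<mu>))) \<partial>measure_pmf p) \<le> ennreal (exp (t\<^sup>2 * v))"
proof -
  note s1 = pmf_sum_1[OF p]
  have "(\<Sum>i<S. pmf p i * exp (t * (f i - \<mu>))) \<le> (\<Sum>i<S. pmf p i * (1 + t * (f i - \<mu>) + (t * (f i - \<mu>))\<^sup>2))"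
    using b t by (intro sum_mono mult_left_mono exp_le_quadratic) (auto simp: abs_mult)
  also have "\<dots> = (\<Sum>i<S. pmf p i + t * (pmf p i * (f i - \<mu>)) + t\<^sup>2 * (pmf p i * (f i - \<mu>)\<^sup>2))"
    by (intro sum.cong refl) (simp only: distrib_left power_mult_distrib mult_1_right mult.left_commute)
  also have "\<dots> = (\<Sum>i<S. pmf p i) + t * (\<Sum>i<S. pmf p i * (f i - \<mu>)) + t\<^sup>2 * (\<Sum>i<S. pmf p i * (f i - \<mu>)\<^sup>2)"
    by (simp add: sum.distrib sum_distrib_left)
  also have "\<dots> = 1 + t\<^sup>2 * v"
    unfolding variance_eq[OF s1] convex_sum_shift[OF s1] v_def by (simp add: \<mu>_def s1)
  also have "\<dots> \<le> exp (t\<^sup>2 * v)" by (rule exp_ge_add_one_self)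
  finally show ?thesis by (subst nn_integral_pmf_finite[OF p]) (auto intro: ennreal_leI)
qed

text \<open>Chernoff's bound with \<open>t\<close> left free. Optimizing it would put
  \<open>v\<close> under a square root, whereas the potential argument needs a bound linear in
  \<open>v\<close>.\<close>

lemma bernstein_upper:
  fixes p :: "nat pmf" and f :: "nat \<Rightarrow> real"
  assumes p: "set_pmf p \<subseteq> {..<S}" and n: "0 < n"
  defines "\<mu> \<equiv> \<Sum>i<S. pmf p i * f i"
  defines "v \<equiv> (\<Sum>i<S. pmf p i * (f i)\<^sup>2) - \<mu>\<^sup>2"
  defines "M \<equiv> PiM {..<n} (\<lambda>_. measure_pmf p)"
  assumes t: "0 < t" and b: "\<And>i. i < S \<Longrightarrow> t * \<bar>f i - \<mu>\<bar> \<le> 1"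
  shows "emeasure M {y \<in> space M. t * v + L / (real n * t) < (\<Sum>k<n. f (y k)) / real n - \<mu>} \<le> ennreal (exp (- L))"
    and "{y \<in> space M. t * v + L / (real n * t) < (\<Sum>k<n. f (y k)) / real n - \<mu>} \<in> sets M"
proof -
  interpret product_sigma_finite "\<lambda>_::nat. measure_pmf p"
    by standard
  have meas[measurable]: "(\<lambda>y. f (y k)) \<in> borel_measurable M" if "k < n" for k
    unfolding M_def using that by (intro measurable_compose[OF measurable_component_singleton]) auto
  have [measurable]: "(\<lambda>y. \<Sum>k<n. f (y k)) \<in> borel_measurable M"
    by (intro borel_measurable_sum) auto
  show "{y \<in> space M. t * v + L / (real n * t) < (\<Sum>k<n. f (y k)) / real n - \<mu>} \<in> sets M"
    by measurable
  define u where "u = (\<lambda>y. ennreal (exp (t * ((\<Sum>k<n. f (y k)) - real n * \<mu>))))"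
  define c where "c = real n * (t\<^sup>2 * v) + L"
  have u_prod: "u y = (\<Prod>k<n. ennreal (exp (t * (f (y k) - \<mu>))))" for y
  proof -
    have "t * ((\<Sum>k<n. f (y k)) - real n * \<mu>) = (\<Sum>k<n. t * (f (y k) - \<mu>))"
      by (simp add: sum_subtractf sum_distrib_left[symmetric])
    then show ?thesis unfolding u_def by (simp add: exp_sum prod_ennreal)
  qed
  have [measurable]: "u \<in> borel_measurable M" unfolding u_def by measurable
  have "(\<integral>\<^sup>+y. u y \<partial>M) = (\<Prod>k<n. \<integral>\<^sup>+x. ennreal (exp (t * (f x - \<mu>))) \<partial>measure_pmf p)"
    unfolding u_prod M_def by (intro product_nn_integral_prod) auto
  also have "\<dots> \<le> (\<Prod>k<n. ennreal (exp (t\<^sup>2 * v)))"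
    using t b unfolding v_def \<mu>_def by (intro prod_mono_ennreal pmf_mgf_bound[OF p]) auto
  also have "\<dots> = ennreal (exp (real n * (t\<^sup>2 * v)))"
    by (simp add: ennreal_power exp_of_nat_mult)
  finally have int: "(\<integral>\<^sup>+y. u y \<partial>M) \<le> ennreal (exp (real n * (t\<^sup>2 * v)))" .
  have "emeasure M {y \<in> space M. t * v + L / (real n * t) < (\<Sum>k<n. f (y k)) / real n - \<mu>}
    \<le> emeasure M {y \<in> space M. 1 \<le> ennreal (exp (- c)) * u y}"
  proof (rule emeasure_mono)
    show "{y \<in> space M. t * v + L / (real n * t) < (\<Sum>k<n. f (y k)) / real n - \<mu>}
      \<subseteq> {y \<in> space M. 1 \<le> ennreal (exp (- c)) * u y}"
    proof safe
      fix y assume "t * v + L / (real n * t) < (\<Sum>k<n. f (y k)) / real n - \<mu>"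
      then have "real n * t * (t * v + L / (real n * t)) < real n * t * ((\<Sum>k<n. f (y k)) / real n - \<mu>)"
        using n t by (intro mult_strict_left_mono) auto
      moreover have "real n * t * (t * v + L / (real n * t)) = c"
        using n t by (simp add: c_def field_simps power2_eq_square)
      moreover have "real n * t * ((\<Sum>k<n. f (y k)) / real n - \<mu>) = t * ((\<Sum>k<n. f (y k)) - real n * \<mu>)"
        using n by (simp add: field_simps)
      ultimately have "1 \<le> exp (- c + t * ((\<Sum>k<n. f (y k)) - real n * \<mu>))" by simp
      then have "1 \<le> exp (- c) * exp (t * ((\<Sum>k<n. f (y k)) - real n * \<mu>))" by (simp only: exp_add)
      then show "1 \<le> ennreal (exp (- c)) * u y"
        unfolding u_def by (simp add: ennreal_mult[symmetric] ennreal_1[symmetric] del: ennreal_1)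
    qed
  qed measurable
  also have "\<dots> \<le> ennreal (exp (- c)) * (\<integral>\<^sup>+y. u y * indicator (space M) y \<partial>M)"
    by (rule nn_integral_Markov_inequality) auto
  also have "(\<integral>\<^sup>+y. u y * indicator (space M) y \<partial>M) = (\<integral>\<^sup>+y. u y \<partial>M)"
    by (intro nn_integral_cong) auto
  also have "ennreal (exp (- c)) * (\<integral>\<^sup>+y. u y \<partial>M) \<le> ennreal (exp (- c)) * ennreal (exp (real n * (t\<^sup>2 * v)))"
    using int by (rule mult_left_mono) simp
  also have "\<dots> = ennreal (exp (- L))"
    by (simp add: ennreal_mult[symmetric] exp_add[symmetric] c_def)
  finally show "emeasure M {y \<in> space M. t * v + L / (real n * t) < (\<Sum>k<n. f (y k)) / real n - \<mu>}
    \<le> ennreal (exp (- L))" .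
qed

lemma bernstein:
  fixes p :: "nat pmf" and f :: "nat \<Rightarrow> real" and t L :: real
  assumes p: "set_pmf p \<subseteq> {..<S}" and n: "0 < n"
  defines "\<mu> \<equiv> \<Sum>i<S. pmf p i * f i"
  defines "v \<equiv> (\<Sum>i<S. pmf p i * (f i)\<^sup>2) - \<mu>\<^sup>2"
  defines "M \<equiv> PiM {..<n} (\<lambda>_. measure_pmf p)"
  defines "B \<equiv> {y \<in> space M. t * v + L / (real n * t) < \<bar>(\<Sum>k<n. f (y k)) / real n - \<mu>\<bar>}"
  assumes t: "0 < t" and b: "\<And>i. i < S \<Longrightarrow> t * \<bar>f i - \<mu>\<bar> \<le> 1"
  shows "emeasure M B \<le> ennreal (2 * exp (- L))" and "B \<in> sets M"
proof -
  define B1 where "B1 = {y \<in> space M. t * v + L / (real n * t) < (\<Sum>k<n. f (y k)) / real n - \<mu>}"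
  define B2 where "B2 = {y \<in> space M. t * v + L / (real n * t) < (\<Sum>k<n. - f (y k)) / real n - - \<mu>}"
  have neg: "- \<mu> = (\<Sum>i<S. pmf p i * - f i)" "v = (\<Sum>i<S. pmf p i * (- f i)\<^sup>2) - (- \<mu>)\<^sup>2"
    by (simp_all add: \<mu>_def v_def sum_negf)
  have bm: "t * \<bar>- f i - - \<mu>\<bar> \<le> 1" if "i < S" for i using b[OF that] by (simp add: abs_minus_commute)
  have B1: "emeasure M B1 \<le> ennreal (exp (- L))" "B1 \<in> sets M"
    using bernstein_upper[OF p n t b[unfolded \<mu>_def]] unfolding B1_def M_def v_def \<mu>_def by auto
  have B2: "emeasure M B2 \<le> ennreal (exp (- L))" "B2 \<in> sets M"
    using bernstein_upper[OF p n t bm[unfolded neg(1)], folded neg(1), folded neg(2)]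
    unfolding B2_def M_def by auto
  have "(\<Sum>k<n. - f (y k)) / real n - - \<mu> = - ((\<Sum>k<n. f (y k)) / real n - \<mu>)" for y
    by (simp add: sum_negf)
  moreover have "c < \<bar>x\<bar> \<longleftrightarrow> c < x \<or> c < - x" for c x :: real by (auto simp: abs_if)
  ultimately have B: "B = B1 \<union> B2" unfolding B_def B1_def B2_def by auto
  then show "B \<in> sets M" using B1 B2 by auto
  have "emeasure M B \<le> emeasure M B1 + emeasure M B2"
    unfolding B by (rule emeasure_subadditive[OF B1(2) B2(2)])
  also have "\<dots> \<le> ennreal (exp (- L)) + ennreal (exp (- L))" by (rule add_mono[OF B1(1) B2(1)])
  also have "\<dots> = ennreal (2 * exp (- L))" by (simp add: ennreal_plus[symmetric] del: ennreal_plus)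
  finally show "emeasure M B \<le> ennreal (2 * exp (- L))" .
qed

definition emp_row :: "nat \<Rightarrow> (nat \<Rightarrow> nat) \<Rightarrow> nat \<Rightarrow> real" where
  "emp_row n y i = real (card {k. k < n \<and> y k = i}) / real n"

lemma emp_row_sum:
  assumes "\<And>k. k < n \<Longrightarrow> y k < S"
  shows "(\<Sum>i<S. emp_row n y i * f i) = (\<Sum>k<n. f (y k)) / real n"
proof -
  have "real (card {k. k < n \<and> y k = i}) = (\<Sum>k<n. if y k = i then 1 else 0)" for i
    by (simp add: sum.If_cases) (intro arg_cong[where f = card], auto)
  then have "(\<Sum>i<S. emp_row n y i * f i) = (\<Sum>i<S. \<Sum>k<n. if y k = i then f i else 0) / real n"
    unfolding emp_row_def sum_divide_distrib[of _ "{..<S}"]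
    by (intro sum.cong refl) (simp add: sum_distrib_right if_distrib[of "\<lambda>x. x * _"] cong: if_cong)
  also have "(\<Sum>i<S. \<Sum>k<n. if y k = i then f i else 0) = (\<Sum>k<n. \<Sum>i<S. if y k = i then f i else 0)"
    by (rule sum.swap)
  also have "\<dots> = (\<Sum>k<n. f (y k))" using assms by (intro sum.cong) (auto simp: sum.delta')
  finally show ?thesis .
qed

text \<open>\<open>\<theta>\<close> is chosen such that
  \<open>L / (n * \<theta>) = \<theta> * N\<close>, so both Bernstein terms carry the factor
  \<open>\<theta>\<close>. Samples outside the state range are excluded because empirical averages
  are formed over \<open>{..<S}\<close> only. A measurable cover of the bad set suffices for the
  slicing bounds.\<close>

lemma row_good_probability:
  fixes p :: "nat pmf" and f :: "nat \<Rightarrow> real"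
  assumes p: "set_pmf p \<subseteq> {..<S}" and n: "0 < n" and g: "0 < \<gamma>" "\<gamma> < 1"
    and f: "\<And>i. i < S \<Longrightarrow> \<bar>f i\<bar> \<le> N" and N: "1 \<le> N" and L: "0 < L" "L * N \<le> real n"
  defines "M \<equiv> PiM {..<n} (\<lambda>_. measure_pmf p)"
  defines "\<theta> \<equiv> sqrt (L / (real n * N))"
  shows "\<exists>B\<in>sets M. emeasure M B \<le> ennreal (4 * exp (- L)) \<and>
    {y \<in> space M. (\<forall>k<n. y k < S) \<and> \<not> row_good S \<gamma> N \<theta> (pmf p) (emp_row n y) f} \<subseteq> B"
proof -
  define \<mu> where "\<mu> = (\<Sum>i<S. pmf p i * f i)"
  define \<mu>2 where "\<mu>2 = (\<Sum>i<S. pmf p i * (f i)\<^sup>2)"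
  define v where "v = \<mu>2 - \<mu>\<^sup>2"
  define v2 where "v2 = (\<Sum>i<S. pmf p i * ((f i)\<^sup>2)\<^sup>2) - \<mu>2\<^sup>2"
  note s1 = pmf_sum_1[OF p]
  have th: "0 < \<theta>" "\<theta>\<^sup>2 = L / (real n * N)" using L N n by (auto simp: \<theta>_def)
  have thN: "\<theta> * N \<le> 1"
  proof (rule power2_le_imp_le)
    have "(\<theta> * N)\<^sup>2 = L / (real n * N) * N\<^sup>2" by (simp add: power_mult_distrib th(2))
    also have "\<dots> = L * N / real n" using N by (simp add: power2_eq_square)
    also have "\<dots> \<le> 1" using L n by simp
    finally show "(\<theta> * N)\<^sup>2 \<le> 1\<^sup>2" by simp
  qed simp
  have mu: "\<bar>\<mu>\<bar> \<le> N" unfolding \<mu>_def using f s1 by (intro convex_sum_abs_le) auto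
  have f2: "0 \<le> (f i)\<^sup>2" "(f i)\<^sup>2 \<le> N\<^sup>2" if "i < S" for i
    using power_mono[OF f[OF that], of 2] by auto
  have mu2: "0 \<le> \<mu>2" "\<mu>2 \<le> N\<^sup>2" unfolding \<mu>2_def
    using f2 s1 by (auto intro!: convex_sum_le sum_nonneg)
  \<comment> \<open>The mean square of \<open>f^2\<close> about any point bounds its variance; about
    \<open>\<mu>^2\<close> it factors, with
    \<open>\<bar>f + \<mu>\<bar> \<le> 2 * N\<close>.\<close>
  have v2: "v2 \<le> 4 * N\<^sup>2 * v"
  proof -
    have "v2 \<le> (\<Sum>i<S. pmf p i * ((f i)\<^sup>2 - \<mu>\<^sup>2)\<^sup>2)"
      unfolding variance_eq[OF s1] v2_def \<mu>2_def by simp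
    also have "\<dots> \<le> (\<Sum>i<S. pmf p i * (4 * N\<^sup>2 * (f i - \<mu>)\<^sup>2))"
    proof (intro sum_mono mult_left_mono)
      fix i assume "i \<in> {..<S}"
      then have "\<bar>f i + \<mu>\<bar> \<le> 2 * N" using f mu by fastforce
      then have "(f i + \<mu>)\<^sup>2 \<le> (2 * N)\<^sup>2" using N by (metis abs_ge_zero power2_abs power_mono)
      then have "(f i - \<mu>)\<^sup>2 * (f i + \<mu>)\<^sup>2 \<le> (f i - \<mu>)\<^sup>2 * (4 * N\<^sup>2)"
        by (intro mult_left_mono) (auto simp: power_mult_distrib)
      moreover have "((f i)\<^sup>2 - \<mu>\<^sup>2)\<^sup>2 = (f i - \<mu>)\<^sup>2 * (f i + \<mu>)\<^sup>2"
        by (simp add: power2_eq_square algebra_simps)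
      ultimately show "((f i)\<^sup>2 - \<mu>\<^sup>2)\<^sup>2 \<le> 4 * N\<^sup>2 * (f i - \<mu>)\<^sup>2" by (simp add: mult.commute)
    qed auto
    also have "\<dots> = 4 * N\<^sup>2 * (\<Sum>i<S. pmf p i * (f i - \<mu>)\<^sup>2)"
      by (simp add: sum_distrib_left mult.left_commute)
    also have "\<dots> = 4 * N\<^sup>2 * v"
      unfolding variance_eq[OF s1] by (simp add: \<mu>_def[symmetric] \<mu>2_def[symmetric] v_def)
    finally show ?thesis .
  qed
  define t where "t = \<gamma> * \<theta> / 8"
  \<comment> \<open>With \<open>v2 \<le> 4 * N^2 * v\<close> this makes the variance term
    \<open>v / 4\<close>; the other term is \<open>16 * N * (L * N / n)\<close>, at most
    \<open>16 * N\<close> since \<open>L * N \<le> n\<close>.\<close>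
  define t2 where "t2 = 1 / (16 * N\<^sup>2)"
  define B1 where "B1 = {y \<in> space M. t * v + L / (real n * t) < \<bar>(\<Sum>k<n. f (y k)) / real n - \<mu>\<bar>}"
  define B2 where "B2 = {y \<in> space M. t2 * v2 + L / (real n * t2) < \<bar>(\<Sum>k<n. (f (y k))\<^sup>2) / real n - \<mu>2\<bar>}"
  have t0: "0 < t" "0 < t2" using g th N by (auto simp: t_def t2_def)
  have tb: "t * \<bar>f i - \<mu>\<bar> \<le> 1" if "i < S" for i
  proof -
    have "t * \<bar>f i - \<mu>\<bar> \<le> \<theta> / 8 * (2 * N)"
      using f[OF that] mu g th N by (intro mult_mono) (auto simp: t_def)
    also have "\<theta> / 8 * (2 * N) = \<theta> * N / 4" by simp
    finally show ?thesis using thN by linarith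
  qed
  have t2b: "t2 * \<bar>(f i)\<^sup>2 - \<mu>2\<bar> \<le> 1" if "i < S" for i
  proof -
    have "\<bar>(f i)\<^sup>2 - \<mu>2\<bar> \<le> N\<^sup>2" using f2[OF that] mu2 zero_le_power2[of "f i"] unfolding abs_le_iff by linarith
    then have "t2 * \<bar>(f i)\<^sup>2 - \<mu>2\<bar> \<le> t2 * N\<^sup>2" using t0 by (intro mult_left_mono) auto
    then show ?thesis using N by (simp add: t2_def)
  qed
  have B1: "emeasure M B1 \<le> ennreal (2 * exp (- L))" "B1 \<in> sets M"
    using bernstein[OF p n t0(1) tb[unfolded \<mu>_def], of L]
    unfolding B1_def M_def v_def \<mu>_def \<mu>2_def by auto
  have B2: "emeasure M B2 \<le> ennreal (2 * exp (- L))" "B2 \<in> sets M"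
    using bernstein[OF p n t0(2) t2b[unfolded \<mu>2_def], of L]
    unfolding B2_def M_def v2_def \<mu>2_def by auto
  have "emeasure M (B1 \<union> B2) \<le> emeasure M B1 + emeasure M B2"
    by (rule emeasure_subadditive[OF B1(2) B2(2)])
  also have "\<dots> \<le> ennreal (2 * exp (- L)) + ennreal (2 * exp (- L))" by (rule add_mono[OF B1(1) B2(1)])
  also have "\<dots> = ennreal (4 * exp (- L))" by (simp add: ennreal_plus[symmetric] del: ennreal_plus)
  finally have em: "emeasure M (B1 \<union> B2) \<le> ennreal (4 * exp (- L))" .
  have e1: "t * v + L / (real n * t) = \<theta> * (\<gamma> * v / 8 + 8 * N / \<gamma>)"
  proof -
    have "L / (real n * t) = 8 * (L / (real n * \<theta>)) / \<gamma>" by (simp add: t_def mult_ac)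
    also have "L / (real n * \<theta>) = \<theta> * N"
      using th N n by (simp add: field_simps power2_eq_square)
    finally show ?thesis by (simp add: t_def algebra_simps)
  qed
  have e2: "t2 * v2 + L / (real n * t2) \<le> v / 4 + 16 * N"
  proof -
    have "t2 * v2 \<le> t2 * (4 * N\<^sup>2 * v)" using v2 t0 by (intro mult_left_mono) auto
    also have "\<dots> = v / 4" using N by (simp add: t2_def)
    finally have "t2 * v2 \<le> v / 4" .
    moreover have "L / (real n * t2) = 16 * N * (L * N / real n)" by (simp add: t2_def power2_eq_square)
    moreover have "16 * N * (L * N / real n) \<le> 16 * N * 1" using L n N by (intro mult_left_mono) auto
    ultimately show ?thesis by simp
  qed
  have "{y \<in> space M. (\<forall>k<n. y k < S) \<and> \<not> row_good S \<gamma> N \<theta> (pmf p) (emp_row n y) f} \<subseteq> B1 \<union> B2"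
  proof safe
    fix y assume y: "y \<in> space M" "\<forall>k<n. y k < S" "y \<notin> B2" and bad: "\<not> row_good S \<gamma> N \<theta> (pmf p) (emp_row n y) f"
    have q: "(\<Sum>i<S. emp_row n y i * h i) = (\<Sum>k<n. h (y k)) / real n" for h
      using y(2) by (intro emp_row_sum) auto
    have "\<bar>(\<Sum>k<n. (f (y k))\<^sup>2) / real n - \<mu>2\<bar> \<le> v / 4 + 16 * N"
      using y(1,3) e2 unfolding B2_def by auto
    then have "\<not> \<bar>(\<Sum>k<n. f (y k)) / real n - \<mu>\<bar> \<le> \<theta> * (\<gamma> * v / 8 + 8 * N / \<gamma>)"
      using bad unfolding row_good_def Let_def q[of f] q[of "\<lambda>i. (f i)\<^sup>2"]
      by (simp add: \<mu>_def[symmetric] \<mu>2_def[symmetric] v_def[symmetric])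
    then show "y \<in> B1" unfolding B1_def using y(1) e1 by simp
  qed
  then show ?thesis using em B1 B2 by (intro bexI[of _ "B1 \<union> B2"]) auto
qed

section \<open>Slicing product measures, and measurability\<close>

text \<open>Fubini in a single coordinate; all uses of independence go through bounds of this kind.
  With the other coordinates frozen, a function that ignores coordinate \<open>e\<close> is
  deterministic.\<close>

lemma emeasure_PiM_slice_le:
  assumes M: "\<And>i. prob_space (M i)" and I: "finite I" "e \<in> I" and B: "B \<in> sets (PiM I M)"
    and slice: "\<And>x. emeasure (M e) {y \<in> space (M e). x(e := y) \<in> B} \<le> c"
  shows "emeasure (PiM I M) B \<le> c"
proof -
  interpret product_prob_space M by (simp add: product_prob_space_def product_prob_space_axioms_def
    product_sigma_finite_def M prob_space_imp_sigma_finite)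
  define J where "J = I - {e}"
  have J: "finite J" "e \<notin> J" "I = insert e J" using I by (auto simp: J_def)
  interpret PJ: prob_space "PiM J M" by (intro prob_space_PiM M)
  have "emeasure (PiM I M) B = (\<integral>\<^sup>+x. indicator B x \<partial>PiM (insert e J) M)"
    using B J by simp
  also have "\<dots> = (\<integral>\<^sup>+x. (\<integral>\<^sup>+y. indicator B (x(e := y)) \<partial>M e) \<partial>PiM J M)"
    using J B by (intro product_nn_integral_insert) auto
  also have "\<dots> \<le> (\<integral>\<^sup>+x. c \<partial>PiM J M)"
  proof (rule nn_integral_mono)
    fix x assume x: "x \<in> space (PiM J M)"
    have "(\<lambda>y. x(e := y)) \<in> measurable (M e) (PiM I M)"
      unfolding J(3) by (rule measurable_fun_upd[of _ J]) (use x in auto)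
    then have "{y \<in> space (M e). x(e := y) \<in> B} \<in> sets (M e)"
      using B by (simp add: measurable_def vimage_def Int_def conj_commute)
    then have "emeasure (M e) {y \<in> space (M e). x(e := y) \<in> B}
        = (\<integral>\<^sup>+y. indicator {y \<in> space (M e). x(e := y) \<in> B} y \<partial>M e)"
      by simp
    also have "\<dots> = (\<integral>\<^sup>+y. indicator B (x(e := y)) \<partial>M e)"
      by (intro nn_integral_cong) (simp add: indicator_def)
    finally show "(\<integral>\<^sup>+y. indicator B (x(e := y)) \<partial>M e) \<le> c" using slice[of x] by simp
  qed
  also have "\<dots> = c" by (simp add: PJ.emeasure_space_1)
  finally show ?thesis .
qed

lemma emeasure_pair_slice1_le:
  assumes "prob_space M1" "prob_space M2" and B: "B \<in> sets (M1 \<Otimes>\<^sub>M M2)"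
    and slice: "\<And>y. y \<in> space M2 \<Longrightarrow> emeasure M1 ((\<lambda>x. (x, y)) -` B) \<le> c"
  shows "emeasure (M1 \<Otimes>\<^sub>M M2) B \<le> c"
proof -
  interpret M1: prob_space M1 by fact
  interpret M2: prob_space M2 by fact
  interpret pair_sigma_finite M1 M2 ..
  have "emeasure (M1 \<Otimes>\<^sub>M M2) B \<le> (\<integral>\<^sup>+y. c \<partial>M2)"
    unfolding emeasure_pair_measure_alt2[OF B] by (intro nn_integral_mono slice)
  then show ?thesis by (simp add: M2.emeasure_space_1)
qed

lemma emeasure_pair_slice2_le:
  assumes "prob_space M1" "prob_space M2" and B: "B \<in> sets (M1 \<Otimes>\<^sub>M M2)"
    and slice: "\<And>x. x \<in> space M1 \<Longrightarrow> emeasure M2 (Pair x -` B) \<le> c"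
  shows "emeasure (M1 \<Otimes>\<^sub>M M2) B \<le> c"
proof -
  interpret M1: prob_space M1 by fact
  interpret M2: prob_space M2 by fact
  have "emeasure (M1 \<Otimes>\<^sub>M M2) B \<le> (\<integral>\<^sup>+x. c \<partial>M1)"
    unfolding M2.emeasure_pair_measure_alt[OF B] by (intro nn_integral_mono slice)
  then show ?thesis by (simp add: M1.emeasure_space_1)
qed

lemma prob_space_uniform_interval: "0 < \<xi> \<Longrightarrow> prob_space (uniform_measure lborel {0..\<xi>::real})"
  by (intro prob_space_uniform_measure) auto

lemma uniform_interval_le:
  fixes \<xi> c w :: real
  assumes "0 < \<xi>" "0 \<le> w"
  shows "emeasure (uniform_measure lborel {0..\<xi>}) {y. \<bar>y - c\<bar> \<le> w} \<le> ennreal (2 * w / \<xi>)"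
proof -
  have eq: "{y. \<bar>y - c\<bar> \<le> w} = {c - w..c + w}" by auto
  have "emeasure (uniform_measure lborel {0..\<xi>}) {y. \<bar>y - c\<bar> \<le> w} = emeasure lborel ({0..\<xi>} \<inter> {c - w..c + w}) / emeasure lborel {0..\<xi>}"
    unfolding eq by (subst emeasure_uniform_measure) auto
  also have "\<dots> \<le> emeasure lborel {c - w..c + w} / emeasure lborel {0..\<xi>}"
    by (intro divide_right_mono_ennreal emeasure_mono) auto
  also have "\<dots> = ennreal (2 * w / \<xi>)" using assms by (simp add: divide_ennreal)
  finally show ?thesis .
qed

lemma uniform_interval_outside:
  fixes \<xi> :: real
  assumes "0 < \<xi>"
  shows "emeasure (uniform_measure lborel {0..\<xi>}) {y. y \<notin> {0..\<xi>}} = 0"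
proof -
  have "{y. y \<notin> {0..\<xi>}} = - {0..\<xi>}" by auto
  then show ?thesis using assms by (subst emeasure_uniform_measure) auto
qed

lemma measurable_fix_lim:
  assumes T: "\<And>v s. s < S \<Longrightarrow> (\<And>s'. s' < S \<Longrightarrow> (\<lambda>\<omega>. v \<omega> s') \<in> borel_measurable M) \<Longrightarrow>
      (\<lambda>\<omega>. T \<omega> (v \<omega>) s) \<in> borel_measurable M" and s: "s < S"
  shows "(\<lambda>\<omega>. fix_lim (T \<omega>) s) \<in> borel_measurable M"
proof -
  have "s < S \<longrightarrow> (\<lambda>\<omega>. (T \<omega> ^^ k) (\<lambda>_. 0) s) \<in> borel_measurable M" for k s
  proof (induction k arbitrary: s)
    case (Suc k)
    then show ?case using T[of s "\<lambda>\<omega>. (T \<omega> ^^ k) (\<lambda>_. 0)"] by simp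
  qed simp
  then show ?thesis unfolding fix_lim_def using s by (intro borel_measurable_lim_metric) auto
qed

lemma measurable_action_value:
  assumes K: "\<And>s'. s' < S \<Longrightarrow> (\<lambda>\<omega>. K \<omega> s a s') \<in> borel_measurable M"
    and r: "(\<lambda>\<omega>. r \<omega> s a) \<in> borel_measurable M"
    and v: "\<And>s'. s' < S \<Longrightarrow> (\<lambda>\<omega>. v \<omega> s') \<in> borel_measurable M"
  shows "(\<lambda>\<omega>. action_value S \<gamma> (K \<omega>) (r \<omega>) e u (v \<omega>) s a) \<in> borel_measurable M"
proof -
  note [measurable] = r
  have [measurable]: "(\<lambda>\<omega>. \<Sum>s'<S. K \<omega> s a s' * v \<omega> s') \<in> borel_measurable M"
    by (intro borel_measurable_sum borel_measurable_times K v) auto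
  show ?thesis unfolding action_value_def by measurable
qed

lemma measurable_bellman_value:
  assumes K: "\<And>s a s'. s < S \<Longrightarrow> a < A \<Longrightarrow> s' < S \<Longrightarrow> (\<lambda>\<omega>. K \<omega> s a s') \<in> borel_measurable M"
    and r: "\<And>s a. s < S \<Longrightarrow> a < A \<Longrightarrow> (\<lambda>\<omega>. r \<omega> s a) \<in> borel_measurable M" and s: "s < S"
  shows "(\<lambda>\<omega>. bellman_value S A \<gamma> (K \<omega>) (r \<omega>) e u s) \<in> borel_measurable M"
  unfolding bellman_value_def
proof (rule measurable_fix_lim[OF _ s])
  fix v :: "_ \<Rightarrow> nat \<Rightarrow> real" and s :: nat assume s: "s < S" and v: "\<And>s'. s' < S \<Longrightarrow> (\<lambda>\<omega>. v \<omega> s') \<in> borel_measurable M"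
  show "(\<lambda>\<omega>. Max (action_value S \<gamma> (K \<omega>) (r \<omega>) e u (v \<omega>) s ` {..<A})) \<in> borel_measurable M"
    using s by (intro borel_measurable_Max measurable_action_value K r v) auto
qed

lemma measurable_row_good:
  assumes q: "\<And>i. i < S \<Longrightarrow> (\<lambda>\<omega>. q \<omega> i) \<in> borel_measurable M"
    and f: "\<And>i. i < S \<Longrightarrow> (\<lambda>\<omega>. f \<omega> i) \<in> borel_measurable M"
  shows "Measurable.pred M (\<lambda>\<omega>. row_good S \<gamma> N \<theta> p (q \<omega>) (f \<omega>))"
proof -
  have pred: "Measurable.pred M (\<lambda>\<omega>. \<bar>a \<omega> - b \<omega>\<bar> \<le> \<theta> * (\<gamma> * (d \<omega> - (b \<omega>)\<^sup>2) / 8 + 8 * N / \<gamma>)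
      \<and> \<bar>c \<omega> - d \<omega>\<bar> \<le> (d \<omega> - (b \<omega>)\<^sup>2) / 4 + 16 * N)"
    if [measurable]: "a \<in> borel_measurable M" "b \<in> borel_measurable M" "c \<in> borel_measurable M"
      "d \<in> borel_measurable M" for a b c d :: "_ \<Rightarrow> real"
    by measurable
  show ?thesis unfolding row_good_def Let_def
    by (rule pred) (intro borel_measurable_sum borel_measurable_times borel_measurable_power
        borel_measurable_const q f; simp)+
qed

section \<open>The random model and its bad events\<close>

locale sampled = discounted +
  fixes n :: nat and P :: "nat \<Rightarrow> nat \<Rightarrow> nat pmf" and r :: "nat \<Rightarrow> nat \<Rightarrow> real" and \<xi> L :: real
  assumes n_pos: "0 < n" and P: "\<And>s a. s < S \<Longrightarrow> a < A \<Longrightarrow> set_pmf (P s a) \<subseteq> {..<S}"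
    and reward: "\<And>s a. s < S \<Longrightarrow> a < A \<Longrightarrow> 0 \<le> r s a \<and> r s a \<le> 1"
    and xi: "0 < \<xi>" and L_pos: "0 < L"
begin

abbreviation pairs :: "(nat \<times> nat) set" where "pairs \<equiv> {..<S} \<times> {..<A}"
abbreviation row_measure :: "nat \<times> nat \<Rightarrow> (nat \<Rightarrow> nat) measure" where
  "row_measure sa \<equiv> PiM {..<n} (\<lambda>i. measure_pmf (P (fst sa) (snd sa)))"
abbreviation XM where "XM \<equiv> sample_measure S A n P"
abbreviation DM where "DM \<equiv> noise_measure S A \<xi>"
abbreviation M where "M \<equiv> data_measure S A n P \<xi>"
abbreviation perturbed :: "(nat \<times> nat \<Rightarrow> real) \<Rightarrow> nat \<Rightarrow> nat \<Rightarrow> real" where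
  "perturbed D s a \<equiv> r s a + D (s, a)"
definition sampled_value :: "nat \<times> nat \<Rightarrow> real \<Rightarrow> (nat \<times> nat \<Rightarrow> nat \<Rightarrow> nat) \<times> (nat \<times> nat \<Rightarrow> real) \<Rightarrow> nat \<Rightarrow> real" where
  "sampled_value e u \<omega> = bellman_value S A \<gamma> (emp_kernel n (fst \<omega>)) (perturbed (snd \<omega>)) e u"

lemma prob_row: "prob_space (row_measure sa)"
  by (intro prob_space_PiM prob_space_measure_pmf)

lemma prob_XM: "prob_space XM" unfolding sample_measure_def by (intro prob_space_PiM prob_row)
lemma prob_DM: "prob_space DM" unfolding noise_measure_def
  by (intro prob_space_PiM prob_space_uniform_interval xi)

lemma prob_M: "prob_space M"
proof -
  interpret X: prob_space XM by (rule prob_XM)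
  interpret D: prob_space DM by (rule prob_DM)
  interpret pair_prob_space XM DM ..
  show ?thesis unfolding data_measure_def by unfold_locales
qed

lemma measurable_sample: "e \<in> pairs \<Longrightarrow> k < n \<Longrightarrow> (\<lambda>\<omega>. fst \<omega> e k) \<in> measurable M (count_space UNIV)"
proof -
  assume e: "e \<in> pairs" and k: "k < n"
  have "(\<lambda>\<omega>. fst \<omega> e) \<in> measurable M (row_measure e)"
    unfolding data_measure_def sample_measure_def using e by measurable
  then have "(\<lambda>\<omega>. fst \<omega> e k) \<in> measurable M (measure_pmf (P (fst e) (snd e)))"
    by (rule measurable_compose) (use k in \<open>auto intro: measurable_component_singleton\<close>)
  then show ?thesis by (simp cong: measurable_cong_sets)
qed

lemma measurable_noise: "e \<in> pairs \<Longrightarrow> (\<lambda>\<omega>. snd \<omega> e) \<in> borel_measurable M"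
proof -
  assume e: "e \<in> pairs"
  have "(\<lambda>\<omega>. snd \<omega> e) \<in> measurable M (uniform_measure lborel {0..\<xi>})"
    unfolding data_measure_def noise_measure_def using e by measurable
  then show ?thesis by (simp cong: measurable_cong_sets)
qed

lemma measurable_emp_row:
  assumes e: "e \<in> pairs"
  shows "(\<lambda>\<omega>. emp_row n (fst \<omega> e) i) \<in> borel_measurable M"
proof -
  have "emp_row n y i = (\<Sum>k<n. (if y k = i then 1 else 0)) / real n" for y
    unfolding emp_row_def
    by (simp add: sum.If_cases lessThan_def Collect_conj_eq)
  moreover have "(\<lambda>\<omega>. \<Sum>k<n. (if fst \<omega> e k = i then 1 else 0 :: real)) \<in> borel_measurable M"
  proof (intro borel_measurable_sum)
    fix k assume "k \<in> {..<n}"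
    then have [measurable]: "(\<lambda>\<omega>. fst \<omega> e k) \<in> measurable M (count_space UNIV)"
      using measurable_sample[OF e] by simp
    show "(\<lambda>\<omega>. if fst \<omega> e k = i then 1 else 0 :: real) \<in> borel_measurable M" by measurable
  qed
  ultimately show ?thesis by simp
qed

lemma emp_kernel_eq: "emp_kernel n X s a s' = emp_row n (X (s, a)) s'"
  by (simp add: emp_kernel_def emp_row_def)

lemma measurable_kernel_perturbed:
  assumes "s < S" "a < A"
  shows "(\<lambda>\<omega>. emp_kernel n (fst \<omega>) s a s') \<in> borel_measurable M"
    "(\<lambda>\<omega>. perturbed (snd \<omega>) s a) \<in> borel_measurable M"
proof -
  have e: "(s, a) \<in> pairs" using assms by simp
  note [measurable] = measurable_noise[OF e]
  show "(\<lambda>\<omega>. emp_kernel n (fst \<omega>) s a s') \<in> borel_measurable M"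
    unfolding emp_kernel_eq by (rule measurable_emp_row[OF e])
  show "(\<lambda>\<omega>. perturbed (snd \<omega>) s a) \<in> borel_measurable M" by measurable
qed

lemma measurable_sampled_value: "i < S \<Longrightarrow> (\<lambda>\<omega>. sampled_value e u \<omega> i) \<in> borel_measurable M"
  unfolding sampled_value_def
  by (rule measurable_bellman_value[OF measurable_kernel_perturbed])

lemma measurable_strictly_greedy:
  "Measurable.pred M (\<lambda>\<omega>. strictly_greedy 0 (emp_kernel n (fst \<omega>)) (perturbed (snd \<omega>)) e u d)"
proof (cases "\<forall>s<S. d s < A")
  case True
  define av where "av = (\<lambda>s a \<omega>. action_value S \<gamma> (emp_kernel n (fst \<omega>)) (perturbed (snd \<omega>)) e u (sampled_value e u \<omega>) s a)"
  have av_eq: "action_value S \<gamma> (emp_kernel n (fst \<omega>)) (perturbed (snd \<omega>)) e u (sampled_value e u \<omega>) s a = av s a \<omega>" for s a \<omega>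
    by (simp add: av_def)
  have av: "av s a \<in> borel_measurable M" if "s < S" "a < A" for s a
    unfolding av_def
    by (rule measurable_action_value) (assumption | rule measurable_kernel_perturbed[OF that] measurable_sampled_value)+
  have "Measurable.pred M (\<lambda>\<omega>. \<forall>s\<in>{..<S}. \<forall>a\<in>{a. a < A \<and> a \<noteq> d s}. av s a \<omega> < av s (d s) \<omega>)"
    using True by (intro pred_intros_finite(3) borel_measurable_pred_less av) auto
  moreover have eq: "strictly_greedy 0 (emp_kernel n (fst \<omega>)) (perturbed (snd \<omega>)) e u d \<longleftrightarrow>
    (\<forall>s\<in>{..<S}. \<forall>a\<in>{a. a < A \<and> a \<noteq> d s}. av s a \<omega> < av s (d s) \<omega>)" for \<omega>
    using True unfolding strictly_greedy_def sampled_value_def[symmetric] av_eq add_0_right by blast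
  ultimately show ?thesis unfolding eq by blast
next
  case False
  then have eq: "strictly_greedy 0 K r' e u d = False" for K r' unfolding strictly_greedy_def by blast
  show ?thesis unfolding eq by measurable
qed

lemma sampled_value_row_independent: "sampled_value e u (X(e := y), D) i = sampled_value e u (X, D) i" if "i < S"
  unfolding sampled_value_def by (rule bellman_value_cong[OF _ _ that]) (auto simp: emp_kernel_eq)

lemma sampled_value_noise_independent: "sampled_value e u (X, D(e := y)) i = sampled_value e u (X, D) i" if "i < S"
  unfolding sampled_value_def by (rule bellman_value_cong[OF _ _ that]) auto

text \<open>The comparison at \<open>e\<close> itself uses \<open>u\<close> in place of the row
  average, so the choice of the greedy policy, and not only the value, ignores the row at
  \<open>e\<close>.\<close>

lemma strictly_greedy_row_independent:
  "strictly_greedy 0 (emp_kernel n (X(e := y))) (perturbed D) e u d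
    \<longleftrightarrow> strictly_greedy 0 (emp_kernel n X) (perturbed D) e u d"
proof -
  have v: "bellman_value S A \<gamma> (emp_kernel n (X(e := y))) (perturbed D) e u i
      = bellman_value S A \<gamma> (emp_kernel n X) (perturbed D) e u i" if "i < S" for i
    using sampled_value_row_independent[OF that, of e u X y D] by (simp add: sampled_value_def)
  have "action_value S \<gamma> (emp_kernel n (X(e := y))) (perturbed D) e u
      (bellman_value S A \<gamma> (emp_kernel n (X(e := y))) (perturbed D) e u) s a =
    action_value S \<gamma> (emp_kernel n X) (perturbed D) e u
      (bellman_value S A \<gamma> (emp_kernel n X) (perturbed D) e u) s a" for s a
  proof (cases "(s, a) = e")
    case False
    then have "emp_kernel n (X(e := y)) s a i = emp_kernel n X s a i" for i by (simp add: emp_kernel_eq)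
    then show ?thesis using False v by (simp add: action_value_def)
  qed (simp add: action_value_def)
  then show ?thesis by (simp add: strictly_greedy_def)
qed

lemma sample_slice_le:
  assumes e: "e \<in> pairs" and B: "B \<in> sets M"
    and slice: "\<And>X D. emeasure (row_measure e) {y \<in> space (row_measure e). (X(e := y), D) \<in> B} \<le> c"
  shows "emeasure M B \<le> c"
  unfolding data_measure_def
proof (rule emeasure_pair_slice1_le[OF prob_XM prob_DM])
  show "B \<in> sets (XM \<Otimes>\<^sub>M DM)" using B by (simp add: data_measure_def)
  fix D assume D: "D \<in> space DM"
  have "(\<lambda>X. (X, D)) -` B \<inter> space XM \<in> sets XM"
    using D B by (intro measurable_sets[where A = "XM \<Otimes>\<^sub>M DM"]) (auto simp: data_measure_def)
  moreover have sub: "(\<lambda>X. (X, D)) -` B \<subseteq> space XM"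
    using sets.sets_into_space[OF B] by (auto simp: data_measure_def space_pair_measure)
  ultimately have "(\<lambda>X. (X, D)) -` B \<in> sets XM" by (simp add: Int_absorb2)
  then show "emeasure XM ((\<lambda>X. (X, D)) -` B) \<le> c"
    unfolding sample_measure_def
    by (intro emeasure_PiM_slice_le[OF prob_row _ e]) (use slice in auto)
qed

lemma noise_slice_le:
  assumes e: "e \<in> pairs" and B: "B \<in> sets M"
    and slice: "\<And>X D. emeasure (uniform_measure lborel {0..\<xi>}) {y. (X, D(e := y)) \<in> B} \<le> c"
  shows "emeasure M B \<le> c"
  unfolding data_measure_def
proof (rule emeasure_pair_slice2_le[OF prob_XM prob_DM])
  show "B \<in> sets (XM \<Otimes>\<^sub>M DM)" using B by (simp add: data_measure_def)
  fix X assume "X \<in> space XM"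
  have "Pair X -` B \<in> sets DM"
    using B by (intro sets_Pair1) (simp add: data_measure_def)
  then show "emeasure DM (Pair X -` B) \<le> c"
    unfolding noise_measure_def
    by (intro emeasure_PiM_slice_le[OF prob_space_uniform_interval[OF xi] _ e]) (use slice in auto)
qed

text \<open>The sample space consists of all naturals. These null events are discarded so that each
  empirical row sums to 1 over \<open>{..<S}\<close>.\<close>

definition sample_outside :: "nat \<times> nat \<Rightarrow> nat \<Rightarrow> ((nat \<times> nat \<Rightarrow> nat \<Rightarrow> nat) \<times> (nat \<times> nat \<Rightarrow> real)) set" where
  "sample_outside e k = {\<omega> \<in> space M. S \<le> fst \<omega> e k}"

definition noise_outside :: "nat \<times> nat \<Rightarrow> ((nat \<times> nat \<Rightarrow> nat \<Rightarrow> nat) \<times> (nat \<times> nat \<Rightarrow> real)) set" where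
  "noise_outside e = {\<omega> \<in> space M. snd \<omega> e \<notin> {0..\<xi>}}"

text \<open>The reward at which the pair \<open>e\<close> would tie with the value attained without
  it. It reads the row at \<open>e\<close> but not the noise at \<open>e\<close>, so that noise is
  uniform given the threshold.\<close>

definition threshold :: "nat \<times> nat \<Rightarrow> (nat \<times> nat \<Rightarrow> nat \<Rightarrow> nat) \<times> (nat \<times> nat \<Rightarrow> real) \<Rightarrow> real" where
  "threshold e \<omega> = sampled_value e (-1) \<omega> (fst e)
    - \<gamma> * (\<Sum>s'<S. emp_row n (fst \<omega> e) s' * sampled_value e (-1) \<omega> s')"

definition noise_near :: "real \<Rightarrow> nat \<times> nat \<Rightarrow> ((nat \<times> nat \<Rightarrow> nat \<Rightarrow> nat) \<times> (nat \<times> nat \<Rightarrow> real)) set" where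
  "noise_near w e = {\<omega> \<in> space M. \<bar>r (fst e) (snd e) + snd \<omega> e - threshold e \<omega>\<bar> \<le> w}"

lemma sample_outside:
  assumes e: "e \<in> pairs" and k: "k < n"
  shows "sample_outside e k \<in> sets M" "emeasure M (sample_outside e k) \<le> 0"
proof -
  have [measurable]: "(\<lambda>\<omega>. fst \<omega> e k) \<in> measurable M (count_space UNIV)"
    by (rule measurable_sample[OF e k])
  show B: "sample_outside e k \<in> sets M" unfolding sample_outside_def by measurable
  show "emeasure M (sample_outside e k) \<le> 0"
  proof (rule sample_slice_le[OF e B])
    fix X D
    let ?R = "{y \<in> space (row_measure e). S \<le> y k}"
    have R: "?R \<in> sets (row_measure e)"
    proof -
      have "(\<lambda>y. y k) \<in> measurable (row_measure e) (measure_pmf (P (fst e) (snd e)))"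
        using k by (intro measurable_component_singleton) simp
      then have [measurable]: "(\<lambda>y. y k) \<in> measurable (row_measure e) (count_space UNIV)"
        by (simp cong: measurable_cong_sets)
      show ?thesis by measurable
    qed
    have "emeasure (row_measure e) ?R \<le> 0"
    proof (rule emeasure_PiM_slice_le[OF prob_space_measure_pmf _ _ R])
      fix y :: "nat \<Rightarrow> nat"
      have "set_pmf (P (fst e) (snd e)) \<inter> {S..} = {}"
        using P[of "fst e" "snd e"] e by fastforce
      then have "emeasure (measure_pmf (P (fst e) (snd e))) {S..} = 0"
        by (simp add: measure_pmf.emeasure_eq_measure measure_pmf_zero_iff)
      moreover have "emeasure (measure_pmf (P (fst e) (snd e))) {z \<in> space (measure_pmf (P (fst e) (snd e))). y(k := z) \<in> ?R}
          \<le> emeasure (measure_pmf (P (fst e) (snd e))) {S..}"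
        by (intro emeasure_mono) auto
      ultimately show "emeasure (measure_pmf (P (fst e) (snd e)))
        {z \<in> space (measure_pmf (P (fst e) (snd e))). y(k := z) \<in> ?R} \<le> 0"
        by (simp only:)
    qed (use k in auto)
    moreover have "{y \<in> space (row_measure e). (X(e := y), D) \<in> sample_outside e k} \<subseteq> ?R"
      by (auto simp: sample_outside_def)
    ultimately show "emeasure (row_measure e) {y \<in> space (row_measure e). (X(e := y), D) \<in> sample_outside e k} \<le> 0"
      using emeasure_mono[OF _ R] order_trans by blast
  qed
qed

lemma noise_outside:
  assumes e: "e \<in> pairs"
  shows "noise_outside e \<in> sets M" "emeasure M (noise_outside e) \<le> 0"
proof -
  note [measurable] = measurable_noise[OF e]
  show B: "noise_outside e \<in> sets M" unfolding noise_outside_def by measurable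
  show "emeasure M (noise_outside e) \<le> 0"
  proof (rule noise_slice_le[OF e B])
    fix X D
    have "emeasure (uniform_measure lborel {0..\<xi>}) {y. (X, D(e := y)) \<in> noise_outside e}
      \<le> emeasure (uniform_measure lborel {0..\<xi>}) {y. y \<notin> {0..\<xi>}}"
      by (intro emeasure_mono) (auto simp: noise_outside_def)
    also have "\<dots> = 0" by (rule uniform_interval_outside[OF xi])
    finally show "emeasure (uniform_measure lborel {0..\<xi>}) {y. (X, D(e := y)) \<in> noise_outside e} \<le> 0" .
  qed
qed

lemma noise_near:
  assumes e: "e \<in> pairs" and w: "0 \<le> w"
  shows "noise_near w e \<in> sets M" "emeasure M (noise_near w e) \<le> ennreal (2 * w / \<xi>)"
proof -
  note [measurable] = measurable_noise[OF e]
  have [measurable]: "threshold e \<in> borel_measurable M"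
    unfolding threshold_def[abs_def] using e
    by (intro borel_measurable_diff borel_measurable_times borel_measurable_sum measurable_sampled_value
        measurable_emp_row borel_measurable_const) auto
  show B: "noise_near w e \<in> sets M" unfolding noise_near_def by measurable
  show "emeasure M (noise_near w e) \<le> ennreal (2 * w / \<xi>)"
  proof (rule noise_slice_le[OF e B])
    fix X D
    have th: "threshold e (X, D(e := y)) = threshold e (X, D)" for y
      unfolding threshold_def using sampled_value_noise_independent[of _ e "-1" X D y] e by (auto intro!: sum.cong)
    have "{y. (X, D(e := y)) \<in> noise_near w e} \<subseteq> {y. \<bar>y - (threshold e (X, D) - r (fst e) (snd e))\<bar> \<le> w}"
      by (auto simp: noise_near_def th algebra_simps)
    then have "emeasure (uniform_measure lborel {0..\<xi>}) {y. (X, D(e := y)) \<in> noise_near w e}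
      \<le> emeasure (uniform_measure lborel {0..\<xi>}) {y. \<bar>y - (threshold e (X, D) - r (fst e) (snd e))\<bar> \<le> w}"
      by (intro emeasure_mono) auto
    also have "\<dots> \<le> ennreal (2 * w / \<xi>)" by (rule uniform_interval_le[OF xi w])
    finally show "emeasure (uniform_measure lborel {0..\<xi>}) {y. (X, D(e := y)) \<in> noise_near w e} \<le> ennreal (2 * w / \<xi>)" .
  qed
qed

text \<open>The span test is part of the event, so the probability bound covers functions whose span
  is random: where the test fails, nothing is bad.\<close>

definition row_bad :: "nat \<Rightarrow> nat \<times> nat \<Rightarrow> (nat \<Rightarrow> real) \<Rightarrow> (nat \<Rightarrow> nat) \<Rightarrow> bool" where
  "row_bad N e f y \<longleftrightarrow> (\<forall>k<n. y k < S) \<and> (\<forall>i<S. \<bar>f i - f 0\<bar> \<le> real N) \<and>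
    \<not> row_good S \<gamma> (real N) (sqrt (L / (real n * real N))) (pmf (P (fst e) (snd e))) (emp_row n y) (\<lambda>i. f i - f 0)"

lemma row_bad_cong: "(\<And>i. i < S \<Longrightarrow> f i = g i) \<Longrightarrow> row_bad N e f y = row_bad N e g y"
  using S_pos by (simp add: row_bad_def row_good_def Let_def cong: sum.cong_simp)

text \<open>The function \<open>f\<close> may depend on all data except the row at \<open>e\<close>.
  On a slice it is fixed, and the Bernstein bound for fixed functions applies.\<close>

lemma row_bad_slice:
  assumes e: "e \<in> pairs" and N: "1 \<le> N" "L * real N \<le> real n" and B: "B \<in> sets M"
    and slice: "\<And>X D. \<exists>f. \<forall>y. (X(e := y), D) \<in> B \<longrightarrow> row_bad N e f y"
  shows "emeasure M B \<le> ennreal (4 * exp (- L))"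
proof (rule sample_slice_le[OF e B])
  fix X D
  obtain f where f: "\<And>y. (X(e := y), D) \<in> B \<Longrightarrow> row_bad N e f y" using slice by blast
  show "emeasure (row_measure e) {y \<in> space (row_measure e). (X(e := y), D) \<in> B} \<le> ennreal (4 * exp (- L))"
  proof (cases "\<forall>i<S. \<bar>f i - f 0\<bar> \<le> real N")
    case True
    obtain R where R: "R \<in> sets (row_measure e)" "emeasure (row_measure e) R \<le> ennreal (4 * exp (- L))"
      "{y \<in> space (row_measure e). (\<forall>k<n. y k < S) \<and>
        \<not> row_good S \<gamma> (real N) (sqrt (L / (real n * real N))) (pmf (P (fst e) (snd e))) (emp_row n y) (\<lambda>i. f i - f 0)} \<subseteq> R"
      using row_good_probability[of "P (fst e) (snd e)" S n \<gamma> "\<lambda>i. f i - f 0" "real N" L]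
        P[of "fst e" "snd e"] n_pos discount True N L_pos e by auto
    have "{y \<in> space (row_measure e). (X(e := y), D) \<in> B} \<subseteq> R"
      using R(3) f by (auto simp: row_bad_def)
    then have "emeasure (row_measure e) {y \<in> space (row_measure e). (X(e := y), D) \<in> B} \<le> emeasure (row_measure e) R"
      by (intro emeasure_mono R(1))
    then show ?thesis using R(2) by simp
  next
    case False
    then have "{y \<in> space (row_measure e). (X(e := y), D) \<in> B} = {}" using f by (auto simp: row_bad_def)
    then show ?thesis by (simp only: emeasure_empty zero_le)
  qed
qed

lemma measurable_row_bad:
  assumes e: "e \<in> pairs" and f: "\<And>i. i < S \<Longrightarrow> (\<lambda>\<omega>. f \<omega> i) \<in> borel_measurable M"
  shows "Measurable.pred M (\<lambda>\<omega>. row_bad N e (f \<omega>) (fst \<omega> e))"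
proof -
  have "Measurable.pred M (\<lambda>\<omega>. \<forall>k\<in>{..<n}. fst \<omega> e k < S)"
  proof (intro pred_intros_finite)
    fix k assume "k \<in> {..<n}"
    then have [measurable]: "(\<lambda>\<omega>. fst \<omega> e k) \<in> measurable M (count_space UNIV)"
      using measurable_sample[OF e] by simp
    show "Measurable.pred M (\<lambda>\<omega>. fst \<omega> e k < S)" by measurable
  qed auto
  moreover have "Measurable.pred M (\<lambda>\<omega>. \<forall>i\<in>{..<S}. \<bar>f \<omega> i - f \<omega> 0\<bar> \<le> real N)"
  proof (intro pred_intros_finite)
    fix i assume "i \<in> {..<S}"
    then have [measurable]: "(\<lambda>\<omega>. f \<omega> i) \<in> borel_measurable M" "(\<lambda>\<omega>. f \<omega> 0) \<in> borel_measurable M"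
      using f S_pos by auto
    show "Measurable.pred M (\<lambda>\<omega>. \<bar>f \<omega> i - f \<omega> 0\<bar> \<le> real N)" by measurable
  qed auto
  moreover have "Measurable.pred M (\<lambda>\<omega>. row_good S \<gamma> (real N) (sqrt (L / (real n * real N)))
      (pmf (P (fst e) (snd e))) (emp_row n (fst \<omega> e)) (\<lambda>i. f \<omega> i - f \<omega> 0))"
    by (intro measurable_row_good measurable_emp_row[OF e] borel_measurable_diff f S_pos)
  moreover have eq: "row_bad N e h y \<longleftrightarrow> (\<forall>k\<in>{..<n}. y k < S) \<and> (\<forall>i\<in>{..<S}. \<bar>h i - h 0\<bar> \<le> real N) \<and>
    \<not> row_good S \<gamma> (real N) (sqrt (L / (real n * real N))) (pmf (P (fst e) (snd e))) (emp_row n y) (\<lambda>i. h i - h 0)" for h y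
    unfolding row_bad_def by blast
  ultimately show ?thesis unfolding eq by (intro pred_intros_logic)
qed

definition fixed_bad where
  "fixed_bad N e f = {\<omega> \<in> space M. row_bad N e f (fst \<omega> e)}"

definition value_bad where
  "value_bad N e u = {\<omega> \<in> space M. row_bad N e (sampled_value e u \<omega>) (fst \<omega> e)}"

text \<open>The union over all policies costs nothing: at most one policy is strictly greedy in the
  overridden model, and which one is determined without the row at \<open>e\<close>. Each slice
  therefore concerns a single function.\<close>

definition greedy_bad where
  "greedy_bad N e u = {\<omega> \<in> space M. \<exists>d\<in>PiE {..<S} (\<lambda>_. {..<A}).
    strictly_greedy 0 (emp_kernel n (fst \<omega>)) (perturbed (snd \<omega>)) e u d \<and>
    row_bad N e (disc_value S A (kernel_of P) r \<gamma> (det_policy d)) (fst \<omega> e)}"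

lemma fixed_bad:
  assumes e: "e \<in> pairs" and N: "1 \<le> N" "L * real N \<le> real n"
  shows "fixed_bad N e f \<in> sets M" "emeasure M (fixed_bad N e f) \<le> ennreal (4 * exp (- L))"
proof -
  note [measurable] = measurable_row_bad[OF e, of "\<lambda>_. f", simplified]
  show B: "fixed_bad N e f \<in> sets M" unfolding fixed_bad_def by measurable
  show "emeasure M (fixed_bad N e f) \<le> ennreal (4 * exp (- L))"
    by (rule row_bad_slice[OF e N B]) (auto simp: fixed_bad_def)
qed

lemma value_bad:
  assumes e: "e \<in> pairs" and N: "1 \<le> N" "L * real N \<le> real n"
  shows "value_bad N e u \<in> sets M" "emeasure M (value_bad N e u) \<le> ennreal (4 * exp (- L))"
proof -
  note [measurable] = measurable_row_bad[OF e, of "sampled_value e u", OF measurable_sampled_value]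
  show B: "value_bad N e u \<in> sets M" unfolding value_bad_def by measurable
  show "emeasure M (value_bad N e u) \<le> ennreal (4 * exp (- L))"
  proof (rule row_bad_slice[OF e N B], intro exI allI impI)
    fix X D y assume "(X(e := y), D) \<in> value_bad N e u"
    then have "row_bad N e (sampled_value e u (X(e := y), D)) y" by (simp add: value_bad_def)
    then show "row_bad N e (sampled_value e u (X, D)) y"
      using row_bad_cong[of "sampled_value e u (X(e := y), D)" "sampled_value e u (X, D)"] sampled_value_row_independent by blast
  qed
qed

lemma greedy_bad:
  assumes e: "e \<in> pairs" and N: "1 \<le> N" "L * real N \<le> real n"
  shows "greedy_bad N e u \<in> sets M" "emeasure M (greedy_bad N e u) \<le> ennreal (4 * exp (- L))"
proof -
  let ?V = "\<lambda>d. disc_value S A (kernel_of P) r \<gamma> (det_policy d)"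
  have "Measurable.pred M (\<lambda>\<omega>. \<exists>d\<in>PiE {..<S} (\<lambda>_. {..<A}).
    strictly_greedy 0 (emp_kernel n (fst \<omega>)) (perturbed (snd \<omega>)) e u d \<and> row_bad N e (?V d) (fst \<omega> e))"
    by (rule pred_intros_finite(4), simp add: finite_PiE)
      (intro pred_intros_logic measurable_strictly_greedy measurable_row_bad[OF e] borel_measurable_const)
  then show B: "greedy_bad N e u \<in> sets M" unfolding greedy_bad_def Measurable.pred_def .
  show "emeasure M (greedy_bad N e u) \<le> ennreal (4 * exp (- L))"
  proof (rule row_bad_slice[OF e N B])
    fix X D
    let ?G = "\<lambda>d. d \<in> PiE {..<S} (\<lambda>_. {..<A}) \<and> strictly_greedy 0 (emp_kernel n X) (perturbed D) e u d"
    have uniq: "d = d'" if "?G d" "?G d'" for d d'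
    proof (rule PiE_ext)
      show "d \<in> PiE {..<S} (\<lambda>_. {..<A})" "d' \<in> PiE {..<S} (\<lambda>_. {..<A})" using that by auto
      show "d i = d' i" if "i \<in> {..<S}" for i
        using strictly_greedy_unique \<open>?G d\<close> \<open>?G d'\<close> that by blast
    qed
    \<comment> \<open>If no policy is strictly greedy, the chosen one is arbitrary, but then the
      slice of \<open>greedy_bad\<close> is empty.\<close>
    have "row_bad N e (?V (SOME d. ?G d)) y" if y: "(X(e := y), D) \<in> greedy_bad N e u" for y
    proof -
      obtain d where d: "?G d" "row_bad N e (?V d) y"
        using y by (auto simp: greedy_bad_def strictly_greedy_row_independent)
      have "(SOME d. ?G d) = d" using uniq[OF _ d(1)] someI[of ?G, OF d(1)] by blast
      then show ?thesis using d(2) by simp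
    qed
    then show "\<exists>f. \<forall>y. (X(e := y), D) \<in> greedy_bad N e u \<longrightarrow> row_bad N e f y" by blast
  qed
qed

end

section \<open>The error bound outside the bad events\<close>

lemma abs_diff_le_span_norm:
  assumes "i < S" "j < S"
  shows "\<bar>V i - V j\<bar> \<le> span_norm S V"
proof -
  have "V i \<le> Max (V ` {..<S})" "V j \<le> Max (V ` {..<S})" "Min (V ` {..<S}) \<le> V i" "Min (V ` {..<S}) \<le> V j"
    using assms by auto
  then show ?thesis unfolding span_norm_def by linarith
qed

lemma span_norm_nonneg: "0 < S \<Longrightarrow> 0 \<le> span_norm S V"
  using abs_diff_le_span_norm[of 0 S 0 V] by simp

lemma span_norm_cong:
  assumes "\<And>i. i < S \<Longrightarrow> V i = W i"
  shows "span_norm S V = span_norm S W"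
proof -
  have "V ` {..<S} = W ` {..<S}" using assms by (intro image_cong) auto
  then show ?thesis by (simp add: span_norm_def)
qed

lemma kernel_kernel_of:
  assumes "\<And>s a. s < S \<Longrightarrow> a < A \<Longrightarrow> set_pmf (P s a) \<subseteq> {..<S}"
  shows "kernel S A (kernel_of P)"
  using assms by (auto simp: kernel_def kernel_of_def intro!: pmf_sum_1)

lemma kernel_emp_kernel:
  assumes "0 < n" "\<And>s a k. s < S \<Longrightarrow> a < A \<Longrightarrow> k < n \<Longrightarrow> X (s, a) k < S"
  shows "kernel S A (emp_kernel n X)"
  unfolding kernel_def
proof (intro allI impI conjI)
  fix s a assume sa: "s < S" "a < A"
  have "(\<Sum>s'<S. emp_row n (X (s, a)) s' * 1) = (\<Sum>k<n. 1) / real n"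
    using assms(2)[OF sa] by (rule emp_row_sum)
  then show "(\<Sum>s'<S. emp_kernel n X s a s') = 1"
    using assms(1) by (simp add: emp_kernel_def emp_row_def)
  show "0 \<le> emp_kernel n X s a s'" for s' by (simp add: emp_kernel_def)
qed

context discounted
begin

lemma disc_value_det_reward_diff:
  assumes K: "kernel S A K" and d: "\<And>s. s < S \<Longrightarrow> d s < A"
    and r: "\<And>s a. s < S \<Longrightarrow> a < A \<Longrightarrow> \<bar>r' s a - r s a\<bar> \<le> c" and s: "s < S"
  shows "\<bar>disc_value S A K r' \<gamma> (det_policy d) s - disc_value S A K r \<gamma> (det_policy d) s\<bar> \<le> c / (1 - \<gamma>)"
proof -
  let ?V = "disc_value S A K r \<gamma> (det_policy d)" and ?V' = "disc_value S A K r' \<gamma> (det_policy d)"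
  have st: "stochastic S (\<lambda>s. K s (d s))" using kernelD[OF K] d by (auto simp: stochastic_def)
  have eq: "\<gamma> * (\<Sum>i<S. K s (d s) i * (v i - w i)) = \<gamma> * (\<Sum>i<S. K s (d s) i * v i) - \<gamma> * (\<Sum>i<S. K s (d s) i * w i)" for s v w
    by (simp add: right_diff_distrib sum_subtractf)
  have *: "?V' s - ?V s \<le> c + \<gamma> * (\<Sum>i<S. K s (d s) i * (?V' i - ?V i))"
    "?V s - ?V' s \<le> c + \<gamma> * (\<Sum>i<S. K s (d s) i * (?V i - ?V' i))" if "s < S" for s
  proof -
    have "?V s = r s (d s) + \<gamma> * (\<Sum>i<S. K s (d s) i * ?V i)" "?V' s = r' s (d s) + \<gamma> * (\<Sum>i<S. K s (d s) i * ?V' i)"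
      by (rule disc_value_det_eq[OF K _ discount' discount(2) that], erule d)+
    moreover have "\<bar>r' s (d s) - r s (d s)\<bar> \<le> c" using r[OF that d[OF that]] .
    ultimately show "?V' s - ?V s \<le> c + \<gamma> * (\<Sum>i<S. K s (d s) i * (?V' i - ?V i))"
      "?V s - ?V' s \<le> c + \<gamma> * (\<Sum>i<S. K s (d s) i * (?V i - ?V' i))"
      unfolding eq by linarith+
  qed
  show ?thesis
    using max_principle[OF discount' discount(2) st *(1) s] max_principle[OF discount' discount(2) st *(2) s]
    unfolding abs_le_iff by linarith
qed

lemma strictly_greedy_cong:
  "(\<And>s. s < S \<Longrightarrow> d s = d' s) \<Longrightarrow> strictly_greedy h K r e u d \<longleftrightarrow> strictly_greedy h K r e u d'"
  unfolding strictly_greedy_def by auto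

end

context sampled
begin

abbreviation true_kernel where "true_kernel \<equiv> kernel_of P"

definition bad_event where
  "bad_event w \<eta> J = (\<Union>e\<in>pairs. (\<Union>k\<in>{..<n}. sample_outside e k) \<union> (noise_outside e \<union> (noise_near w e \<union>
     (\<Union>N\<in>{N. 1 \<le> N \<and> N \<le> n \<and> L * real N \<le> real n}. fixed_bad N e (opt true_kernel r) \<union>
       (\<Union>j\<in>{..J}. value_bad N e (real j * \<eta>) \<union> greedy_bad N e (real j * \<eta>))))))"

text \<open>Purely deterministic: all randomness has been moved into \<open>bad_event\<close>. The
  conditions on \<open>\<eta>\<close> and \<open>J\<close> make the multiples
  \<open>j * \<eta>\<close> a net of the interval up to \<open>2 / (1 - \<gamma>)\<close>, which
  contains all perturbed action values, fine enough for the gap \<open>h\<close> to survive.\<close>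

lemma sample_error_bound:
  assumes \<omega>: "(X, D) \<in> space M" "(X, D) \<notin> bad_event (h / (1 - \<gamma>)) \<eta> J"
    and xi_eq: "\<xi> = (1 - \<gamma>) / (2 * real n)" and L1: "1 \<le> L"
    and eta: "0 < \<eta>" "2 * \<eta> \<le> h" "\<eta> \<le> 1 / (8 * real n)" and J: "2 / (1 - \<gamma>) \<le> \<eta> * real J"
    and opt: "is_optimal_policy S A (emp_kernel n X) (perturbed D) \<gamma> pihat"
  defines "spans \<equiv> span_norm S (opt_value S A true_kernel r \<gamma>) +
    min (span_norm S (disc_value S A (emp_kernel n X) r \<gamma> pihat)) (span_norm S (disc_value S A true_kernel r \<gamma> pihat))"
  assumes s: "s < S"
  shows "0 \<le> opt_value S A true_kernel r \<gamma> s - disc_value S A true_kernel r \<gamma> pihat s"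
    and "opt_value S A true_kernel r \<gamma> s - disc_value S A true_kernel r \<gamma> pihat s
      \<le> 26 / (1 - \<gamma>) * sqrt (L * (spans + 4) / real n)"
proof -
  let ?K = true_kernel and ?Q = "emp_kernel n X" and ?r = "perturbed D"
  have K: "kernel S A ?K" by (rule kernel_kernel_of[OF P])
  have X: "X e k < S" if "e \<in> pairs" "k < n" for e k
  proof (rule ccontr)
    assume "\<not> X e k < S"
    then have "(X, D) \<in> sample_outside e k" using \<omega>(1) by (simp add: sample_outside_def)
    then show False using \<omega>(2) that unfolding bad_event_def by blast
  qed
  have D: "0 \<le> D e" "D e \<le> \<xi>" if "e \<in> pairs" for e
  proof -
    have "(X, D) \<notin> noise_outside e" using \<omega>(2) that unfolding bad_event_def by blast
    then show "0 \<le> D e" "D e \<le> \<xi>" using \<omega>(1) by (auto simp: noise_outside_def)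
  qed
  have Q: "kernel S A ?Q" using X by (intro kernel_emp_kernel n_pos) auto
  have xi_small: "\<xi> / (1 - \<gamma>) \<le> 1 / 2" "\<xi> \<le> 1 / 2"
  proof -
    have "\<xi> / (1 - \<gamma>) = 1 / (2 * real n)" using discount by (simp add: xi_eq)
    also have "\<dots> \<le> 1 / 2" using n_pos by (simp add: field_simps)
    finally show "\<xi> / (1 - \<gamma>) \<le> 1 / 2" .
    moreover have "\<xi> \<le> \<xi> / (1 - \<gamma>)" using discount xi by (simp add: field_simps)
    ultimately show "\<xi> \<le> 1 / 2" by linarith
  qed
  have r': "0 \<le> ?r s a \<and> r s a \<le> ?r s a \<and> ?r s a \<le> r s a + \<xi>" if "s < S" "a < A" for s a
    using D[of "(s, a)"] reward[OF that] that by auto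
  have h0: "0 \<le> h" using eta by simp
  have far: "h / (1 - \<gamma>) < \<bar>?r s a - (bellman_value S A \<gamma> ?Q ?r (s, a) (-1) s
        - \<gamma> * (\<Sum>s'<S. ?Q s a s' * bellman_value S A \<gamma> ?Q ?r (s, a) (-1) s'))\<bar>" if "s < S" "a < A" for s a
  proof (rule ccontr)
    assume "\<not> ?thesis"
    then have "(X, D) \<in> noise_near (h / (1 - \<gamma>)) (s, a)"
      using \<omega>(1) by (simp add: noise_near_def threshold_def sampled_value_def emp_kernel_eq)
    then show False using \<omega>(2) that unfolding bad_event_def by blast
  qed
  obtain d0 where d0: "strictly_greedy h ?Q ?r (S, 0) 0 d0"
    using gap_or_reward_near_threshold[OF Q _ h0 far] r' by blast
  \<comment> \<open>\<open>greedy_bad\<close> ranges over the finitely many extensional functions,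
    so \<open>d\<close> has to be one of them.\<close>
  define d where "d = restrict d0 {..<S}"
  have d: "strictly_greedy h ?Q ?r (S, 0) 0 d"
    using strictly_greedy_cong[of d0 d] d0 by (simp add: d_def)
  note dA = strictly_greedy_opt(1)[OF Q d h0] and dU = strictly_greedy_opt(2)[OF Q d h0]
  have dPi: "d \<in> PiE {..<S} (\<lambda>_. {..<A})"
    using strictly_greedy_opt(1)[OF Q d0 h0] by (auto simp: d_def)
  have pol: "is_policy S A pihat" using opt by (simp add: is_optimal_policy_def)
  have pol_eq: "disc_value S A K' r'' \<gamma> pihat s = disc_value S A K' r'' \<gamma> (det_policy d) s"
    if "kernel S A K'" "s < S" for K' r'' s
    using optimal_policy_strictly_greedy[OF Q d h0 opt] is_policy_det_policy[of S d A] dA that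
    by (intro disc_value_cong pol) auto
  define V where "V = disc_value S A ?K r \<gamma> (det_policy d)"
  define W where "W = disc_value S A ?Q r \<gamma> (det_policy d)"
  define U where "U = opt ?Q ?r"
  define Vs where "Vs = opt ?K r"
  have Vs: "opt_value S A ?K r \<gamma> i = Vs i" if "i < S" for i
    unfolding Vs_def by (rule opt_value_eq[OF K that])
  have spans: "spans = span_norm S Vs + min (span_norm S W) (span_norm S V)"
    unfolding spans_def V_def W_def
    by (simp only: span_norm_cong[OF Vs] span_norm_cong[of S, OF pol_eq[OF K]] span_norm_cong[of S, OF pol_eq[OF Q]])
  have V_le: "V i \<le> Vs i" if "i < S" for i
    unfolding V_def Vs_def using dA that by (intro disc_value_le_opt K is_policy_det_policy) auto
  \<comment> \<open>The span in the claim is that of the unperturbed value \<open>W\<close>, while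
    the recursion uses \<open>U\<close>. The size of \<open>\<xi>\<close> makes the difference at
    most \<open>\<xi> / (1 - \<gamma>) = 1 / (2 * n)\<close>.\<close>
  have UW: "\<bar>U i - W i\<bar> \<le> 1 / 2" if "i < S" for i
  proof -
    have "U i = disc_value S A ?Q ?r \<gamma> (det_policy d) i"
      unfolding U_def using dA dU by (intro disc_value_greedy[OF Q _ that, symmetric]) blast
    moreover have "\<bar>?r s a - r s a\<bar> \<le> \<xi>" if "s < S" "a < A" for s a using r'[OF that] by auto
    ultimately have "\<bar>U i - W i\<bar> \<le> \<xi> / (1 - \<gamma>)"
      using disc_value_det_reward_diff[OF Q _ _ that, of d ?r r \<xi>] dA by (simp add: W_def)
    then show ?thesis using xi_small by linarith
  qed
  have goal_eq: "opt_value S A ?K r \<gamma> s - disc_value S A ?K r \<gamma> pihat s = Vs s - V s"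
    using Vs[OF s] pol_eq[OF K s] by (simp add: V_def)
  show "0 \<le> opt_value S A ?K r \<gamma> s - disc_value S A ?K r \<gamma> pihat s"
    unfolding goal_eq using V_le[OF s] by simp
  have sp0: "0 \<le> span_norm S Vs" "0 \<le> span_norm S W" "0 \<le> span_norm S V"
    using span_norm_nonneg[OF S_pos] by auto
  \<comment> \<open>Rounded to an integer to be one of the candidates in \<open>bad_event\<close>.
    The summand 3 leaves room for the passage from \<open>W\<close> to \<open>U\<close>, at most 1
    in differences of values, and from \<open>U\<close> to its proxy, at most 1/4.\<close>
  define N where "N = nat \<lceil>spans + 3\<rceil>"
  have N: "spans + 3 \<le> real N" "real N \<le> spans + 4"
    unfolding N_def using sp0 spans by linarith+
  have N1: "1 \<le> N" using N sp0 spans by linarith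
  define R where "R = sqrt (L * (spans + 4) / real n)"
  have "Vs s - V s \<le> 26 / (1 - \<gamma>) * R"
  proof (cases "L * real N \<le> real n")
    \<comment> \<open>Too few samples: here \<open>R \<ge> 1\<close>, and the error never exceeds
      \<open>1 / (1 - \<gamma>)\<close>.\<close>
    case False
    have "real n \<le> L * (spans + 4)"
      using False N(2) L_pos mult_left_mono[OF N(2), of L] by linarith
    then have "1 \<le> R" unfolding R_def using n_pos by simp
    moreover have "Vs s \<le> 1 / (1 - \<gamma>)" unfolding Vs_def
      using reward by (intro bellman_value_upper[OF K _ _ _ s]) auto
    moreover have "0 \<le> V s" unfolding V_def using disc_value_det_bounds(1)[OF K dA reward s] .
    moreover have "1 / (1 - \<gamma>) \<le> 26 / (1 - \<gamma>) * R"
      using \<open>1 \<le> R\<close> discount by (simp add: divide_le_cancel field_simps)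
    ultimately show ?thesis by linarith
  next
    case True
    define \<theta> where "\<theta> = sqrt (L / (real n * real N))"
    have th0: "0 \<le> \<theta>" using L_pos by (simp add: \<theta>_def)
    have thN: "\<theta> * real N = sqrt (L * real N / real n)"
    proof -
      have "\<theta> * real N = sqrt (L / (real n * real N)) * sqrt ((real N)\<^sup>2)" by (simp add: \<theta>_def)
      also have "\<dots> = sqrt (L / (real n * real N) * (real N)\<^sup>2)" by (simp only: real_sqrt_mult)
      also have "L / (real n * real N) * (real N)\<^sup>2 = L * real N / real n"
        using N1 by (simp add: power2_eq_square)
      finally show ?thesis .
    qed
    have thN1: "\<theta> * real N \<le> 1" unfolding thN using True n_pos by simp
    have N1': "1 \<le> real N" using N1 by simp
    have Nn: "N \<le> n"
    proof -
      have "1 * real N \<le> L * real N" using L1 by (intro mult_right_mono) auto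
      then show ?thesis using True by linarith
    qed
    have good: "row_good S \<gamma> (real N) \<theta> (?K s a) (?Q s a) (\<lambda>i. f i - f 0)"
      if "s < S" "a < A" "\<And>i. i < S \<Longrightarrow> \<bar>f i - f 0\<bar> \<le> real N" "\<not> row_bad N (s, a) f (X (s, a))" for s a f
    proof -
      have "?K s a = pmf (P s a)" "?Q s a = emp_row n (X (s, a))"
        by (auto simp: kernel_of_def emp_kernel_eq)
      then show ?thesis using that X unfolding row_bad_def \<theta>_def by auto
    qed
    have Ngood: "N \<in> {N. 1 \<le> N \<and> N \<le> n \<and> L * real N \<le> real n}" using N1 Nn True by simp
    have VsN: "\<bar>Vs i - Vs 0\<bar> \<le> real N" if "i < S" for i
      using abs_diff_le_span_norm[OF that S_pos, of Vs] N(1) spans sp0 by linarith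
    have "Vs s - U s \<le> 12 * \<theta> * real N / (1 - \<gamma>)"
      unfolding Vs_def U_def
    proof (rule opt_error[OF K Q reward _ N1' VsN[unfolded Vs_def] th0 _ s])
      show "r s a \<le> ?r s a" if "s < S" "a < A" for s a using r'[OF that] by blast
      fix s a assume sa: "s < S" "a < A"
      have "(X, D) \<notin> fixed_bad N (s, a) (opt ?K r)"
        using \<omega>(2) sa Ngood unfolding bad_event_def by blast
      then have "\<not> row_bad N (s, a) (opt ?K r) (X (s, a))" using \<omega>(1) by (simp add: fixed_bad_def)
      then show "row_good S \<gamma> (real N) \<theta> (?K s a) (?Q s a) (\<lambda>i. opt ?K r i - opt ?K r 0)"
        using VsN sa unfolding Vs_def by (intro good)
    qed
    moreover have "U s - V s \<le> (13 * \<theta> * real N + \<xi> + 4 * \<eta>) / (1 - \<gamma>)"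
    proof -
      have net: "\<exists>j\<le>J. \<bar>real j * \<eta> - optq ?Q ?r s a\<bar> \<le> \<eta>" if sa: "s < S" "a < A" for s a
      proof -
        let ?u = "optq ?Q ?r s a"
        define j where "j = nat \<lfloor>?u / \<eta>\<rfloor>"
        have U0: "0 \<le> U i" if "i < S" for i
          unfolding U_def using r' by (intro bellman_value_nonneg[OF Q _ _ that]) auto
        have "0 \<le> \<gamma> * (\<Sum>s'<S. ?Q s a s' * U s')"
          using U0 kernelD(1)[OF Q sa] discount by (intro mult_nonneg_nonneg sum_nonneg) auto
        then have u0: "0 \<le> ?u" using r'[OF sa] by (simp add: U_def)
        have "?u \<le> U s" unfolding U_def by (rule optq_le_opt[OF Q sa])
        also have "U s \<le> 2 / (1 - \<gamma>)" unfolding U_def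
          using r' reward xi_small(2) by (intro bellman_value_upper[OF Q _ _ _ sa(1)]) (fastforce+)
        finally have "?u / \<eta> \<le> real J" using J eta(1) by (simp add: pos_divide_le_eq mult.commute)
        moreover have "real j = of_int \<lfloor>?u / \<eta>\<rfloor>" unfolding j_def using u0 eta(1) by simp
        ultimately have j: "real j \<le> ?u / \<eta>" "?u / \<eta> < real j + 1" "j \<le> J" by linarith+
        have "real j * \<eta> \<le> ?u" "?u < real j * \<eta> + \<eta>"
          using j(1,2) eta(1) by (simp_all add: pos_le_divide_eq pos_divide_less_eq distrib_right)
        then show ?thesis using j(3) by (intro exI[of _ j]) auto
      qed
      have override: "strictly_greedy 0 ?Q ?r (s, a) (real j * \<eta>) d"
        "\<And>i. i < S \<Longrightarrow> \<bar>sampled_value (s, a) (real j * \<eta>) (X, D) i - U i\<bar> \<le> \<eta>"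
        if "s < S" "a < A" "\<bar>real j * \<eta> - optq ?Q ?r s a\<bar> \<le> \<eta>" for s a j
        using strictly_greedy_override[OF Q _ _ _ d eta(2), of "(s, a)" "real j * \<eta>"] that
        by (auto simp: sampled_value_def U_def)
      have d_opt: "d s < A \<and> opt ?Q ?r s = optq ?Q ?r s (d s)" if "s < S" for s
        using dA[OF that] dU[OF that] by blast
      show ?thesis
      \<comment> \<open>The smaller span decides the kernel for unrolling \<open>U - V\<close>. Only
        then is the function concerned bounded by \<open>N\<close>, which contains just the minimum
        of these two spans.\<close>
      proof (cases "span_norm S W \<le> span_norm S V")
        case True
        have eta8: "\<eta> \<le> 1 / 8"
        proof -
          have "1 / (8 * real n) \<le> 1 / 8" using n_pos by (simp add: field_simps)
          then show ?thesis using eta(3) by linarith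
        qed
        have sW: "span_norm S W + 3 \<le> real N" using N(1) spans sp0 True by linarith
        have UN: "\<bar>U i - U 0\<bar> \<le> span_norm S W + 1" if "i < S" for i
          using abs_diff_le_span_norm[OF that S_pos, of W] UW[OF that] UW[OF S_pos] by linarith
        have UN': "\<bar>U i - U 0\<bar> \<le> real N" if "i < S" for i using UN[OF that] sW by linarith
        show ?thesis
          unfolding U_def V_def
        proof (rule greedy_error_empirical_variance[OF K Q reward _ xi_small(2) d_opt N1' UN'[unfolded U_def] th0 thN1 eta8 _ s])
          show "0 \<le> ?r s a \<and> ?r s a \<le> r s a + \<xi>" if "s < S" "a < A" for s a using r'[OF that] by blast
          fix s a assume sa: "s < S" "a < A"
          obtain j where j: "j \<le> J" "\<bar>real j * \<eta> - optq ?Q ?r s a\<bar> \<le> \<eta>" using net[OF sa] by blast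
          define G where "G = sampled_value (s, a) (real j * \<eta>) (X, D)"
          have GU: "\<bar>G i - U i\<bar> \<le> \<eta>" if "i < S" for i unfolding G_def by (rule override(2)[OF sa j(2) that])
          have GN: "\<bar>G i - G 0\<bar> \<le> real N" if "i < S" for i
            using GU[OF that] GU[OF S_pos] UN[OF that] sW eta8 by linarith
          have "(X, D) \<notin> value_bad N (s, a) (real j * \<eta>)"
            using \<omega>(2) sa Ngood j(1) unfolding bad_event_def by blast
          then have "\<not> row_bad N (s, a) G (X (s, a))" using \<omega>(1) by (simp add: value_bad_def G_def)
          then have "row_good S \<gamma> (real N) \<theta> (?K s a) (?Q s a) (\<lambda>i. G i - G 0)"
            using GN sa by (intro good)
          then show "\<exists>G. (\<forall>i<S. \<bar>G i - opt ?Q ?r i\<bar> \<le> \<eta> \<and> \<bar>G i - G 0\<bar> \<le> real N)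
            \<and> row_good S \<gamma> (real N) \<theta> (?K s a) (?Q s a) (\<lambda>i. G i - G 0)"
            using GU GN unfolding U_def by blast
        qed
      next
        case False
        have VN: "\<bar>V i - V 0\<bar> \<le> real N" if "i < S" for i
          using abs_diff_le_span_norm[OF that S_pos, of V] N(1) spans sp0 False by linarith
        have "U s - V s \<le> (12 * \<theta> * real N + \<xi>) / (1 - \<gamma>)"
          unfolding U_def V_def
        proof (rule greedy_error_true_variance[OF K Q reward _ d_opt N1' VN[unfolded V_def] th0 _ s])
          show "?r s a \<le> r s a + \<xi>" if "s < S" "a < A" for s a using r'[OF that] by blast
          fix s a assume sa: "s < S" "a < A"
          obtain j where j: "j \<le> J" "\<bar>real j * \<eta> - optq ?Q ?r s a\<bar> \<le> \<eta>" using net[OF sa] by blast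
          have "(X, D) \<notin> greedy_bad N (s, a) (real j * \<eta>)"
            using \<omega>(2) sa Ngood j(1) unfolding bad_event_def by blast
          then have "\<not> row_bad N (s, a) V (X (s, a))"
            using \<omega>(1) override(1)[OF sa j(2)] dPi by (auto simp: greedy_bad_def V_def)
          then show "row_good S \<gamma> (real N) \<theta> (?K s a) (?Q s a)
            (\<lambda>i. disc_value S A ?K r \<gamma> (det_policy d) i - disc_value S A ?K r \<gamma> (det_policy d) 0)"
            using VN sa unfolding V_def by (intro good)
        qed
        also have "\<dots> \<le> (13 * \<theta> * real N + \<xi> + 4 * \<eta>) / (1 - \<gamma>)"
          using discount eta(1) th0 by (intro divide_right_mono) auto
        finally show ?thesis .
      qed
    qed
    \<comment> \<open>Perturbation and net together cost at most \<open>1 / n\<close>, which is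
      below \<open>sqrt (1 / n)\<close> and hence below \<open>\<theta> * N\<close>. This gives the
      constant 12 + 13 + 1 = 26.\<close>
    moreover have "\<xi> + 4 * \<eta> \<le> \<theta> * real N"
    proof -
      have "\<xi> \<le> 1 / (2 * real n)" using discount n_pos by (simp add: xi_eq field_simps)
      moreover have "4 * \<eta> \<le> 1 / (2 * real n)" using eta(3) by simp
      moreover have "1 / (2 * real n) + 1 / (2 * real n) = 1 / real n" using n_pos by (simp add: field_simps)
      ultimately have "\<xi> + 4 * \<eta> \<le> 1 / real n" by linarith
      also have "1 / real n \<le> sqrt (1 / real n)"
      proof (rule real_le_rsqrt)
        have "1 / real n * (1 / real n) \<le> 1 / real n * 1" using n_pos by (intro mult_left_mono) auto
        then show "(1 / real n)\<^sup>2 \<le> 1 / real n" by (simp only: power2_eq_square mult_1_right)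
      qed
      also have "\<dots> \<le> sqrt (L * real N / real n)"
      proof -
        have "1 * 1 \<le> L * real N" using L1 N1' by (intro mult_mono) auto
        then show ?thesis using n_pos by (intro real_sqrt_le_mono divide_right_mono) auto
      qed
      finally show ?thesis unfolding thN .
    qed
    ultimately have "Vs s - V s \<le> 12 * \<theta> * real N / (1 - \<gamma>) + (14 * (\<theta> * real N)) / (1 - \<gamma>)"
    proof -
      assume 1: "Vs s - U s \<le> 12 * \<theta> * real N / (1 - \<gamma>)"
        and 2: "U s - V s \<le> (13 * \<theta> * real N + \<xi> + 4 * \<eta>) / (1 - \<gamma>)" and 3: "\<xi> + 4 * \<eta> \<le> \<theta> * real N"
      have "13 * \<theta> * real N = 13 * (\<theta> * real N)" by simp
      with 3 have "13 * \<theta> * real N + \<xi> + 4 * \<eta> \<le> 14 * (\<theta> * real N)" by linarith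
      then have "(13 * \<theta> * real N + \<xi> + 4 * \<eta>) / (1 - \<gamma>) \<le> 14 * (\<theta> * real N) / (1 - \<gamma>)"
        using discount by (intro divide_right_mono) auto
      with 1 2 show ?thesis by linarith
    qed
    also have "\<dots> = 26 / (1 - \<gamma>) * (\<theta> * real N)" 
    proof -
      have "12 * t / c + 14 * t / c = 26 / c * t" for t c :: real by (cases "c = 0") (auto simp: field_simps)
      from this[of "\<theta> * real N" "1 - \<gamma>"] show ?thesis by (simp only: mult.assoc)
    qed
    also have "\<dots> \<le> 26 / (1 - \<gamma>) * R"
    proof (intro mult_left_mono)
      show "\<theta> * real N \<le> R" unfolding thN R_def
        by (intro real_sqrt_le_mono divide_right_mono mult_left_mono N(2)) (use L_pos in auto)
    qed (use discount in auto)
    finally show ?thesis .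
  qed
  then show "opt_value S A ?K r \<gamma> s - disc_value S A ?K r \<gamma> pihat s
      \<le> 26 / (1 - \<gamma>) * sqrt (L * (spans + 4) / real n)"
    unfolding goal_eq R_def .
qed

end

lemma sup_norm_le:
  assumes "0 < S" "\<And>s. s < S \<Longrightarrow> \<bar>V s\<bar> \<le> c"
  shows "sup_norm S V \<le> c"
  unfolding sup_norm_def using assms by (subst Max_le_iff) auto

lemma (in prob_space) prob_UN_le:
  assumes "finite I" "\<And>i. i \<in> I \<Longrightarrow> A i \<in> events" "\<And>i. i \<in> I \<Longrightarrow> prob (A i) \<le> c"
  shows "(\<Union>i\<in>I. A i) \<in> events" "prob (\<Union>i\<in>I. A i) \<le> real (card I) * c"
proof -
  show "(\<Union>i\<in>I. A i) \<in> events" using assms(1,2) by (rule sets.finite_UN)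
  have "prob (\<Union>i\<in>I. A i) \<le> (\<Sum>i\<in>I. prob (A i))"
    using assms by (intro finite_measure_subadditive_finite) auto
  also have "\<dots> \<le> (\<Sum>i\<in>I. c)" using assms(3) by (rule sum_mono)
  finally show "prob (\<Union>i\<in>I. A i) \<le> real (card I) * c" by simp
qed

lemma (in prob_space) prob_Un_le:
  assumes "A \<in> events" "B \<in> events" "prob A \<le> a" "prob B \<le> b"
  shows "A \<union> B \<in> events" "prob (A \<union> B) \<le> a + b"
  using assms measure_Un_le[OF assms(1,2)] by auto

context sampled
begin

text \<open>For each pair: \<open>2 * w / \<xi>\<close> for a near tie, and for each of at most
  \<open>n\<close> candidates \<open>N\<close> one deviation event for the fixed function and two
  for each of the \<open>J + 1\<close> override values. The out-of-range events have probability
  0.\<close>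

lemma bad_event_probability:
  assumes w: "0 \<le> w"
  shows "bad_event w \<eta> J \<in> sets M"
    and "measure M (bad_event w \<eta> J) \<le>
      real (S * A) * (2 * w / \<xi> + real n * (4 * exp (- L) + real (J + 1) * (8 * exp (- L))))"
proof -
  interpret M: prob_space M by (rule prob_M)
  have to_prob: "M.prob B \<le> c" if "emeasure M B \<le> ennreal c" "0 \<le> c" for B c
    using that by (simp add: M.emeasure_eq_measure)
  define I where "I = {N. 1 \<le> N \<and> N \<le> n \<and> L * real N \<le> real n}"
  have I: "finite I" "card I \<le> n"
  proof -
    have "I \<subseteq> {1..n}" by (auto simp: I_def)
    then show "finite I" "card I \<le> n" using card_mono[of "{1..n}" I] by (auto intro: finite_subset)
  qed
  define q where "q = exp (- L)"
  have q: "0 \<le> 4 * q" by (simp add: q_def)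
  define rows where "rows = (\<lambda>e N. fixed_bad N e (opt true_kernel r) \<union>
       (\<Union>j\<in>{..J}. value_bad N e (real j * \<eta>) \<union> greedy_bad N e (real j * \<eta>)))"
  have rows: "rows e N \<in> M.events" "M.prob (rows e N) \<le> 4 * q + real (J + 1) * (8 * q)"
    if e: "e \<in> pairs" and N: "N \<in> I" for e N
  proof -
    have N': "1 \<le> N" "L * real N \<le> real n" using N by (auto simp: I_def)
    have vg: "value_bad N e (real j * \<eta>) \<union> greedy_bad N e (real j * \<eta>) \<in> M.events"
      "M.prob (value_bad N e (real j * \<eta>) \<union> greedy_bad N e (real j * \<eta>)) \<le> 8 * q" for j
      using M.prob_Un_le[OF value_bad(1)[OF e N'] greedy_bad(1)[OF e N']
          to_prob[OF value_bad(2)[OF e N'] q[unfolded q_def]] to_prob[OF greedy_bad(2)[OF e N'] q[unfolded q_def]]]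
      by (auto simp: q_def)
    have u: "(\<Union>j\<in>{..J}. value_bad N e (real j * \<eta>) \<union> greedy_bad N e (real j * \<eta>)) \<in> M.events"
      "M.prob (\<Union>j\<in>{..J}. value_bad N e (real j * \<eta>) \<union> greedy_bad N e (real j * \<eta>)) \<le> real (card {..J}) * (8 * q)"
      by (rule M.prob_UN_le[OF finite_atMost vg])+
    show "rows e N \<in> M.events" "M.prob (rows e N) \<le> 4 * q + real (J + 1) * (8 * q)"
      using M.prob_Un_le[OF fixed_bad(1)[OF e N'] u(1) to_prob[OF fixed_bad(2)[OF e N'] q[unfolded q_def]] u(2)]
      unfolding rows_def by (auto simp: q_def)
  qed
  define B where "B = (\<lambda>e. (\<Union>k\<in>{..<n}. sample_outside e k) \<union> (noise_outside e \<union> (noise_near w e \<union>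
     (\<Union>N\<in>I. rows e N))))"
  have B: "B e \<in> M.events"
    "M.prob (B e) \<le> 2 * w / \<xi> + real n * (4 * q + real (J + 1) * (8 * q))" if e: "e \<in> pairs" for e
  proof -
    have 1: "(\<Union>k\<in>{..<n}. sample_outside e k) \<in> M.events"
      "M.prob (\<Union>k\<in>{..<n}. sample_outside e k) \<le> real (card {..<n}) * 0"
      by (rule M.prob_UN_le; use sample_outside[OF e] to_prob[of _ 0] in auto)+
    have 2: "M.prob (noise_outside e) \<le> 0" using noise_outside(2)[OF e] by (intro to_prob) auto
    have 3: "M.prob (noise_near w e) \<le> 2 * w / \<xi>"
      using noise_near(2)[OF e w] w xi by (intro to_prob) auto
    have 4: "(\<Union>N\<in>I. rows e N) \<in> M.events"
      "M.prob (\<Union>N\<in>I. rows e N) \<le> real (card I) * (4 * q + real (J + 1) * (8 * q))"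
      by (rule M.prob_UN_le[OF I(1) rows[OF e]]; assumption)+
    note 34 = M.prob_Un_le[OF noise_near(1)[OF e w] 4(1) 3 4(2)]
    note 234 = M.prob_Un_le[OF noise_outside(1)[OF e] 34(1) 2 34(2)]
    note 1234 = M.prob_Un_le[OF 1(1) 234(1) 1(2) 234(2)]
    show "B e \<in> M.events" unfolding B_def by (rule 1234(1))
    have "real (card I) * (4 * q + real (J + 1) * (8 * q)) \<le> real n * (4 * q + real (J + 1) * (8 * q))"
      using I(2) q by (intro mult_right_mono) auto
    then show "M.prob (B e) \<le> 2 * w / \<xi> + real n * (4 * q + real (J + 1) * (8 * q))"
      using 1234(2) unfolding B_def by linarith
  qed
  have bad: "bad_event w \<eta> J = (\<Union>e\<in>pairs. B e)"
    unfolding bad_event_def B_def rows_def I_def ..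
  have "finite pairs" "card pairs = S * A" by auto
  then show "bad_event w \<eta> J \<in> sets M" "measure M (bad_event w \<eta> J) \<le>
      real (S * A) * (2 * w / \<xi> + real n * (4 * exp (- L) + real (J + 1) * (8 * exp (- L))))"
    using M.prob_UN_le[of pairs B, OF _ B] unfolding bad q_def by auto
qed

end

section \<open>Choice of parameters and the theorem\<close>

lemma single_action_value:
  assumes "0 < S" "0 < \<gamma>" "\<gamma> < 1" and K: "kernel S 1 K" and pol: "is_policy S 1 pol" and s: "s < S"
  shows "disc_value S 1 K r \<gamma> pol s = opt_value S 1 K r \<gamma> s"
proof -
  interpret discounted S 1 \<gamma> using assms by unfold_locales auto
  obtain pol' where pol': "is_policy S 1 pol'" "\<And>s. s < S \<Longrightarrow> disc_value S 1 K r \<gamma> pol' s = opt K r s"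
    using opt_attained[OF K] by metis
  have "disc_value S 1 K r \<gamma> pol s = disc_value S 1 K r \<gamma> pol' s"
    using pol pol' by (intro disc_value_cong[OF K] s) (auto simp: is_policy_def)
  then show ?thesis using pol'(2)[OF s] opt_value_eq[OF K s] by simp
qed

definition error_bound where
  "error_bound S A n P r \<gamma> \<delta> X pihat = 1 / (1 - \<gamma>) *
    sqrt (200000 * (ln (real S * real A * real n / ((1 - \<gamma>) * \<delta>))) ^ 3 / real n *
      (span_norm S (opt_value S A (kernel_of P) r \<gamma>)
       + min (span_norm S (disc_value S A (emp_kernel n X) r \<gamma> pihat))
             (span_norm S (disc_value S A (kernel_of P) r \<gamma> pihat))
       + 1))"

text \<open>\<open>S * A * n\<close> is at most \<open>\<delta> * x\<close> and the net has order
  \<open>x^3\<close> points, so the sum is at most \<open>\<delta> * 516 / x^12\<close>; for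
  \<open>x \<ge> 2\<close> the power is at least 4096.\<close>

lemma failure_probability_arithmetic:
  fixes S A n J :: nat and \<gamma> \<delta> x :: real
  assumes pos: "0 < S" "0 < A" "0 < n" and g: "0 < \<gamma>" "\<gamma> < 1" and d: "0 < \<delta>" "\<delta> < 1"
    and x: "x = real S * real A * real n / ((1 - \<gamma>) * \<delta>)" "2 \<le> x"
    and J: "real J \<le> 64 * (real S * real A * real n) / (\<delta> * (1 - \<gamma>) ^ 3) + 1"
  shows "real (S * A) * (real n * (4 / x ^ 16 + real (J + 1) * (8 / x ^ 16))) \<le> \<delta> / 2"
proof -
  define y where "y = real S * real A * real n"
  have "1 \<le> real S * real A" using pos by (simp add: Suc_leI flip: of_nat_mult)
  then have y: "1 \<le> y" unfolding y_def using pos mult_mono[of 1 "real S * real A" 1 "real n"] by simp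
  have xy: "x * ((1 - \<gamma>) * \<delta>) = y" using x(1) g d by (simp add: y_def)
  have "(1 - \<gamma>) * \<delta> \<le> 1 * \<delta>" using g d by (intro mult_right_mono) auto
  then have "x * ((1 - \<gamma>) * \<delta>) \<le> x * \<delta>" using x(2) by (intro mult_left_mono) auto
  then have y_le: "y \<le> \<delta> * x" using xy by (simp add: mult.commute)
  have Jx: "y / (\<delta> * (1 - \<gamma>) ^ 3) \<le> x ^ 3"
  proof -
    \<comment> \<open>Since \<open>y = x * (1 - \<gamma>) * \<delta>\<close> is at least 1, it is at
      most its cube, which supplies both \<open>x^3\<close> and the three factors
      \<open>1 - \<gamma>\<close>.\<close>
    have "y * \<delta>\<^sup>2 \<le> y ^ 3 * 1"
    proof (intro mult_mono)
      show "y \<le> y ^ 3" using y power_increasing[of 1 3 y] by simp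
      show "\<delta>\<^sup>2 \<le> 1" using d by (simp add: power_le_one)
    qed (use y in auto)
    also have "y ^ 3 = x ^ 3 * ((1 - \<gamma>) ^ 3 * \<delta> ^ 3)" unfolding xy[symmetric] by (simp add: power_mult_distrib)
    finally have "y * \<delta>\<^sup>2 \<le> (x ^ 3 * (\<delta> * (1 - \<gamma>) ^ 3)) * \<delta>\<^sup>2"
      by (simp add: power2_eq_square power3_eq_cube mult_ac)
    then have "y \<le> x ^ 3 * (\<delta> * (1 - \<gamma>) ^ 3)" using d by (simp only: mult_le_cancel_right) auto
    then show ?thesis using g d by (simp add: pos_divide_le_eq)
  qed
  have J': "real (J + 1) \<le> 64 * x ^ 3 + 2" using J Jx by (simp add: y_def)
  have x3: "8 \<le> x ^ 3" using power_mono[OF x(2), of 3] by simp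
  have "real (S * A) * (real n * (4 / x ^ 16 + real (J + 1) * (8 / x ^ 16))) = y * ((4 + 8 * real (J + 1)) / x ^ 16)"
    by (simp add: y_def add_divide_distrib)
  also have "\<dots> \<le> (\<delta> * x) * ((516 * x ^ 3) / x ^ 16)"
    using J' x3 x(2) y y_le d by (intro mult_mono divide_right_mono) auto
  also have "\<dots> = \<delta> * (516 / x ^ 12)"
  proof -
    have "x ^ 16 = x ^ (1 + 3 + 12)" by simp
    also have "\<dots> = x * x ^ 3 * x ^ 12" by (simp only: power_add power_one_right)
    finally show ?thesis using x(2) by simp
  qed
  also have "\<dots> \<le> \<delta> * (1 / 2)"
  proof (intro mult_left_mono)
    have "4096 \<le> x ^ 12" using power_mono[OF x(2), of 12] by simp
    then show "516 / x ^ 12 \<le> 1 / 2" using x(2) by (simp add: divide_le_eq)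
  qed (use d in auto)
  finally show ?thesis by simp
qed

text \<open>Two actions force \<open>x \<ge> 2\<close>, so the logarithm is bounded away from 0:
  this gives \<open>L \<ge> 1\<close> and allows the logarithm to be bounded by its cube.\<close>

lemma error_with_high_probability:
  fixes S A n :: nat and P :: "nat \<Rightarrow> nat \<Rightarrow> nat pmf" and r :: "nat \<Rightarrow> nat \<Rightarrow> real" and \<gamma> \<delta> :: real
  assumes pos: "0 < S" "2 \<le> A" "0 < n"
    and P: "\<And>s a. s < S \<Longrightarrow> a < A \<Longrightarrow> set_pmf (P s a) \<subseteq> {..<S}"
    and r: "\<And>s a. s < S \<Longrightarrow> a < A \<Longrightarrow> 0 \<le> r s a \<and> r s a \<le> 1"
    and g: "0 < \<gamma>" "\<gamma> < 1" and d: "0 < \<delta>" "\<delta> < 1"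
  defines "\<xi> \<equiv> (1 - \<gamma>) / (2 * real n)"
  shows "\<exists>E\<in>sets (data_measure S A n P \<xi>). 1 - \<delta> \<le> measure (data_measure S A n P \<xi>) E \<and>
    (\<forall>X D. (X, D) \<in> E \<longrightarrow> (\<forall>pihat. is_optimal_policy S A (emp_kernel n X) (\<lambda>s a. r s a + D (s, a)) \<gamma> pihat \<longrightarrow>
      sup_norm S (\<lambda>s. disc_value S A (kernel_of P) r \<gamma> pihat s - opt_value S A (kernel_of P) r \<gamma> s)
        \<le> error_bound S A n P r \<gamma> \<delta> X pihat))"
proof -
  define x where "x = real S * real A * real n / ((1 - \<gamma>) * \<delta>)"
  \<comment> \<open>Makes \<open>exp (- L)\<close> equal to \<open>x^(-16)\<close>, small against
    the number of events, which is of order \<open>\<delta> * x^4\<close>.\<close>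
  define L where "L = 16 * ln x"
  have SA: "2 \<le> real S * real A" using pos mult_mono[of 1 "real S" 2 "real A"] by simp
  then have SAn: "2 \<le> real S * real A * real n" using pos mult_mono[of 2 "real S * real A" 1 "real n"] by simp
  have x2: "2 \<le> x"
  proof -
    have "(1 - \<gamma>) * \<delta> \<le> 1" using g d by (intro mult_le_one) auto
    then have "2 * ((1 - \<gamma>) * \<delta>) \<le> real S * real A * real n" using SAn by linarith
    then show ?thesis unfolding x_def using g d by (simp add: pos_le_divide_eq)
  qed
  have ln_x: "1 / 2 \<le> ln x"
  proof -
    have "ln 2 \<le> ln x" using x2 by simp
    moreover have "exp (1 / 2 :: real) \<le> 2"
    proof (rule power2_le_imp_le)
      have "(exp (1 / 2 :: real))\<^sup>2 = exp 1" by (simp add: power2_eq_square flip: exp_add)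
      then show "(exp (1 / 2 :: real))\<^sup>2 \<le> 2\<^sup>2" using exp_le by simp
    qed simp
    then have "1 / 2 \<le> ln (2::real)" by (simp only: ln_ge_iff zero_less_numeral)
    ultimately show ?thesis by linarith
  qed
  have L1: "1 \<le> L" using ln_x by (simp add: L_def)
  have expL: "exp (- L) = 1 / x ^ 16"
  proof -
    have "exp L = x ^ 16" unfolding L_def using x2 exp_of_nat_mult[of 16 "ln x"] by simp
    then show ?thesis by (simp add: exp_minus inverse_eq_divide)
  qed
  have xi: "0 < \<xi>" using g pos by (simp add: \<xi>_def)
  interpret sampled S A \<gamma> n P r \<xi> L
    using pos g P r xi L1 by unfold_locales auto
  \<comment> \<open>A near tie at one pair has probability at most
    \<open>2 * h / ((1 - \<gamma>) * \<xi>)\<close>; this \<open>h\<close> makes the sum over the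
    \<open>S * A\<close> pairs equal to \<open>\<delta> / 2\<close>. The other half is left for the
    deviation events.\<close>
  define h where "h = \<delta> * (1 - \<gamma>) * \<xi> / (4 * (real S * real A))"
  define \<eta> where "\<eta> = h / 4"
  define J where "J = nat \<lceil>2 / ((1 - \<gamma>) * \<eta>)\<rceil>"
  define Bad where "Bad = bad_event (h / (1 - \<gamma>)) \<eta> J"
  have h: "0 < h" unfolding h_def using xi d g pos by (intro divide_pos_pos mult_pos_pos) auto
  have eta: "0 < \<eta>" "2 * \<eta> \<le> h" using h by (auto simp: \<eta>_def)
  have eta_n: "\<eta> \<le> 1 / (8 * real n)"
  proof -
    have "\<delta> * (1 - \<gamma>) * \<xi> \<le> 1 * \<xi>" using d g xi by (intro mult_right_mono mult_le_one) auto
    moreover have "\<xi> \<le> 1 / (2 * real n)" unfolding \<xi>_def using g by (intro divide_right_mono) auto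
    ultimately have "h \<le> (1 / (2 * real n)) / (4 * (real S * real A))"
      unfolding h_def using SA by (intro divide_right_mono) auto
    also have "\<dots> \<le> (1 / (2 * real n)) / 1" using SA by (intro divide_left_mono) auto
    finally show ?thesis by (simp add: \<eta>_def)
  qed
  have J0: "0 \<le> 2 / ((1 - \<gamma>) * \<eta>)" using g eta by simp
  have J1: "2 / (1 - \<gamma>) \<le> \<eta> * real J"
  proof -
    have "2 / ((1 - \<gamma>) * \<eta>) \<le> real J" unfolding J_def by (rule real_nat_ceiling_ge)
    then have "2 / ((1 - \<gamma>) * \<eta>) * \<eta> \<le> real J * \<eta>" using eta by (intro mult_right_mono) auto
    then show ?thesis using eta by (simp add: mult.commute)
  qed
  have J2: "real J \<le> 64 * (real S * real A * real n) / (\<delta> * (1 - \<gamma>) ^ 3) + 1"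
  proof -
    have "real J \<le> 2 / ((1 - \<gamma>) * \<eta>) + 1" unfolding J_def using J0 by linarith
    also have "2 / ((1 - \<gamma>) * \<eta>) = 64 * (real S * real A * real n) / (\<delta> * (1 - \<gamma>) ^ 3)"
      unfolding \<eta>_def h_def \<xi>_def by (simp add: power3_eq_cube mult_ac)
    finally show ?thesis .
  qed
  interpret M: prob_space M by (rule prob_M)
  have w: "0 \<le> h / (1 - \<gamma>)" using h g by simp
  have Bad: "Bad \<in> sets M" unfolding Bad_def by (rule bad_event_probability(1)[OF w])
  have "M.prob Bad \<le> real (S * A) * (2 * (h / (1 - \<gamma>)) / \<xi>) +
      real (S * A) * (real n * (4 / x ^ 16 + real (J + 1) * (8 / x ^ 16)))"
    using bad_event_probability(2)[OF w, of \<eta> J] unfolding Bad_def expL by (simp add: distrib_left)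
  also have "real (S * A) * (2 * (h / (1 - \<gamma>)) / \<xi>) = \<delta> / 2"
    unfolding h_def using xi g pos by (simp add: field_simps)
  also have "real (S * A) * (real n * (4 / x ^ 16 + real (J + 1) * (8 / x ^ 16))) \<le> \<delta> / 2"
    using pos by (intro failure_probability_arithmetic[OF pos(1) _ pos(3) g d x_def x2 J2]) auto
  finally have prob_Bad: "M.prob Bad \<le> \<delta>" by simp
  show ?thesis
  proof (intro bexI conjI allI impI)
    show "space M - Bad \<in> sets M" using Bad by auto
    show "1 - \<delta> \<le> measure M (space M - Bad)" using M.prob_compl[OF Bad] prob_Bad by simp
    fix X D pihat
    assume \<omega>: "(X, D) \<in> space M - Bad"
      and opt: "is_optimal_policy S A (emp_kernel n X) (\<lambda>s a. r s a + D (s, a)) \<gamma> pihat"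
    define m where "m = span_norm S (opt_value S A (kernel_of P) r \<gamma>)
      + min (span_norm S (disc_value S A (emp_kernel n X) r \<gamma> pihat))
            (span_norm S (disc_value S A (kernel_of P) r \<gamma> pihat))"
    have m: "0 \<le> m" unfolding m_def using span_norm_nonneg[OF pos(1)] by simp
    have "26 / (1 - \<gamma>) * sqrt (L * (m + 4) / real n) = 1 / (1 - \<gamma>) * sqrt (676 * (L * (m + 4) / real n))"
      using real_sqrt_mult[of 676 "L * (m + 4) / real n"] real_sqrt_abs[of 26] by simp
    also have "\<dots> \<le> error_bound S A n P r \<gamma> \<delta> X pihat"
      unfolding error_bound_def m_def[symmetric] x_def[symmetric]
    proof (intro mult_left_mono real_sqrt_le_mono)
      \<comment> \<open>From \<open>ln x \<ge> 1 / 2\<close> the single logarithm is at most 4 times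
        its cube, and \<open>m + 4 \<le> 4 * (m + 1)\<close>. The constant is then 26^2 * 16 * 4 * 4
        = 173056, rounded up to 200000.\<close>
      have "(1 / 2)\<^sup>2 \<le> (ln x)\<^sup>2" using ln_x by (intro power_mono) auto
      then have "1 / 4 * ln x \<le> (ln x)\<^sup>2 * ln x" using ln_x by (intro mult_right_mono) (auto simp: power2_eq_square)
      then have ln3: "ln x \<le> 4 * (ln x) ^ 3" by (simp add: power2_eq_square power3_eq_cube)
      have "676 * (L * (m + 4)) = 676 * 16 * (ln x * (m + 4))" by (simp add: L_def)
      also have "ln x * (m + 4) \<le> (4 * (ln x) ^ 3) * (4 * (m + 1))"
        using ln3 ln_x m by (intro mult_mono) auto
      also have "676 * 16 * ((4 * (ln x) ^ 3) * (4 * (m + 1))) \<le> 200000 * ((ln x) ^ 3 * (m + 1))"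
        using ln_x m by simp
      finally have "676 * (L * (m + 4)) \<le> 200000 * ((ln x) ^ 3 * (m + 1))" by simp
      then have "676 * (L * (m + 4)) / real n \<le> 200000 * ((ln x) ^ 3 * (m + 1)) / real n"
        by (intro divide_right_mono) auto
      then show "676 * (L * (m + 4) / real n) \<le> 200000 * (ln x) ^ 3 / real n * (m + 1)" by (simp add: mult_ac)
    qed (use g in auto)
    finally have bound: "26 / (1 - \<gamma>) * sqrt (L * (m + 4) / real n) \<le> error_bound S A n P r \<gamma> \<delta> X pihat" .
    have \<omega>': "(X, D) \<in> space M" "(X, D) \<notin> bad_event (h / (1 - \<gamma>)) \<eta> J" using \<omega> by (auto simp: Bad_def)
    have xi_eq: "\<xi> = (1 - \<gamma>) / (2 * real n)" by (simp add: \<xi>_def)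
    note err = sample_error_bound[OF \<omega>' xi_eq L1 eta eta_n J1 opt, folded m_def]
    show "sup_norm S (\<lambda>s. disc_value S A (kernel_of P) r \<gamma> pihat s - opt_value S A (kernel_of P) r \<gamma> s)
        \<le> error_bound S A n P r \<gamma> \<delta> X pihat"
    proof (rule sup_norm_le[OF pos(1)])
      fix s assume "s < S"
      from err[OF this] bound show "\<bar>disc_value S A (kernel_of P) r \<gamma> pihat s - opt_value S A (kernel_of P) r \<gamma> s\<bar>
        \<le> error_bound S A n P r \<gamma> \<delta> X pihat" by linarith
    qed
  qed
qed

text \<open>With one action the argument of the logarithm can be arbitrarily close to 1, where the
  cube falls below the logarithm itself. But all policies then coincide and the error is 0, so
  nonnegativity of the bound is enough.\<close>

lemma single_action_error:
  fixes S n :: nat and P :: "nat \<Rightarrow> nat \<Rightarrow> nat pmf" and r :: "nat \<Rightarrow> nat \<Rightarrow> real" and \<gamma> \<delta> :: real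
  assumes pos: "0 < S" "0 < n"
    and P: "\<And>s a. s < S \<Longrightarrow> a < 1 \<Longrightarrow> set_pmf (P s a) \<subseteq> {..<S}"
    and g: "0 < \<gamma>" "\<gamma> < 1" and d: "0 < \<delta>" "\<delta> < 1" and pol: "is_policy S 1 pihat"
  shows "sup_norm S (\<lambda>s. disc_value S 1 (kernel_of P) r \<gamma> pihat s - opt_value S 1 (kernel_of P) r \<gamma> s)
    \<le> error_bound S 1 n P r \<gamma> \<delta> X pihat"
proof (rule sup_norm_le[OF pos(1)])
  fix s assume s: "s < S"
  have "disc_value S 1 (kernel_of P) r \<gamma> pihat s = opt_value S 1 (kernel_of P) r \<gamma> s"
    using kernel_kernel_of[of S 1 P] P by (intro single_action_value[OF pos(1) g _ pol s]) auto
  moreover have "0 \<le> error_bound S 1 n P r \<gamma> \<delta> X pihat"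
  proof -
    have "1 \<le> real S * real n" using pos mult_mono[of 1 "real S" 1 "real n"] by simp
    moreover have "(1 - \<gamma>) * \<delta> \<le> 1" using g d by (intro mult_le_one) auto
    ultimately have "1 \<le> real S * real 1 * real n / ((1 - \<gamma>) * \<delta>)"
      using g d by (simp add: pos_le_divide_eq)
    then have "0 \<le> ln (real S * real 1 * real n / ((1 - \<gamma>) * \<delta>))" by (rule ln_ge_zero)
    then show ?thesis unfolding error_bound_def
      using g span_norm_nonneg[OF pos(1)]
      by (intro mult_nonneg_nonneg real_sqrt_ge_zero divide_nonneg_nonneg add_nonneg_nonneg zero_le_power) auto
  qed
  ultimately show "\<bar>disc_value S 1 (kernel_of P) r \<gamma> pihat s - opt_value S 1 (kernel_of P) r \<gamma> s\<bar>
    \<le> error_bound S 1 n P r \<gamma> \<delta> X pihat" by simp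
qed

theorem mainTheorem10:
  shows "\<exists>C::real. C > 0 \<and>
    (\<forall>(S::nat) (A::nat) (n::nat) (P :: nat \<Rightarrow> nat \<Rightarrow> nat pmf) (r :: nat \<Rightarrow> nat \<Rightarrow> real) (\<gamma>::real) (\<delta>::real).
       0 < S \<longrightarrow> 0 < A \<longrightarrow> 0 < n \<longrightarrow>
       (\<forall>s<S. \<forall>a<A. set_pmf (P s a) \<subseteq> {..<S}) \<longrightarrow>
       (\<forall>s<S. \<forall>a<A. 0 \<le> r s a \<and> r s a \<le> 1) \<longrightarrow>
       0 < \<gamma> \<longrightarrow> \<gamma> < 1 \<longrightarrow> 0 < \<delta> \<longrightarrow> \<delta> < 1 \<longrightarrow>
       (let \<xi> = (1 - \<gamma>) / (2 * real n); M = data_measure S A n P \<xi> in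
        \<exists>E \<in> sets M. measure M E \<ge> 1 - \<delta> \<and>
          (\<forall>X D. (X, D) \<in> E \<longrightarrow>
             (\<forall>pihat. is_optimal_policy S A (emp_kernel n X) (\<lambda>s a. r s a + D (s, a)) \<gamma> pihat \<longrightarrow>
                sup_norm S (\<lambda>s. disc_value S A (kernel_of P) r \<gamma> pihat s - opt_value S A (kernel_of P) r \<gamma> s)
                \<le> 1 / (1 - \<gamma>) *
                  sqrt (C * (ln (real S * real A * real n / ((1 - \<gamma>) * \<delta>))) ^ 3 / real n *
                    (span_norm S (opt_value S A (kernel_of P) r \<gamma>)
                     + min (span_norm S (disc_value S A (emp_kernel n X) r \<gamma> pihat))
                           (span_norm S (disc_value S A (kernel_of P) r \<gamma> pihat))
                     + 1))))))"
proof (intro exI[of _ 200000] conjI allI impI)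
  fix S A n :: nat and P :: "nat \<Rightarrow> nat \<Rightarrow> nat pmf" and r :: "nat \<Rightarrow> nat \<Rightarrow> real" and \<gamma> \<delta> :: real
  assume pos: "0 < S" "0 < A" "0 < n"
    and P: "\<forall>s<S. \<forall>a<A. set_pmf (P s a) \<subseteq> {..<S}"
    and r: "\<forall>s<S. \<forall>a<A. 0 \<le> r s a \<and> r s a \<le> 1"
    and g: "0 < \<gamma>" "\<gamma> < 1" and d: "0 < \<delta>" "\<delta> < 1"
  define \<xi> where "\<xi> = (1 - \<gamma>) / (2 * real n)"
  have "\<exists>E\<in>sets (data_measure S A n P \<xi>). 1 - \<delta> \<le> measure (data_measure S A n P \<xi>) E \<and>
    (\<forall>X D. (X, D) \<in> E \<longrightarrow> (\<forall>pihat. is_optimal_policy S A (emp_kernel n X) (\<lambda>s a. r s a + D (s, a)) \<gamma> pihat \<longrightarrow>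
      sup_norm S (\<lambda>s. disc_value S A (kernel_of P) r \<gamma> pihat s - opt_value S A (kernel_of P) r \<gamma> s)
        \<le> error_bound S A n P r \<gamma> \<delta> X pihat))"
  proof (cases "A = 1")
    case False
    then show ?thesis
      unfolding \<xi>_def using pos P r by (intro error_with_high_probability g d) auto
  next
    case True
    have xi: "0 < \<xi>" using pos g by (simp add: \<xi>_def)
    interpret sampled S A \<gamma> n P r \<xi> 1
      using pos g P r xi by unfold_locales auto
    interpret M: prob_space M by (rule prob_M)
    have "sup_norm S (\<lambda>s. disc_value S A (kernel_of P) r \<gamma> pihat s - opt_value S A (kernel_of P) r \<gamma> s)
        \<le> error_bound S A n P r \<gamma> \<delta> X pihat"
      if "is_optimal_policy S A K r' \<gamma> pihat" for X K r' pihat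
      using that pos P g d unfolding True is_optimal_policy_def by (intro single_action_error) auto
    then show ?thesis using M.prob_space d by (intro bexI[of _ "space M"]) auto
  qed
  then show "let \<xi> = (1 - \<gamma>) / (2 * real n); M = data_measure S A n P \<xi> in
        \<exists>E \<in> sets M. measure M E \<ge> 1 - \<delta> \<and>
          (\<forall>X D. (X, D) \<in> E \<longrightarrow>
             (\<forall>pihat. is_optimal_policy S A (emp_kernel n X) (\<lambda>s a. r s a + D (s, a)) \<gamma> pihat \<longrightarrow>
                sup_norm S (\<lambda>s. disc_value S A (kernel_of P) r \<gamma> pihat s - opt_value S A (kernel_of P) r \<gamma> s)
                \<le> 1 / (1 - \<gamma>) *
                  sqrt (200000 * (ln (real S * real A * real n / ((1 - \<gamma>) * \<delta>))) ^ 3 / real n *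
                    (span_norm S (opt_value S A (kernel_of P) r \<gamma>)
                     + min (span_norm S (disc_value S A (emp_kernel n X) r \<gamma> pihat))
                           (span_norm S (disc_value S A (kernel_of P) r \<gamma> pihat))
                     + 1))))"
    unfolding Let_def error_bound_def \<xi>_def .
qed simp

end
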